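(* Let $\sigma:\mathbb{R}\to\mathbb{R}$ be a sigmoid activation function and let $\Omega_X\subseteq\mathbb{R}^m$, $\Omega_Y\subseteq\mathbb{R}^n$ be bounded domains, where $\Omega_X$ satisfies the cone property and has piecewise $C^1$ boundary. Let $s>\frac m2$ and let $F:\mathcal{D}(F)\subseteq C(\overline{\Omega_X})\to L^2(\Omega_Y)$ be a continuous operator (with respect to $\|\cdot\|_{L^\infty(\Omega_X)}$ on $\mathcal{D}(F)$), where $\mathcal{D}(F)$ is bounded and weakly closed with respect to the $H^s(\Omega_X)$ norm. Then for every $\varepsilon>0$ there exist positive integers $J,K,L$, and for $j=1,\dots,J$, $k=1,\dots,K$, $l=1,\dots,L$ real parameters $w_{j,k,l},\theta_{j,k},\zeta_j\in\mathbb{R}$, vectors $\vec w_j\in\mathbb{R}^n$ and sampling points $\vec s_l\in\Omega_X$, all depending only on $\varepsilon$ and not on $x$, such that for every $x\in\mathcal{D}(F)$ there exist coefficients $\alpha_{j,k}=\alpha_{j,k}(x,\varepsilon)\in\mathbb{R}$ such that $$F_{\mathtt n}[x](\vec t):=\sum_{j=1}^{J}\sum_{k=1}^{K}\alpha_{j,k}\,\sigma\Big(\sum_{l=1}^{L}w_{j,k,l}\,x(\vec s_l)+\theta_{j,k}\Big)\,\sigma\big(\vec w_j^{T}\vec t+\zeta_j\big),\qquad \vec t\in\Omega_Y,$$ satisfies $\|F[x]-F_{\mathtt n}[x]\|_{L^2(\Omega_Y)}\le\varepsilon$.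
   Context: A function $\sigma:\mathbb{R}\to\mathbb{R}$ is called sigmoid (sigmoidal) if it is strictly monotonically increasing, differentiable, and $\sigma(t)\to1$ as $t\to+\infty$, $\sigma(t)\to0$ as $t\to-\infty$. The cone property is the usual (interior) cone condition for domains used in Sobolev embedding theorems. That $\mathcal{D}(F)$ is bounded and weakly closed with respect to the $H^s(\Omega_X)$ norm means that $\mathcal{D}(F)\subseteq H^s(\Omega_X)$ is norm-bounded in $H^s(\Omega_X)$ and closed under weak convergence in $H^s(\Omega_X)$; since $s>m/2$, elements of $H^s(\Omega_X)$ are identified with their continuous representatives in $C(\overline{\Omega_X})$. *)

theory Defs
  imports "HOL-Analysis.Analysis" "HOL-Probability.Essential_Supremum"
begin

definition sigmoid :: "(real \<Rightarrow> real) \<Rightarrow> bool" where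
  "sigmoid \<sigma> \<longleftrightarrow> strict_mono \<sigma> \<and> (\<forall>t. \<sigma> differentiable at t)
     \<and> (\<sigma> \<longlongrightarrow> 1) at_top \<and> (\<sigma> \<longlongrightarrow> 0) at_bot"

definition bounded_domain :: "'a::euclidean_space set \<Rightarrow> bool" where
  "bounded_domain \<Omega> \<longleftrightarrow> \<Omega> \<noteq> {} \<and> open \<Omega> \<and> connected \<Omega> \<and> bounded \<Omega>"

text \<open>The cone with vertex \<open>x\<close>, axis the unit vector \<open>\<xi>\<close>, height \<open>\<rho>\<close> and half-angle \<open>\<theta>\<close>.
  The cones with fixed \<open>\<rho>\<close> and \<open>\<theta>\<close> are exactly those congruent to a given one.\<close>

definition finite_cone :: "'a::euclidean_space \<Rightarrow> 'a \<Rightarrow> real \<Rightarrow> real \<Rightarrow> 'a set" where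
  "finite_cone x \<xi> \<rho> \<theta> = {y. norm (y - x) \<le> \<rho> \<and> cos \<theta> * norm (y - x) \<le> (y - x) \<bullet> \<xi>}"

definition cone_property :: "'a::euclidean_space set \<Rightarrow> bool" where
  "cone_property \<Omega> \<longleftrightarrow> (\<exists>\<rho> \<theta>. 0 < \<rho> \<and> 0 < \<theta> \<and> \<theta> \<le> pi / 2 \<and>
     (\<forall>x\<in>\<Omega>. \<exists>\<xi>. norm \<xi> = 1 \<and> finite_cone x \<xi> \<rho> \<theta> \<subseteq> \<Omega>))"

definition C1_hypersurface :: "'a::euclidean_space set \<Rightarrow> bool" where
  "C1_hypersurface S \<longleftrightarrow> (\<forall>p\<in>S. \<exists>U g G. open U \<and> p \<in> U \<and>
     (\<forall>x\<in>U. (g has_derivative (\<lambda>h. G x \<bullet> h)) (at x) \<and> G x \<noteq> 0) \<and>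
     continuous_on U G \<and> S \<inter> U = {x\<in>U. g x = (0::real)})"

text \<open>The boundary consists of finitely many faces, disjoint and relatively open in it, which
  together are dense in it; each face is \<open>C\<^sup>1\<close> up to its edges, that is, its closure lies in a
  \<open>C\<^sup>1\<close> hypersurface without boundary.\<close>

definition piecewise_C1_boundary :: "'a::euclidean_space set \<Rightarrow> bool" where
  "piecewise_C1_boundary \<Omega> \<longleftrightarrow> (\<exists>\<G>. finite \<G> \<and> pairwise disjnt \<G> \<and>
     frontier \<Omega> = (\<Union>\<Gamma>\<in>\<G>. closure \<Gamma>) \<and>
     (\<forall>\<Gamma>\<in>\<G>. openin (top_of_set (frontier \<Omega>)) \<Gamma> \<and>
        (\<exists>S. C1_hypersurface S \<and> closure \<Gamma> \<subseteq> S)))"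

text \<open>Functions rather than classes modulo null sets represent the elements of the spaces below,
  so \<open>L2_norm\<close> and \<open>sobolev_norm\<close> are only seminorms. Values outside \<open>\<Omega>\<close> play no role.\<close>

definition L2_space :: "'a::euclidean_space set \<Rightarrow> ('a \<Rightarrow> real) set" where
  "L2_space \<Omega> = {f. f \<in> borel_measurable (lebesgue_on \<Omega>) \<and>
     integrable (lebesgue_on \<Omega>) (\<lambda>t. (f t)\<^sup>2)}"

definition L2_norm :: "'a::euclidean_space set \<Rightarrow> ('a \<Rightarrow> real) \<Rightarrow> real" where
  "L2_norm \<Omega> f = sqrt (LINT t|lebesgue_on \<Omega>. (f t)\<^sup>2)"

definition Linf_norm :: "'a::euclidean_space set \<Rightarrow> ('a \<Rightarrow> real) \<Rightarrow> ereal" where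
  "Linf_norm \<Omega> f = esssup (lebesgue_on \<Omega>) (\<lambda>t. ereal \<bar>f t\<bar>)"

definition partial :: "'m \<Rightarrow> (real^'m \<Rightarrow> real) \<Rightarrow> real^'m \<Rightarrow> real" where
  "partial i f x = frechet_derivative f (at x) (axis i 1)"

text \<open>Differentiability of all iterated partial derivatives makes them all continuous,
  so this is \<open>C\<^sup>\<infinity>\<close>.\<close>

definition test_functions :: "(real^'m) set \<Rightarrow> (real^'m \<Rightarrow> real) set" where
  "test_functions \<Omega> = {\<phi>. (\<forall>is. \<forall>x. foldr partial is \<phi> differentiable at x) \<and>
     compact (closure {x. \<phi> x \<noteq> 0}) \<and> closure {x. \<phi> x \<noteq> 0} \<subseteq> \<Omega>}"

text \<open>A multi-index assigns to every coordinate a number of differentiations. They are carried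
  out in an arbitrary fixed order of the coordinates; on test functions the order is immaterial.\<close>

definition multi_order :: "('m::finite \<Rightarrow> nat) \<Rightarrow> nat" where
  "multi_order \<alpha> = (\<Sum>i\<in>UNIV. \<alpha> i)"

definition multi_partial :: "('m \<Rightarrow> nat) \<Rightarrow> (real^'m \<Rightarrow> real) \<Rightarrow> real^'m \<Rightarrow> real" where
  "multi_partial \<alpha> =
     foldr (\<lambda>i. partial i ^^ \<alpha> i) (SOME is. distinct is \<and> set is = UNIV)"

definition locally_integrable :: "'a::euclidean_space set \<Rightarrow> ('a \<Rightarrow> real) \<Rightarrow> bool" where
  "locally_integrable \<Omega> u \<longleftrightarrow> (\<forall>K. compact K \<and> K \<subseteq> \<Omega> \<longrightarrow> set_integrable lebesgue K u)"

definition is_weak_deriv ::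
    "(real^'m) set \<Rightarrow> ('m \<Rightarrow> nat) \<Rightarrow> (real^'m \<Rightarrow> real) \<Rightarrow> (real^'m \<Rightarrow> real) \<Rightarrow> bool" where
  "is_weak_deriv \<Omega> \<alpha> u v \<longleftrightarrow> locally_integrable \<Omega> u \<and> locally_integrable \<Omega> v \<and>
     (\<forall>\<phi>\<in>test_functions \<Omega>. (LINT x|lebesgue_on \<Omega>. u x * multi_partial \<alpha> \<phi> x)
        = (-1) ^ multi_order \<alpha> * (LINT x|lebesgue_on \<Omega>. v x * \<phi> x))"

text \<open>Weak derivatives on open sets are unique up to null sets; the choice is immaterial.\<close>

definition weak_deriv ::
    "(real^'m) set \<Rightarrow> ('m \<Rightarrow> nat) \<Rightarrow> (real^'m \<Rightarrow> real) \<Rightarrow> real^'m \<Rightarrow> real" where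
  "weak_deriv \<Omega> \<alpha> u = (SOME v. is_weak_deriv \<Omega> \<alpha> u v)"

text \<open>Sobolev-Slobodeckij spaces \<open>H\<^sup>s(\<Omega>) = W\<^sup>s\<^sup>,\<^sup>2(\<Omega>)\<close> for real \<open>s \<ge> 0\<close>: with \<open>s = k + r\<close>,
  \<open>k\<close> an integer and \<open>0 \<le> r < 1\<close>, all weak derivatives up to order \<open>k\<close> are in \<open>L\<^sup>2\<close> and, if
  \<open>r > 0\<close>, those of order \<open>k\<close> have a finite Gagliardo seminorm of exponent \<open>r\<close>.\<close>

definition gagliardo_kernel :: "real \<Rightarrow> (real^'m \<Rightarrow> real) \<Rightarrow> (real^'m) \<times> (real^'m) \<Rightarrow> real" where
  "gagliardo_kernel r v =
     (\<lambda>(x, y). (v x - v y)\<^sup>2 / norm (x - y) powr (real CARD('m) + 2 * r))"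

definition sobolev :: "real \<Rightarrow> (real^'m) set \<Rightarrow> (real^'m \<Rightarrow> real) set" where
  "sobolev s \<Omega> = {u.
     (\<forall>\<alpha>. multi_order \<alpha> \<le> nat \<lfloor>s\<rfloor> \<longrightarrow> (\<exists>v\<in>L2_space \<Omega>. is_weak_deriv \<Omega> \<alpha> u v)) \<and>
     (0 < frac s \<longrightarrow> (\<forall>\<alpha>. multi_order \<alpha> = nat \<lfloor>s\<rfloor> \<longrightarrow>
        integrable (lebesgue_on \<Omega> \<Otimes>\<^sub>M lebesgue_on \<Omega>)
          (gagliardo_kernel (frac s) (weak_deriv \<Omega> \<alpha> u))))}"

definition sobolev_norm :: "real \<Rightarrow> (real^'m) set \<Rightarrow> (real^'m \<Rightarrow> real) \<Rightarrow> real" where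
  "sobolev_norm s \<Omega> u = sqrt (
     (\<Sum>\<alpha> | multi_order \<alpha> \<le> nat \<lfloor>s\<rfloor>. (L2_norm \<Omega> (weak_deriv \<Omega> \<alpha> u))\<^sup>2) +
     (if 0 < frac s then
        (\<Sum>\<alpha> | multi_order \<alpha> = nat \<lfloor>s\<rfloor>.
           integral\<^sup>L (lebesgue_on \<Omega> \<Otimes>\<^sub>M lebesgue_on \<Omega>)
             (gagliardo_kernel (frac s) (weak_deriv \<Omega> \<alpha> u)))
      else 0))"

text \<open>Boundedness of a functional makes it respect equality almost everywhere.\<close>

definition sobolev_dual :: "real \<Rightarrow> (real^'m) set \<Rightarrow> ((real^'m \<Rightarrow> real) \<Rightarrow> real) set" where
  "sobolev_dual s \<Omega> = {\<ll>.
     (\<forall>u\<in>sobolev s \<Omega>. \<forall>v\<in>sobolev s \<Omega>. \<ll> (\<lambda>t. u t + v t) = \<ll> u + \<ll> v) \<and>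
     (\<forall>c. \<forall>u\<in>sobolev s \<Omega>. \<ll> (\<lambda>t. c * u t) = c * \<ll> u) \<and>
     (\<exists>C. \<forall>u\<in>sobolev s \<Omega>. \<bar>\<ll> u\<bar> \<le> C * sobolev_norm s \<Omega> u)}"

definition sobolev_weak_lim ::
    "real \<Rightarrow> (real^'m) set \<Rightarrow> (nat \<Rightarrow> real^'m \<Rightarrow> real) \<Rightarrow> (real^'m \<Rightarrow> real) \<Rightarrow> bool" where
  "sobolev_weak_lim s \<Omega> X u \<longleftrightarrow> (\<forall>\<ll>\<in>sobolev_dual s \<Omega>. (\<lambda>k. \<ll> (X k)) \<longlonglongrightarrow> \<ll> u)"

definition sobolev_bounded :: "real \<Rightarrow> (real^'m) set \<Rightarrow> (real^'m \<Rightarrow> real) set \<Rightarrow> bool" where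
  "sobolev_bounded s \<Omega> D \<longleftrightarrow> D \<subseteq> sobolev s \<Omega> \<and> (\<exists>B. \<forall>x\<in>D. sobolev_norm s \<Omega> x \<le> B)"

text \<open>\<open>D\<close> is meant to consist of continuous representatives, hence the limit \<open>u\<close>, an arbitrary
  representative of its class, only has to agree almost everywhere with a member of \<open>D\<close>.
  For the bounded sets considered here sequential closedness and closedness in the weak topology
  of the separable Hilbert space \<open>H\<^sup>s(\<Omega>)\<close> coincide.\<close>

definition sobolev_weakly_closed :: "real \<Rightarrow> (real^'m) set \<Rightarrow> (real^'m \<Rightarrow> real) set \<Rightarrow> bool" where
  "sobolev_weakly_closed s \<Omega> D \<longleftrightarrow> D \<subseteq> sobolev s \<Omega> \<and>
     (\<forall>X u. (\<forall>k. X k \<in> D) \<and> u \<in> sobolev s \<Omega> \<and> sobolev_weak_lim s \<Omega> X u \<longrightarrow>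
        (\<exists>x\<in>D. AE t in lebesgue_on \<Omega>. x t = u t))"

text \<open>Continuity from \<open>L\<^sup>\<infinity>(\<Omega>)\<close> to \<open>L\<^sup>2(\<Omega>')\<close>; in particular \<open>F\<close> maps functions that agree
  on \<open>\<Omega>\<close> to functions that agree almost everywhere on \<open>\<Omega>'\<close>.\<close>

definition continuous_operator_on ::
    "(real^'m) set \<Rightarrow> (real^'n) set \<Rightarrow> (real^'m \<Rightarrow> real) set \<Rightarrow>
     ((real^'m \<Rightarrow> real) \<Rightarrow> real^'n \<Rightarrow> real) \<Rightarrow> bool" where
  "continuous_operator_on \<Omega> \<Omega>' D F \<longleftrightarrow>
     (\<forall>x\<in>D. \<forall>e>0. \<exists>d>0. \<forall>y\<in>D. Linf_norm \<Omega> (\<lambda>t. y t - x t) < ereal d \<longrightarrow>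
        L2_norm \<Omega>' (\<lambda>t. F y t - F x t) < e)"

end

theory Submission
  imports Defs "HOL-Library.Diagonal_Subsequence"
begin

text \<open>The coefficients may depend on \<open>x\<close> in an arbitrary way, so it is enough that \<open>F\<close> maps \<open>D\<close> onto
  a totally bounded subset of \<open>L\<^sup>2\<close>: the members of a finite net are then approximated by shallow
  networks in \<open>t\<close>, and the first factors \<open>\<sigma>(\<dots>)\<close> are made equal to the nonzero constant \<open>\<sigma>(0)\<close>.

  Total boundedness follows from sequential compactness of \<open>D\<close> in the supremum norm. Let \<open>\<Phi>\<close> be a
  tensor product of bumps with integral \<open>1\<close>, supported in a box such that \<open>x\<close> plus the box lies in the
  cone at \<open>x\<close>. With suitable one-dimensional factors the derivative with respect to \<open>h\<close> of the average of
  \<open>u\<close> against \<open>h\<^sup>-\<^sup>m \<Phi>((\<cdot> - x)/h)\<close> involves only the pure weak derivatives \<open>\<partial>\<^sub>i\<^sup>k u\<close>, paired with functions of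
  integral zero. By Cauchy-Schwarz it is \<open>O(h\<close> to the power \<open>s - m/2 - 1)\<close> times the Sobolev norm, hence the
  averages converge to \<open>u(x)\<close> uniformly in \<open>x\<close>, and on a bounded set the supremum norm is controlled, up
  to a small error, by finitely many integrals of \<open>u\<close>. A diagonal argument yields a uniformly convergent
  subsequence. Its limit is also the weak limit in \<open>H\<^sup>s\<close>, because midpoint combinations of almost
  minimal norm converge strongly, and so it agrees almost everywhere with a member of \<open>D\<close>.\<close>

section \<open>Smooth functions of one variable\<close>

text \<open>The shape of the kernels has the following origin. In the scale derivative of a product
  kernel one factor f at a time is replaced by A f = - (t f)', so factors are wanted for which A f
  is a derivative of order k + 1. Of these derivatives k are moved to u by the definition of the
  weak derivative, and they are pure because the other factors stay untouched. The one that is left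
  forces integral zero, so v(y) may be replaced by the differences v(y) - v(z) with z in the box,
  which is what the Gagliardo seminorm measures. The exponent is a count: Cauchy-Schwarz on a box of
  side of order h gives h^(m/2 + r), the integrations by parts give h^k, normalization and chain
  rule cost h^(m + 1). The total exceeds -1 exactly when k + r > m/2. Weak limits need the detour
  through midpoints because a member of the dual is only known to be linear and bounded in norm.
  Uniform convergence tells nothing about its values; norm convergence does, and a one-sided
  inequality for a linear functional survives midpoints.\<close>

primrec diff_times :: "nat \<Rightarrow> (real \<Rightarrow> real) \<Rightarrow> bool" where
  "diff_times 0 f \<longleftrightarrow> True"
| "diff_times (Suc n) f \<longleftrightarrow> (\<exists>f'. (\<forall>t. (f has_real_derivative f' t) (at t)) \<and> diff_times n f')"

text \<open>Since \<open>diff_times\<close> asks only for some derivative at each stage, closure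
  properties follow by exhibiting one; \<open>smooth_deriv\<close> then passes to
  \<open>deriv\<close>, which can be iterated as an operator.\<close>

definition smooth :: "(real \<Rightarrow> real) \<Rightarrow> bool" where
  "smooth f \<longleftrightarrow> (\<forall>n. diff_times n f)"

lemma diff_times_SucD: "diff_times (Suc n) f \<Longrightarrow> diff_times n f"
proof (induction n arbitrary: f)
  case (Suc n)
  then obtain f' where "\<And>t. (f has_real_derivative f' t) (at t)" "diff_times (Suc n) f'" by auto
  with Suc.IH[of f'] show ?case by auto
qed simp

lemma diff_times_add: "diff_times n f \<Longrightarrow> diff_times n g \<Longrightarrow> diff_times n (\<lambda>t. f t + g t)"
proof (induction n arbitrary: f g)
  case (Suc n)
  then obtain f' g' where "\<And>t. (f has_real_derivative f' t) (at t)" "diff_times n f'"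
    "\<And>t. (g has_real_derivative g' t) (at t)" "diff_times n g'" by auto
  then show ?case
    unfolding diff_times.simps
    by (intro exI[of _ "\<lambda>t. f' t + g' t"] conjI allI DERIV_add Suc.IH)
qed simp

lemma diff_times_mult: "diff_times n f \<Longrightarrow> diff_times n g \<Longrightarrow> diff_times n (\<lambda>t. f t * g t)"
proof (induction n arbitrary: f g)
  case (Suc n)
  then obtain f' g' where d: "\<And>t. (f has_real_derivative f' t) (at t)" "diff_times n f'"
    "\<And>t. (g has_real_derivative g' t) (at t)" "diff_times n g'" by auto
  have "diff_times n (\<lambda>t. f' t * g t + g' t * f t)"
    by (rule diff_times_add; rule Suc.IH; (rule d | rule Suc.prems[THEN diff_times_SucD]))
  moreover have "\<forall>t. ((\<lambda>t. f t * g t) has_real_derivative (f' t * g t + g' t * f t)) (at t)"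
    using d by (auto intro: DERIV_mult)
  ultimately show ?case by auto
qed simp

lemma diff_times_const: "diff_times n (\<lambda>t. c)"
proof (induction n arbitrary: c)
  case (Suc n)
  show ?case
    unfolding diff_times.simps by (intro exI[of _ "\<lambda>t. 0"] conjI allI DERIV_const Suc.IH)
qed simp

lemma diff_times_affine: "diff_times n f \<Longrightarrow> diff_times n (\<lambda>t. f (a * t + b))"
proof (induction n arbitrary: f)
  case (Suc n)
  then obtain f' where d: "\<And>t. (f has_real_derivative f' t) (at t)" "diff_times n f'" by auto
  have "diff_times n (\<lambda>t. f' (a * t + b) * a)"
    by (intro diff_times_mult diff_times_const Suc.IH d)
  moreover have "\<forall>t. ((\<lambda>t. f (a * t + b)) has_real_derivative (f' (a * t + b) * a)) (at t)"
  proof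
    fix t
    show "((\<lambda>t. f (a * t + b)) has_real_derivative (f' (a * t + b) * a)) (at t)"
      by (rule DERIV_chain2[OF d(1)]) (auto intro!: derivative_eq_intros)
  qed
  ultimately show ?case by auto
qed simp

lemma smooth_add: "smooth f \<Longrightarrow> smooth g \<Longrightarrow> smooth (\<lambda>t. f t + g t)"
  and smooth_mult: "smooth f \<Longrightarrow> smooth g \<Longrightarrow> smooth (\<lambda>t. f t * g t)"
  and smooth_const: "smooth (\<lambda>t. c)"
  and smooth_affine: "smooth f \<Longrightarrow> smooth (\<lambda>t. f (a * t + b))"
  by (simp_all add: smooth_def diff_times_add diff_times_mult diff_times_const diff_times_affine)

lemma smooth_ident: "smooth (\<lambda>t. t)"
  unfolding smooth_def
proof
  show "diff_times n (\<lambda>t. t)" for n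
  proof (cases n)
    case (Suc k)
    show ?thesis
      unfolding Suc diff_times.simps by (intro exI[of _ "\<lambda>t. 1"] conjI allI DERIV_ident diff_times_const)
  qed simp
qed

lemma smooth_minus: "smooth f \<Longrightarrow> smooth (\<lambda>t. - f t)"
  using smooth_mult[OF smooth_const[of "-1"], of f] by simp

lemma smooth_deriv:
  assumes "smooth f"
  shows "smooth (deriv f)" and "(f has_real_derivative deriv f t) (at t)"
proof -
  have d: "(f has_real_derivative deriv f t) (at t)" for t
    using assms[unfolded smooth_def, rule_format, of "Suc 0"] by simp (metis DERIV_imp_deriv)
  then show "(f has_real_derivative deriv f t) (at t)" .
  show "smooth (deriv f)"
    unfolding smooth_def
  proof
    fix n
    obtain f' where f': "\<And>t. (f has_real_derivative f' t) (at t)" "diff_times n f'"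
      using assms[unfolded smooth_def, rule_format, of "Suc n"] by auto
    then have "f' = deriv f" by (metis DERIV_imp_deriv ext)
    with f' show "diff_times n (deriv f)" by simp
  qed
qed

lemma smooth_deriv_funpow: "smooth f \<Longrightarrow> smooth ((deriv ^^ n) f)"
  by (induction n) (auto intro: smooth_deriv)

lemma smooth_continuous: "smooth f \<Longrightarrow> continuous_on A f"
  by (meson DERIV_continuous continuous_at_imp_continuous_on smooth_deriv(2))

lemma deriv_funpow_affine:
  assumes "smooth f"
  shows "(deriv ^^ n) (\<lambda>t. f (a * t + b)) = (\<lambda>t. a ^ n * (deriv ^^ n) f (a * t + b))"
proof (induction n)
  case (Suc n)
  have "deriv (\<lambda>t. a ^ n * (deriv ^^ n) f (a * t + b)) t = a ^ Suc n * (deriv ^^ Suc n) f (a * t + b)" for t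
  proof (rule DERIV_imp_deriv)
    have "((deriv ^^ n) f has_real_derivative (deriv ^^ Suc n) f (a * t + b)) (at (a * t + b))"
      using smooth_deriv(2)[OF smooth_deriv_funpow[OF assms, of n]] by simp
    then have "((\<lambda>t. (deriv ^^ n) f (a * t + b)) has_real_derivative
        (deriv ^^ Suc n) f (a * t + b) * a) (at t)"
      by (rule DERIV_chain2) (auto intro!: derivative_eq_intros)
    from DERIV_cmult[OF this, of "a ^ n"]
    show "((\<lambda>t. a ^ n * (deriv ^^ n) f (a * t + b)) has_real_derivative
        a ^ Suc n * (deriv ^^ Suc n) f (a * t + b)) (at t)"
      by (simp add: mult_ac)
  qed
  with Suc show ?case by auto
qed simp

text \<open>The functions \<open>p(1/t) exp(-1/t)\<close> on the positive half-line, extended by zero, are closed under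
  differentiation.\<close>

definition flat :: "real poly \<Rightarrow> real \<Rightarrow> real" where
  "flat p t = (if t > 0 then poly p (1 / t) * exp (- (1 / t)) else 0)"

lemma poly_exp_tendsto_0: "((\<lambda>z. poly p z * exp (- z)) \<longlongrightarrow> (0::real)) at_top"
proof -
  have "((\<lambda>z. \<Sum>i\<le>degree p. coeff p i * (z ^ i / exp z)) \<longlongrightarrow> (\<Sum>i\<le>degree p. coeff p i * 0)) at_top"
    by (intro tendsto_intros tendsto_power_div_exp_0)
  then show ?thesis
    by (simp add: poly_altdef sum_distrib_right exp_minus divide_inverse mult.assoc)
qed

text \<open>With z = 1 / t one has dz/dt = - z^2, so differentiating p(z) exp(- z) produces z^2 (p -
  p')(z) exp(- z); the factor z^2 is \<open>[:0, 0, 1:]\<close>.\<close>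

lemma flat_deriv:
  "(flat p has_real_derivative flat ([:0, 0, 1:] * (p - pderiv p)) t) (at t)"
proof -
  consider "t > 0" | "t < 0" | "t = 0" by linarith
  then show ?thesis
  proof cases
    case 1
    have "((\<lambda>t. poly p (1 / t) * exp (- (1 / t))) has_real_derivative
        flat ([:0, 0, 1:] * (p - pderiv p)) t) (at t)"
    proof -
      have i: "((\<lambda>t. 1 / t) has_real_derivative - (1 / t\<^sup>2)) (at t)"
        using 1 by (auto intro!: derivative_eq_intros simp: power2_eq_square)
      have "((\<lambda>t. poly p (1 / t) * exp (- (1 / t))) has_real_derivative
          poly (pderiv p) (1 / t) * (- (1 / t\<^sup>2)) * exp (- (1 / t)) +
          exp (- (1 / t)) * (- (- (1 / t\<^sup>2))) * poly p (1 / t)) (at t)"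
        by (intro DERIV_mult DERIV_chain2[OF poly_DERIV i] DERIV_chain2[OF DERIV_exp DERIV_minus[OF i]])
      then show ?thesis
        using 1 by (simp add: flat_def algebra_simps power2_eq_square)
    qed
    then show ?thesis
      by (rule has_field_derivative_transform_within_open[where S="{0<..}"]) (use 1 in \<open>auto simp: flat_def\<close>)
  next
    case 2
    have "((\<lambda>t. 0) has_real_derivative flat ([:0, 0, 1:] * (p - pderiv p)) t) (at t)"
      using 2 by (auto simp: flat_def)
    then show ?thesis
      by (rule has_field_derivative_transform_within_open[where S="{..<0}"]) (use 2 in \<open>auto simp: flat_def\<close>)
  next
    case 3
    \<comment> \<open>At 0 the right difference quotient \<open>flat p h / h\<close> equals z p(z)
      exp(- z) with z = 1 / h, and multiplication by z is \<open>pCons 0\<close>.\<close>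
    have "((\<lambda>h. poly (pCons 0 p) (inverse h) * exp (- inverse h)) \<longlongrightarrow> 0) (at_right 0)"
      by (rule filterlim_compose[OF poly_exp_tendsto_0 filterlim_inverse_at_top_right])
    moreover have "\<forall>\<^sub>F h in at_right 0. poly (pCons 0 p) (inverse h) * exp (- inverse h) = flat p h / h"
      by (rule eventually_mono[OF eventually_at_right_less]) (simp add: flat_def divide_inverse mult_ac)
    ultimately have R: "((\<lambda>h. flat p h / h) \<longlongrightarrow> 0) (at_right 0)"
      by (rule Lim_transform_eventually)
    have "((\<lambda>h. 0) \<longlongrightarrow> (0::real)) (at_left 0)" by simp
    then have L: "((\<lambda>h. flat p h / h) \<longlongrightarrow> 0) (at_left 0)"
      by (rule Lim_transform_eventually)
        (auto simp: eventually_at_left_field flat_def intro!: exI[of _ "-1"])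
    show ?thesis
      using 3 R L by (simp add: DERIV_def flat_def filterlim_split_at)
  qed
qed

lemma smooth_flat: "smooth (flat p)"
  unfolding smooth_def
proof
  fix n
  show "diff_times n (flat p)"
  proof (induction n arbitrary: p)
    case (Suc n)
    show ?case
      unfolding diff_times.simps by (intro exI conjI allI, rule flat_deriv, rule Suc)
  qed simp
qed

text \<open>The parameter c steepens the flanks: as c grows the bump tends to the indicator of the
  open interval, which is how indicators of boxes are reached from test functions.\<close>

definition box_bump :: "real \<Rightarrow> real \<Rightarrow> real \<Rightarrow> real \<Rightarrow> real" where
  "box_bump c a b t = flat 1 (c * (t - a)) * flat 1 (c * (b - t))"

lemma smooth_box_bump: "smooth (box_bump c a b)"
proof -
  have "smooth (\<lambda>t. flat 1 (c * t + (- c * a)) * flat 1 ((- c) * t + c * b))"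
    by (intro smooth_mult smooth_affine smooth_flat)
  then show ?thesis by (simp add: box_bump_def[abs_def] algebra_simps)
qed

lemma box_bump_pos: "c > 0 \<Longrightarrow> a < t \<Longrightarrow> t < b \<Longrightarrow> box_bump c a b t > 0"
  and box_bump_nonneg: "box_bump c a b t \<ge> 0"
  and box_bump_le_1: "box_bump c a b t \<le> 1"
  by (simp_all add: box_bump_def flat_def mult_le_one)

lemma box_bump_eq_0: "c > 0 \<Longrightarrow> t \<notin> {a<..<b} \<Longrightarrow> box_bump c a b t = 0"
  by (auto simp: box_bump_def flat_def zero_less_mult_iff)

lemma box_bump_tendsto:
  assumes "t \<in> {a<..<b}"
  shows "(\<lambda>n. box_bump (real (Suc n)) a b t) \<longlonglongrightarrow> 1"
proof -
  have *: "(\<lambda>n. exp (- (1 / (real (Suc n) * d)))) \<longlonglongrightarrow> 1" if "d > 0" for d :: real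
  proof -
    have "(\<lambda>n. exp (- (inverse (real (Suc n)) * (1 / d)))) \<longlonglongrightarrow> exp (- (0 * (1 / d)))"
      by (intro tendsto_intros LIMSEQ_inverse_real_of_nat)
    then show ?thesis by (simp add: field_simps)
  qed
  have "(\<lambda>n. exp (- (1 / (real (Suc n) * (t - a)))) * exp (- (1 / (real (Suc n) * (b - t))))) \<longlonglongrightarrow> 1 * 1"
    using assms by (intro tendsto_mult *) auto
  then show ?thesis
    using assms by (simp add: box_bump_def flat_def del: of_nat_Suc)
qed

section \<open>Compactly supported functions and the one-dimensional kernels\<close>

lemma deriv_eq_0_outside:
  assumes "\<And>t. t \<notin> {a..b} \<Longrightarrow> f t = (0::real)" "t \<notin> {a..b}"
  shows "deriv f t = 0"
proof (rule DERIV_imp_deriv)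
  have "((\<lambda>t. 0) has_real_derivative 0) (at t)" by simp
  moreover have "open (- {a..b})" by auto
  ultimately show "(f has_real_derivative 0) (at t)"
    by (rule has_field_derivative_transform_within_open) (use assms in auto)
qed

lemma deriv_funpow_eq_0_outside:
  assumes "\<And>t. t \<notin> {a..b} \<Longrightarrow> f t = (0::real)" "t \<notin> {a..b}"
  shows "(deriv ^^ n) f t = 0"
  using assms(2) by (induction n arbitrary: t) (auto simp: assms(1) intro!: deriv_eq_0_outside[of a b])

lemma integrable_compact_support:
  fixes f :: "real \<Rightarrow> real"
  assumes "continuous_on UNIV f" "\<And>t. t \<notin> {a..b} \<Longrightarrow> f t = (0::real)"
  shows "integrable lborel f"
proof -
  have "set_integrable lborel {a..b} f"
    by (rule borel_integrable_atLeastAtMost') (use assms(1) continuous_on_subset in blast)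
  moreover have "(\<lambda>t. indicator {a..b} t *\<^sub>R f t) = f"
    by (rule ext) (use assms(2) in \<open>auto simp: indicator_def\<close>)
  ultimately show ?thesis by (simp add: set_integrable_def)
qed

lemma integral_deriv_compact_support:
  assumes "smooth f" "\<And>t. t \<notin> {a..b} \<Longrightarrow> f t = 0" "a \<le> b"
  shows "(LBINT t. deriv f t) = 0"
proof -
  \<comment> \<open>The interval is enlarged by 1 on both sides because f is assumed to vanish only
    outside the closed interval, not at its endpoints.\<close>
  have "has_bochner_integral lborel (\<lambda>t. deriv f t * indicator {a - 1..b + 1} t) (f (b + 1) - f (a - 1))"
    by (rule has_bochner_integral_FTC_Icc_real)
      (use assms smooth_deriv(2)[OF assms(1)] smooth_continuous[OF smooth_deriv(1)[OF assms(1)], of UNIV] in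
        \<open>auto simp: continuous_on_eq_continuous_at\<close>)
  moreover have "(\<lambda>t. deriv f t * indicator {a - 1..b + 1} t) = deriv f"
  proof
    fix t
    show "deriv f t * indicator {a - 1..b + 1} t = deriv f t"
      using deriv_eq_0_outside[of a b f t] assms(2) by (cases "t \<in> {a..b}") auto
  qed
  ultimately show ?thesis using assms(2,3) by (auto dest: has_bochner_integral_integral_eq)
qed

text \<open>Leibniz rule with the factor t, whose second derivative is zero. For n = 0 the truncated
  \<open>n - 1\<close> is harmless, since its coefficient is 0.\<close>

lemma deriv_funpow_times_ident:
  assumes "smooth f"
  shows "(deriv ^^ n) (\<lambda>t. - (t * f t)) = (\<lambda>t. - (t * (deriv ^^ n) f t + real n * (deriv ^^ (n - 1)) f t))"
proof (induction n)
  case (Suc n)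
  have "deriv (\<lambda>t. - (t * (deriv ^^ n) f t + real n * (deriv ^^ (n - 1)) f t)) t
      = - (t * (deriv ^^ Suc n) f t + real (Suc n) * (deriv ^^ n) f t)" for t
  proof (rule DERIV_imp_deriv)
    have "((\<lambda>t. - (t * (deriv ^^ n) f t + real n * (deriv ^^ (n - 1)) f t)) has_real_derivative
        - ((1 * (deriv ^^ n) f t + deriv ((deriv ^^ n) f) t * t) +
           real n * deriv ((deriv ^^ (n - 1)) f) t)) (at t)"
      by (intro DERIV_minus DERIV_add DERIV_mult DERIV_ident DERIV_cmult
          smooth_deriv(2) smooth_deriv_funpow assms)
    moreover have "- ((1 * (deriv ^^ n) f t + deriv ((deriv ^^ n) f) t * t) +
           real n * deriv ((deriv ^^ (n - 1)) f) t) = - (t * (deriv ^^ Suc n) f t + real (Suc n) * (deriv ^^ n) f t)"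
      by (cases n) (auto simp: algebra_simps)
    ultimately show "((\<lambda>t. - (t * (deriv ^^ n) f t + real n * (deriv ^^ (n - 1)) f t)) has_real_derivative
        - (t * (deriv ^^ Suc n) f t + real (Suc n) * (deriv ^^ n) f t)) (at t)"
      by metis
  qed
  with Suc show ?case by auto
qed simp

text \<open>The derivative of \<open>f(t/h)/h\<close> with respect to \<open>h\<close> is \<open>(A f)(t/h)/h\<^sup>2\<close> with
  \<open>A f = - (t f)'\<close>. If \<open>A \<Phi> = \<kappa>\<^sup>(\<^sup>k\<^sup>+\<^sup>1\<^sup>)\<close>, then \<open>A\<close> maps \<open>A \<Phi> - (k + 1) \<Phi>\<close> to the
  derivative of order \<open>k + 2\<close> of \<open>- t \<kappa>\<close>.\<close>

lemma scaling_kernel_exists: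
  fixes a b :: real
  assumes "a < b"
  shows "\<exists>\<Phi> \<kappa>. smooth \<Phi> \<and> smooth \<kappa> \<and> (\<forall>t. t \<notin> {a..b} \<longrightarrow> \<Phi> t = 0) \<and> (\<forall>t. t \<notin> {a..b} \<longrightarrow> \<kappa> t = 0) \<and>
    (LBINT t. \<Phi> t) = 1 \<and> (\<forall>t. - (\<Phi> t + t * deriv \<Phi> t) = (deriv ^^ Suc k) \<kappa> t)"
proof -
  \<comment> \<open>The induction carries only a nonzero integral, which each step multiplies by -
    (k + 1); it is normalized to 1 at the end, all other requirements being linear.\<close>
  let ?P = "\<lambda>k \<Phi> \<kappa>. smooth \<Phi> \<and> smooth \<kappa> \<and> (\<forall>t. t \<notin> {a..b} \<longrightarrow> \<Phi> t = 0) \<and> (\<forall>t. t \<notin> {a..b} \<longrightarrow> \<kappa> t = 0) \<and>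
    (LBINT t. \<Phi> t) \<noteq> 0 \<and> (\<forall>t. - (\<Phi> t + t * deriv \<Phi> t) = (deriv ^^ Suc k) \<kappa> t)"
  have A: "deriv (\<lambda>t. - (t * f t)) = (\<lambda>t. - (f t + t * deriv f t))" if "smooth f" for f
    using deriv_funpow_times_ident[OF that, of 1] by (simp add: add.commute)
  have "\<exists>\<Phi> \<kappa>. ?P k \<Phi> \<kappa>"
  proof (induction k)
    \<comment> \<open>For k = 0 the definition of A already has the required form, with \<kappa> = -
      t \<psi>; the bump \<psi> has positive integral.\<close>
    case 0
    let ?\<psi> = "box_bump 1 a b"
    have int: "integrable lborel ?\<psi>"
      by (rule integrable_compact_support[of _ a b])
        (auto intro: smooth_continuous smooth_box_bump box_bump_eq_0)
    have "(LBINT t. ?\<psi> t) \<noteq> 0"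
    proof
      assume "(LBINT t. ?\<psi> t) = 0"
      then have "AE t in lborel. ?\<psi> t = 0"
        using integral_nonneg_eq_0_iff_AE[OF int] by (simp add: box_bump_nonneg)
      then have "AE t in lborel. t \<notin> {a<..<b}"
        by (rule eventually_mono) (use box_bump_pos[of 1 a _ b] in force)
      then have "emeasure lborel {a<..<b} = 0"
        by (subst (asm) AE_iff_measurable[of "{a<..<b}"]) auto
      then show False using assms by simp
    qed
    moreover have "smooth (\<lambda>t. - (t * ?\<psi> t))"
      by (intro smooth_minus smooth_mult smooth_ident smooth_box_bump)
    ultimately show ?case
      by (intro exI[of _ ?\<psi>] exI[of _ "\<lambda>t. - (t * ?\<psi> t)"])
        (auto simp: smooth_box_bump box_bump_eq_0 A)
  next
    case (Suc k)
    then obtain \<Phi> \<kappa> where P: "?P k \<Phi> \<kappa>" by blast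
    \<comment> \<open>Applying A to the derivative of order k + 1 of \<kappa> leaves that derivative
      with coefficient - 1; subtracting (k + 1) \<Phi> raises the coefficient to - (k + 2), as the
      Leibniz rule for - t \<kappa> demands.\<close>
    define \<Phi>' where "\<Phi>' = (\<lambda>t. (deriv ^^ Suc k) \<kappa> t - real (Suc k) * \<Phi> t)"
    have sm: "smooth ((deriv ^^ Suc k) \<kappa>)" and s\<Phi>: "smooth \<Phi>" using P smooth_deriv_funpow by blast+
    have s': "smooth \<Phi>'"
      using smooth_add[OF sm smooth_mult[OF smooth_const[of "- real (Suc k)"] s\<Phi>]]
      by (simp only: \<Phi>'_def diff_conv_add_uminus minus_mult_left)
    have s\<kappa>: "smooth (\<lambda>t. - (t * \<kappa> t))"
      using P by (intro smooth_minus smooth_mult smooth_ident) blast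
    have supp: "\<Phi>' t = 0" if "t \<notin> {a..b}" for t
      unfolding \<Phi>'_def using P that deriv_funpow_eq_0_outside[of a b \<kappa> t "Suc k"] by auto
    have i1: "integrable lborel ((deriv ^^ Suc k) \<kappa>)" "integrable lborel \<Phi>"
      using P deriv_funpow_eq_0_outside[of a b \<kappa> _ "Suc k"]
      by (intro integrable_compact_support[of _ a b] smooth_continuous sm s\<Phi>; blast)+
    \<comment> \<open>The derivative part integrates to zero, so the integral of \<Phi>' comes from
      the multiple of \<Phi> alone and stays nonzero.\<close>
    have "(LBINT t. (deriv ^^ Suc k) \<kappa> t) = 0"
      using integral_deriv_compact_support[OF smooth_deriv_funpow[of \<kappa> k], of a b] assms P
        deriv_funpow_eq_0_outside[of a b \<kappa> _ k] by auto
    then have "(LBINT t. \<Phi>' t) = - real (Suc k) * (LBINT t. \<Phi> t)"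
      unfolding \<Phi>'_def by (subst Bochner_Integration.integral_diff) (use i1 in \<open>auto simp: algebra_simps\<close>)
    moreover have "- (\<Phi>' t + t * deriv \<Phi>' t) = (deriv ^^ Suc (Suc k)) (\<lambda>t. - (t * \<kappa> t)) t" for t
    proof -
      have "deriv \<Phi>' t = (deriv ^^ Suc (Suc k)) \<kappa> t - real (Suc k) * deriv \<Phi> t"
        unfolding \<Phi>'_def using smooth_deriv(2)[OF sm] smooth_deriv(2)[OF s\<Phi>]
        by (intro DERIV_imp_deriv DERIV_diff DERIV_cmult) auto
      moreover have "- (\<Phi> t + t * deriv \<Phi> t) = (deriv ^^ Suc k) \<kappa> t" using P by blast
      moreover have "(deriv ^^ Suc (Suc k)) (\<lambda>t. - (t * \<kappa> t)) t =
          - (t * (deriv ^^ Suc (Suc k)) \<kappa> t + real (Suc (Suc k)) * (deriv ^^ Suc k) \<kappa> t)"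
        using deriv_funpow_times_ident[of \<kappa> "Suc (Suc k)"] P by simp
      ultimately show ?thesis
        unfolding \<Phi>'_def by (simp only: of_nat_Suc) algebra
    qed
    ultimately show ?case
      using P s' s\<kappa> supp by (intro exI[of _ \<Phi>'] exI[of _ "\<lambda>t. - (t * \<kappa> t)"]) auto
  qed
  then obtain \<Phi> \<kappa> where P: "?P k \<Phi> \<kappa>" by blast
  define c where "c = 1 / (LBINT t. \<Phi> t)"
  have d: "deriv (\<lambda>t. c * f t) = (\<lambda>t. c * deriv f t)" if "smooth f" for f
    using smooth_deriv(2)[OF that] by (intro ext DERIV_imp_deriv DERIV_cmult)
  have dn: "(deriv ^^ n) (\<lambda>t. c * \<kappa> t) = (\<lambda>t. c * (deriv ^^ n) \<kappa> t)" for n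
    by (induction n) (use P d smooth_deriv_funpow in auto)
  have "c * - (\<Phi> t + t * deriv \<Phi> t) = c * (deriv ^^ Suc k) \<kappa> t" for t using P by metis
  then have "- (c * \<Phi> t + t * deriv (\<lambda>t. c * \<Phi> t) t) = (deriv ^^ Suc k) (\<lambda>t. c * \<kappa> t) t" for t
    using P by (simp only: dn d) (metis (no_types, opaque_lifting) distrib_left mult.left_commute mult_minus_right)
  moreover have "(LBINT t. c * \<Phi> t) = 1" using P by (simp add: c_def)
  ultimately show ?thesis
    using P smooth_mult[OF smooth_const[of c]] by (intro exI[of _ "\<lambda>t. c * \<Phi> t"] exI[of _ "\<lambda>t. c * \<kappa> t"]) auto
qed

section \<open>Tensor products as test functions\<close>

definition tensor :: "('m::finite \<Rightarrow> real \<Rightarrow> real) \<Rightarrow> real^'m \<Rightarrow> real" where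
  "tensor f y = (\<Prod>i\<in>UNIV. f i (y $ i))"

lemma tensor_upd: "tensor (f(i := g)) y = g (y $ i) * (\<Prod>j\<in>UNIV - {i}. f j (y $ j))"
  unfolding tensor_def by (subst prod.remove[of _ i]) (auto intro!: prod.cong)

lemma tensor_has_derivative:
  assumes "\<And>i. smooth (f i)"
  shows "(tensor f has_derivative (\<lambda>h. \<Sum>i\<in>UNIV. h $ i * tensor (f(i := deriv (f i))) y)) (at y)"
proof -
  have "((\<lambda>y. \<Prod>i\<in>UNIV. f i (y $ i)) has_derivative
      (\<lambda>h. \<Sum>i\<in>UNIV. (deriv (f i) (y $ i) * h $ i) * (\<Prod>j\<in>UNIV - {i}. f j (y $ j)))) (at y)"
  proof (rule has_derivative_prod)
    fix i
    have "((\<lambda>y. y $ i) has_derivative (\<lambda>h. h $ i)) (at y)"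
      by (rule bounded_linear_imp_has_derivative[OF bounded_linear_vec_nth])
    moreover have "(f i has_derivative (*) (deriv (f i) (y $ i))) (at (y $ i))"
      using smooth_deriv(2)[OF assms] by (simp add: has_field_derivative_def)
    ultimately show "((\<lambda>y. f i (y $ i)) has_derivative (\<lambda>h. deriv (f i) (y $ i) * h $ i)) (at y)"
      by (rule has_derivative_compose[where f="\<lambda>y. y $ i"])
  qed
  moreover have "tensor f = (\<lambda>y. \<Prod>i\<in>UNIV. f i (y $ i))" by (simp add: tensor_def fun_eq_iff)
  ultimately show ?thesis by (simp add: tensor_upd mult_ac)
qed

lemma tensor_continuous: "(\<And>i. smooth (f i)) \<Longrightarrow> continuous_on A (tensor f)"
  by (meson continuous_at_imp_continuous_on has_derivative_continuous tensor_has_derivative)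

lemma partial_tensor:
  assumes "\<And>i. smooth (f i)"
  shows "partial i (tensor f) = tensor (f(i := deriv (f i)))"
proof
  fix y
  show "partial i (tensor f) y = tensor (f(i := deriv (f i))) y"
    unfolding partial_def frechet_derivative_at[OF tensor_has_derivative[OF assms], symmetric]
    by (simp add: axis_def if_distrib[of "\<lambda>c. c * _"] cong: if_cong)
qed

lemma partial_funpow_tensor:
  assumes "\<And>i. smooth (f i)"
  shows "(partial i ^^ n) (tensor f) = tensor (f(i := (deriv ^^ n) (f i)))"
proof (induction n)
  case (Suc n)
  have "smooth ((f(i := (deriv ^^ n) (f i))) j)" for j
    using assms smooth_deriv_funpow by auto
  then have "partial i (tensor (f(i := (deriv ^^ n) (f i)))) = tensor (f(i := deriv ((deriv ^^ n) (f i))))"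
    by (subst partial_tensor) auto
  with Suc show ?case by (simp del: fun_upd_apply)
qed simp

text \<open>Tensors of smooth factors are closed under partial derivatives, so all iterated
  derivatives are again differentiable, as \<open>test_functions\<close> requires.\<close>

lemma foldr_partial_tensor:
  assumes "\<And>i. smooth (f i)"
  shows "\<exists>g. (\<forall>i. smooth (g i)) \<and> foldr partial is (tensor f) = tensor g"
proof (induction "is")
  case (Cons i "is")
  then obtain g where g: "\<And>i. smooth (g i)" "foldr partial is (tensor f) = tensor g" by blast
  then show ?case
    by (intro exI[of _ "g(i := deriv (g i))"] conjI) (simp_all add: partial_tensor smooth_deriv del: fun_upd_apply, simp add: smooth_deriv)
qed (use assms in auto)

lemma multi_partial_tensor:
  assumes "\<And>i. smooth (f i)"
  shows "multi_partial \<alpha> (tensor f) = tensor (\<lambda>i. (deriv ^^ \<alpha> i) (f i))"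
proof -
  \<comment> \<open>The statement for partial lists of coordinates makes induction possible;
    distinctness guarantees that no factor is differentiated twice.\<close>
  have *: "foldr (\<lambda>i. partial i ^^ \<alpha> i) is (tensor f) =
      tensor (\<lambda>i. if i \<in> set is then (deriv ^^ \<alpha> i) (f i) else f i)" if "distinct is" for "is"
    using that
  proof (induction "is")
    case (Cons i "is")
    then have IH: "foldr (\<lambda>i. partial i ^^ \<alpha> i) is (tensor f) =
      tensor (\<lambda>i. if i \<in> set is then (deriv ^^ \<alpha> i) (f i) else f i)" by simp
    have "smooth (if j \<in> set is then (deriv ^^ \<alpha> j) (f j) else f j)" for j
      using assms smooth_deriv_funpow by auto
    then show ?case
      using Cons.prems by (simp add: IH, subst partial_funpow_tensor) (auto intro!: arg_cong[where f=tensor])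
  qed simp
  have "\<exists>is::'a list. distinct is \<and> set is = UNIV"
    using finite_distinct_list[OF finite] by blast
  then have "distinct (SOME is::'a list. distinct is \<and> set is = UNIV) \<and>
      set (SOME is::'a list. distinct is \<and> set is = UNIV) = UNIV"
    by (rule someI_ex)
  then show ?thesis unfolding multi_partial_def by (simp add: *)
qed

lemma tensor_eq_0_outside:
  assumes "\<And>i t. t \<notin> {a $ i..b $ i} \<Longrightarrow> f i t = 0" "y \<notin> cbox a b"
  shows "tensor f y = 0"
  using assms unfolding tensor_def mem_box_cart by (auto intro!: prod_zero)

lemma tensor_test_function:
  assumes "\<And>i. smooth (f i)" "\<And>i t. t \<notin> {a $ i..b $ i} \<Longrightarrow> f i t = 0" "cbox a b \<subseteq> \<Omega>"
  shows "tensor f \<in> test_functions \<Omega>"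
proof -
  have "{y. tensor f y \<noteq> 0} \<subseteq> cbox a b"
    using tensor_eq_0_outside[of a b f] assms(2) by blast
  then have "closure {y. tensor f y \<noteq> 0} \<subseteq> cbox a b"
    by (rule closure_minimal) (rule closed_cbox)
  then have "compact (closure {y. tensor f y \<noteq> 0})" "closure {y. tensor f y \<noteq> 0} \<subseteq> \<Omega>"
    using assms(3) by (auto simp: compact_eq_bounded_closed intro: bounded_subset[OF bounded_cbox])
  moreover have "foldr partial is (tensor f) differentiable at x" for "is" x
  proof -
    obtain g where "\<And>i. smooth (g i)" "foldr partial is (tensor f) = tensor g"
      using foldr_partial_tensor[of f "is"] assms(1) by auto
    then show ?thesis using tensor_has_derivative[of g x] by (auto simp: differentiable_def)
  qed
  ultimately show ?thesis by (simp add: test_functions_def)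
qed

lemma integral_tensor:
  assumes "\<And>i. integrable lborel (f i)"
  shows "integral\<^sup>L lborel (tensor f) = (\<Prod>i\<in>UNIV. integral\<^sup>L lborel (f i))"
    and "integrable lborel (tensor f)"
proof -
  interpret product_sigma_finite "\<lambda>_::real^'a. lborel :: real measure"
    by (simp add: product_sigma_finite_def lborel.sigma_finite_measure_axioms)
  \<comment> \<open>\<open>lborel\<close> is a product measure indexed by \<open>Basis\<close>, so
    the factors are transported along the bijection from i to \<open>axis i 1\<close>.\<close>
  define g where "g b = f (THE i. b = axis i 1)" for b :: "real^'a"
  have g: "g (axis i 1) = f i" for i by (simp add: g_def axis_eq_axis)
  have B: "(Basis :: (real^'a) set) = (\<lambda>i. axis i 1) ` UNIV" by (auto simp: Basis_vec_def)
  have inj: "inj (\<lambda>i. axis i 1 :: real^'a)" by (auto simp: inj_def axis_eq_axis)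
  have t: "tensor f y = (\<Prod>b\<in>Basis. g b (y \<bullet> b))" for y
    by (simp add: tensor_def B prod.reindex[OF inj] g inner_axis)
  have gi: "integrable lborel (g b)" if "b \<in> Basis" for b
    using that by (auto simp: B g assms)
  have [measurable]: "g b \<in> borel_measurable borel" if "b \<in> Basis" for b
    using gi[OF that] borel_measurable_integrable by auto
  have m: "(\<lambda>y. \<Prod>b\<in>Basis. g b (y \<bullet> b)) \<in> borel_measurable borel" by measurable
  have eq: "(\<Prod>b\<in>Basis. g b ((\<Sum>b\<in>Basis. h b *\<^sub>R b) \<bullet> b)) = (\<Prod>b\<in>Basis. g b (h b))" for h :: "real^'a \<Rightarrow> real"
    by (intro prod.cong) auto
  have "integral\<^sup>L lborel (tensor f) = (\<integral>y. (\<Prod>b\<in>Basis. g b (y \<bullet> b)) \<partial>(lborel :: (real^'a) measure))"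
    by (simp add: t[abs_def])
  also have "\<dots> = (\<integral>h. (\<Prod>b\<in>Basis. g b (h b)) \<partial>(Pi\<^sub>M Basis (\<lambda>_. lborel)))"
    by (subst lborel_eq, subst integral_distr) (simp_all add: m eq)
  also have "\<dots> = (\<Prod>b\<in>Basis. integral\<^sup>L lborel (g b))"
    by (rule product_integral_prod) (auto intro: gi)
  also have "\<dots> = (\<Prod>i\<in>UNIV. integral\<^sup>L lborel (f i))"
    by (simp add: B prod.reindex[OF inj] g)
  finally show "integral\<^sup>L lborel (tensor f) = (\<Prod>i\<in>UNIV. integral\<^sup>L lborel (f i))" .
  have "integrable (Pi\<^sub>M Basis (\<lambda>_. lborel)) (\<lambda>h. \<Prod>b\<in>Basis. g b (h b))"
    by (rule product_integrable_prod) (auto intro: gi)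
  then have "integrable lborel (\<lambda>y::real^'a. \<Prod>b\<in>Basis. g b (y \<bullet> b))"
    by (subst lborel_eq, subst integrable_distr_eq) (simp_all add: m eq)
  then show "integrable lborel (tensor f)" by (simp add: t[abs_def])
qed

section \<open>Square-integrable functions\<close>

text \<open>A version of \<open>L2_space\<close> over arbitrary measures, because the Gagliardo part
  of the norm lives on a product measure.\<close>

definition square_integrable :: "'a measure \<Rightarrow> ('a \<Rightarrow> real) \<Rightarrow> bool" where
  "square_integrable M f \<longleftrightarrow> f \<in> borel_measurable M \<and> integrable M (\<lambda>x. (f x)\<^sup>2)"

lemma square_integrableD:
  assumes "square_integrable M f"
  shows "f \<in> borel_measurable M" "integrable M (\<lambda>x. (f x)\<^sup>2)"
  using assms by (auto simp: square_integrable_def)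

lemma square_integrable_mult:
  assumes "square_integrable M f" "square_integrable M g"
  shows "integrable M (\<lambda>x. f x * g x)"
proof (rule Bochner_Integration.integrable_bound)
  show "integrable M (\<lambda>x. (f x)\<^sup>2 + (g x)\<^sup>2)"
    using assms by (auto dest: square_integrableD)
  show "(\<lambda>x. f x * g x) \<in> borel_measurable M"
    using square_integrableD(1)[OF assms(1)] square_integrableD(1)[OF assms(2)] by measurable
  have "\<bar>a * b\<bar> \<le> a\<^sup>2 + b\<^sup>2" for a b :: real
  proof -
    have "2 * (\<bar>a\<bar> * \<bar>b\<bar>) \<le> a\<^sup>2 + b\<^sup>2"
      using sum_squares_bound[of "\<bar>a\<bar>" "\<bar>b\<bar>"] by (simp add: mult.assoc)
    moreover have "0 \<le> \<bar>a\<bar> * \<bar>b\<bar>" by simp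
    ultimately show ?thesis unfolding abs_mult by linarith
  qed
  then show "AE x in M. norm (f x * g x) \<le> norm ((f x)\<^sup>2 + (g x)\<^sup>2)" by auto
qed

lemma square_integrable_lincomb:
  assumes "square_integrable M f" "square_integrable M g"
  shows "square_integrable M (\<lambda>x. a * f x + b * g x)"
proof -
  have "integrable M (\<lambda>x. a\<^sup>2 * (f x)\<^sup>2 + (2 * a * b) * (f x * g x) + b\<^sup>2 * (g x)\<^sup>2)"
    using assms square_integrable_mult[OF assms]
    by (intro Bochner_Integration.integrable_add integrable_mult_right) (auto dest: square_integrableD)
  then have "integrable M (\<lambda>x. (a * f x + b * g x)\<^sup>2)"
    by (simp add: power2_eq_square algebra_simps)
  then show ?thesis using assms unfolding square_integrable_def by auto
qed

lemma integral_square_lincomb: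
  assumes "square_integrable M f" "square_integrable M g"
  shows "(\<integral>x. (a * f x + b * g x)\<^sup>2 \<partial>M) =
    a\<^sup>2 * (\<integral>x. (f x)\<^sup>2 \<partial>M) + 2 * a * b * (\<integral>x. f x * g x \<partial>M) + b\<^sup>2 * (\<integral>x. (g x)\<^sup>2 \<partial>M)"
proof -
  have "(\<integral>x. (a * f x + b * g x)\<^sup>2 \<partial>M) =
    (\<integral>x. a\<^sup>2 * (f x)\<^sup>2 + (2 * a * b) * (f x * g x) + b\<^sup>2 * (g x)\<^sup>2 \<partial>M)"
    by (simp add: power2_eq_square algebra_simps)
  then show ?thesis
    using assms square_integrable_mult[OF assms] by (simp add: square_integrableD)
qed

lemma Cauchy_Schwarz_integral:
  assumes "square_integrable M f" "square_integrable M g"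
  shows "\<bar>\<integral>x. f x * g x \<partial>M\<bar> \<le> sqrt (\<integral>x. (f x)\<^sup>2 \<partial>M) * sqrt (\<integral>x. (g x)\<^sup>2 \<partial>M)"
proof -
  define A B C where "A = (\<integral>x. (f x)\<^sup>2 \<partial>M)" and "B = (\<integral>x. f x * g x \<partial>M)" and "C = (\<integral>x. (g x)\<^sup>2 \<partial>M)"
  have q: "0 \<le> A + 2 * c * B + c\<^sup>2 * C" for c
  proof -
    have "0 \<le> (\<integral>x. (1 * f x + c * g x)\<^sup>2 \<partial>M)" by (rule integral_nonneg_AE) simp
    then show ?thesis
      unfolding integral_square_lincomb[OF assms] by (simp add: A_def B_def C_def)
  qed
  have "A \<ge> 0" "C \<ge> 0" by (auto simp: A_def C_def)
  have "B\<^sup>2 \<le> A * C"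
  proof (cases "C = 0")
    case True
    have "B = 0"
    proof (rule ccontr)
      assume "B \<noteq> 0"
      \<comment> \<open>For C = 0 the quadratic is affine in c, and this c gives it the value -
        1.\<close>
      then show False using q[of "- (A + 1) / (2 * B)"] True by (simp add: field_simps)
    qed
    then show ?thesis using True by simp
  next
    case False
    then have "C > 0" using \<open>C \<ge> 0\<close> by simp
    \<comment> \<open>c = - B / C minimizes the quadratic.\<close>
    have "A + 2 * (- B / C) * B + (- B / C)\<^sup>2 * C = A - B\<^sup>2 / C"
      using False by (simp add: power2_eq_square)
    then have "B\<^sup>2 / C \<le> A" using q[of "- B / C"] by linarith
    then show ?thesis using \<open>C > 0\<close> by (simp add: field_simps)
  qed
  then have "\<bar>B\<bar> \<le> sqrt (A * C)" by (simp add: real_le_rsqrt)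
  then show ?thesis by (simp add: A_def B_def C_def real_sqrt_mult)
qed

lemma sqrt_integral_square_triangle:
  assumes "square_integrable M f" "square_integrable M g"
  shows "sqrt (\<integral>x. (f x + g x)\<^sup>2 \<partial>M) \<le> sqrt (\<integral>x. (f x)\<^sup>2 \<partial>M) + sqrt (\<integral>x. (g x)\<^sup>2 \<partial>M)"
proof (rule real_le_lsqrt)
  have "(\<integral>x. (f x + g x)\<^sup>2 \<partial>M) = (\<integral>x. (f x)\<^sup>2 \<partial>M) + 2 * (\<integral>x. f x * g x \<partial>M) + (\<integral>x. (g x)\<^sup>2 \<partial>M)"
    using integral_square_lincomb[OF assms, of 1 1] by simp
  then show "(\<integral>x. (f x + g x)\<^sup>2 \<partial>M) \<le> (sqrt (\<integral>x. (f x)\<^sup>2 \<partial>M) + sqrt (\<integral>x. (g x)\<^sup>2 \<partial>M))\<^sup>2"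
    using Cauchy_Schwarz_integral[OF assms] by (simp add: power2_sum)
qed auto

lemma square_integrable_bounded:
  assumes "finite_measure M" "f \<in> borel_measurable M" "\<And>x. x \<in> space M \<Longrightarrow> \<bar>f x\<bar> \<le> B"
  shows "square_integrable M f"
proof -
  interpret finite_measure M by fact
  have "integrable M (\<lambda>x. (f x)\<^sup>2)"
  proof (rule integrable_const_bound[where B="B\<^sup>2"])
    show "AE x in M. norm ((f x)\<^sup>2) \<le> B\<^sup>2"
    proof (rule AE_I2)
      fix x assume "x \<in> space M"
      from power_mono[OF assms(3)[OF this], of 2] show "norm ((f x)\<^sup>2) \<le> B\<^sup>2" by simp
    qed
  qed (use assms in measurable)
  then show ?thesis using assms by (simp add: square_integrable_def)
qed

lemma square_integrable_integrable:
  assumes "finite_measure M" "square_integrable M f"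
  shows "integrable M f"
  using square_integrable_mult[OF assms(2) square_integrable_bounded[OF assms(1), of "\<lambda>_. 1" 1]] by simp

lemma integrable_mult_bounded:
  fixes f g :: "'a \<Rightarrow> real"
  assumes "integrable M f" "g \<in> borel_measurable M" "\<And>x. x \<in> space M \<Longrightarrow> \<bar>g x\<bar> \<le> B"
  shows "integrable M (\<lambda>x. f x * g x)"
proof (rule Bochner_Integration.integrable_bound)
  show "integrable M (\<lambda>x. B * f x)" using assms(1) by simp
  show "(\<lambda>x. f x * g x) \<in> borel_measurable M" using assms(1,2) by measurable
  show "AE x in M. norm (f x * g x) \<le> norm (B * f x)"
  proof (rule AE_I2)
    fix x assume "x \<in> space M"
    from assms(3)[OF this] have "\<bar>g x\<bar> \<le> \<bar>B\<bar>" by linarith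
    then have "\<bar>f x\<bar> * \<bar>g x\<bar> \<le> \<bar>f x\<bar> * \<bar>B\<bar>" by (rule mult_left_mono) simp
    then show "norm (f x * g x) \<le> norm (B * f x)" by (simp add: abs_mult mult.commute)
  qed
qed

text \<open>By the mean value theorem the bound B on the derivative also bounds all difference
  quotients, so B \<bar>u\<bar> dominates. The bounds \<open>C r\<close> may depend on r: they only
  make the integrals at each r exist.\<close>

lemma has_derivative_under_integral:
  fixes u :: "'a \<Rightarrow> real" and G :: "real \<Rightarrow> 'a \<Rightarrow> real"
  assumes u: "integrable M u"
    and I: "h \<in> {p<..<q}"
    and d: "\<And>r y. r \<in> {p<..<q} \<Longrightarrow> y \<in> space M \<Longrightarrow> ((\<lambda>r. G r y) has_real_derivative G' r y) (at r)"
    and b': "\<And>r y. r \<in> {p<..<q} \<Longrightarrow> y \<in> space M \<Longrightarrow> \<bar>G' r y\<bar> \<le> B"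
    and m: "\<And>r. r \<in> {p<..<q} \<Longrightarrow> G r \<in> borel_measurable M"
    and m': "G' h \<in> borel_measurable M"
    and b: "\<And>r y. r \<in> {p<..<q} \<Longrightarrow> y \<in> space M \<Longrightarrow> \<bar>G r y\<bar> \<le> C r"
  shows "((\<lambda>r. \<integral>y. u y * G r y \<partial>M) has_real_derivative (\<integral>y. u y * G' h y \<partial>M)) (at h)"
proof -
  have int: "integrable M (\<lambda>y. u y * G r y)" if "r \<in> {p<..<q}" for r
    using integrable_mult_bounded[OF u m b] that by blast
  have lim: "((\<lambda>r. ((\<integral>y. u y * G r y \<partial>M) - (\<integral>y. u y * G h y \<partial>M)) / (r - h)) \<longlongrightarrow> (\<integral>y. u y * G' h y \<partial>M))
      (at h within {p<..<q})"
    unfolding tendsto_at_iff_sequentially comp_def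
  proof (intro allI impI)
    fix X :: "nat \<Rightarrow> real" assume X: "\<forall>i. X i \<in> {p<..<q} - {h}" "X \<longlonglongrightarrow> h"
    have "(\<lambda>i. \<integral>y. u y * ((G (X i) y - G h y) / (X i - h)) \<partial>M) \<longlonglongrightarrow> (\<integral>y. u y * G' h y \<partial>M)"
    proof (rule integral_dominated_convergence[where w="\<lambda>y. B * \<bar>u y\<bar>"])
      show "(\<lambda>y. u y * G' h y) \<in> borel_measurable M" using u m' by measurable
      show "(\<lambda>y. u y * ((G (X i) y - G h y) / (X i - h))) \<in> borel_measurable M" for i
      proof -
        have [measurable]: "G (X i) \<in> borel_measurable M" "G h \<in> borel_measurable M" using m I X(1) by auto
        have [measurable]: "u \<in> borel_measurable M" using u by simp
        show ?thesis by measurable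
      qed
      show "integrable M (\<lambda>y. B * \<bar>u y\<bar>)" using u by simp
      show "AE y in M. (\<lambda>i. u y * ((G (X i) y - G h y) / (X i - h))) \<longlonglongrightarrow> u y * G' h y"
      proof (rule AE_I2)
        fix y assume y: "y \<in> space M"
        have "((\<lambda>r. (G r y - G h y) / (r - h)) \<longlongrightarrow> G' h y) (at h)"
          using d[OF I y] by (simp add: has_field_derivative_iff)
        from this[unfolded tendsto_at_iff_sequentially comp_def, rule_format, of X]
        have "(\<lambda>i. (G (X i) y - G h y) / (X i - h)) \<longlonglongrightarrow> G' h y"
          using X by auto
        then show "(\<lambda>i. u y * ((G (X i) y - G h y) / (X i - h))) \<longlonglongrightarrow> u y * G' h y"
          by (rule tendsto_mult_left)
      qed
      show "AE y in M. norm (u y * ((G (X i) y - G h y) / (X i - h))) \<le> B * \<bar>u y\<bar>" for i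
      proof (rule AE_I2)
        fix y assume y: "y \<in> space M"
        have "norm (G (X i) y - G h y) \<le> B * norm (X i - h)"
          by (rule field_differentiable_bound[where S="{p<..<q}" and f'="\<lambda>r. G' r y"])
            (use X I d[OF _ y] b'[OF _ y] in \<open>auto intro: has_field_derivative_at_within\<close>)
        moreover have "X i - h \<noteq> 0" using X by auto
        ultimately have "\<bar>(G (X i) y - G h y) / (X i - h)\<bar> \<le> B"
          unfolding abs_divide real_norm_def by (subst pos_divide_le_eq) auto
        then have "\<bar>u y\<bar> * \<bar>(G (X i) y - G h y) / (X i - h)\<bar> \<le> \<bar>u y\<bar> * B"
          by (rule mult_left_mono) simp
        then show "norm (u y * ((G (X i) y - G h y) / (X i - h))) \<le> B * \<bar>u y\<bar>"
          by (simp add: abs_mult mult.commute)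
      qed
    qed
    moreover have "(\<integral>y. u y * ((G (X i) y - G h y) / (X i - h)) \<partial>M) =
        ((\<integral>y. u y * G (X i) y \<partial>M) - (\<integral>y. u y * G h y \<partial>M)) / (X i - h)" for i
    proof -
      have "(\<integral>y. u y * G (X i) y \<partial>M) - (\<integral>y. u y * G h y \<partial>M) = (\<integral>y. u y * G (X i) y - u y * G h y \<partial>M)"
        using int[of "X i"] int[OF I] X(1) by (subst Bochner_Integration.integral_diff) auto
      then have "(\<integral>y. u y * G (X i) y \<partial>M) - (\<integral>y. u y * G h y \<partial>M) = (\<integral>y. u y * (G (X i) y - G h y) \<partial>M)"
        by (simp only: right_diff_distrib)
      then show ?thesis by simp
    qed
    ultimately show "(\<lambda>i. ((\<integral>y. u y * G (X i) y \<partial>M) - (\<integral>y. u y * G h y \<partial>M)) / (X i - h)) \<longlonglongrightarrow> (\<integral>y. u y * G' h y \<partial>M)"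
      by (simp only:)
  qed
  have "at h within {p<..<q} = at h" by (rule at_within_open[OF I]) simp
  with lim show ?thesis by (simp add: has_field_derivative_iff)
qed

text \<open>Cauchy-Schwarz, with the square of \<phi> dominated by A^2 times the indicator of B. For
  a scaled box the last factor is the source of h^(m/2).\<close>

lemma integral_mult_square_bound:
  assumes fin: "finite_measure M" and v: "square_integrable M v"
    and \<phi>: "\<phi> \<in> borel_measurable M" "\<And>y. y \<in> space M \<Longrightarrow> \<bar>\<phi> y\<bar> \<le> A"
    and B: "B \<in> sets M" "\<And>y. y \<in> space M \<Longrightarrow> y \<notin> B \<Longrightarrow> \<phi> y = 0"
  shows "\<bar>\<integral>y. v y * \<phi> y \<partial>M\<bar> \<le> sqrt (\<integral>y. (v y)\<^sup>2 \<partial>M) * (\<bar>A\<bar> * sqrt (measure M B))"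
proof -
  interpret finite_measure M by fact
  have s: "square_integrable M \<phi>" by (rule square_integrable_bounded[OF fin \<phi>])
  have "(\<integral>y. (\<phi> y)\<^sup>2 \<partial>M) \<le> (\<integral>y. A\<^sup>2 * indicator B y \<partial>M)"
  proof (rule integral_mono)
    show "integrable M (\<lambda>y. (\<phi> y)\<^sup>2)" using s by (rule square_integrableD)
    show "integrable M (\<lambda>y. A\<^sup>2 * indicator B y)"
      using B by (intro integrable_mult_right integrable_real_indicator) (auto simp: less_top[symmetric])
    fix y assume y: "y \<in> space M"
    show "(\<phi> y)\<^sup>2 \<le> A\<^sup>2 * indicator B y"
      using power_mono[OF \<phi>(2)[OF y], of 2] B(2)[OF y] by (cases "y \<in> B") auto
  qed
  also have "\<dots> = A\<^sup>2 * measure M B" using B(1) by simp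
  finally have "sqrt (\<integral>y. (\<phi> y)\<^sup>2 \<partial>M) \<le> sqrt (A\<^sup>2 * measure M B)" by simp
  also have "\<dots> = \<bar>A\<bar> * sqrt (measure M B)" by (simp add: real_sqrt_mult)
  finally have le: "sqrt (\<integral>y. (\<phi> y)\<^sup>2 \<partial>M) \<le> \<bar>A\<bar> * sqrt (measure M B)" .
  show ?thesis
    by (rule order_trans[OF Cauchy_Schwarz_integral[OF v s] mult_left_mono[OF le]]) simp
qed

lemma integral_product:
  fixes f :: "'a \<Rightarrow> real" and g :: "'b \<Rightarrow> real"
  assumes "sigma_finite_measure M" "sigma_finite_measure N" "integrable M f" "integrable N g"
  shows "integrable (M \<Otimes>\<^sub>M N) (\<lambda>(x, y). f x * g y)"
    and "(\<integral>p. (case p of (x, y) \<Rightarrow> f x * g y) \<partial>(M \<Otimes>\<^sub>M N)) = (\<integral>x. f x \<partial>M) * (\<integral>y. g y \<partial>N)"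
proof -
  interpret M: sigma_finite_measure M by fact
  interpret N: sigma_finite_measure N by fact
  interpret pair_sigma_finite M N ..
  have [measurable]: "f \<in> borel_measurable M" "g \<in> borel_measurable N" using assms by auto
  show i: "integrable (M \<Otimes>\<^sub>M N) (\<lambda>(x, y). f x * g y)"
    by (rule Fubini_integrable) (use assms in \<open>auto simp: abs_mult\<close>)
  show "(\<integral>p. (case p of (x, y) \<Rightarrow> f x * g y) \<partial>(M \<Otimes>\<^sub>M N)) = (\<integral>x. f x \<partial>M) * (\<integral>y. g y \<partial>N)"
    using integral_fst'[OF i] by simp
qed

section \<open>The Gagliardo seminorm and functions of integral zero\<close>

lemma gagliardo_kernel_eq:
  "gagliardo_kernel r v (y, z) =
    ((v y - v z) / norm (y - z) powr (real CARD('m) / 2 + r))\<^sup>2" for y z :: "real^'m"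
proof -
  have "(norm (y - z) powr (real CARD('m) / 2 + r))\<^sup>2 =
      norm (y - z) powr ((real CARD('m) / 2 + r) + (real CARD('m) / 2 + r))"
    unfolding power2_eq_square by (rule powr_add[symmetric])
  then show ?thesis by (simp add: gagliardo_kernel_def power_divide)
qed

lemma measurable_id_lebesgue_on [measurable]: "(\<lambda>x. x) \<in> borel_measurable (lebesgue_on \<Omega>)"
  using id_borel_measurable_lebesgue_on[of \<Omega>] by (simp add: id_def)

text \<open>Because \<phi> has integral zero, the measure of B times the integral of v \<phi> equals
  the double integral of (v y - v z) \<phi> y over z in B. Cauchy-Schwarz on the product space
  splits off the difference quotient p; the other factor q lives on B \<times> B, the root of whose
  measure is the measure of B, and this cancels.\<close>

lemma gagliardo_integral_bound:
  fixes \<Omega> B :: "(real^'m) set"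
  assumes \<Omega>: "\<Omega> \<in> lmeasurable" and v: "square_integrable (lebesgue_on \<Omega>) v"
    and K: "integrable (lebesgue_on \<Omega> \<Otimes>\<^sub>M lebesgue_on \<Omega>) (gagliardo_kernel r v)"
    and \<phi>: "\<phi> \<in> borel_measurable (lebesgue_on \<Omega>)" "\<And>y. y \<in> \<Omega> \<Longrightarrow> \<bar>\<phi> y\<bar> \<le> A"
    and B: "B \<in> sets (lebesgue_on \<Omega>)" "\<And>y. y \<in> \<Omega> \<Longrightarrow> y \<notin> B \<Longrightarrow> \<phi> y = 0"
    and d: "\<And>y z. y \<in> B \<Longrightarrow> z \<in> B \<Longrightarrow> norm (y - z) \<le> d"
    and B0: "measure (lebesgue_on \<Omega>) B > 0" and \<phi>0: "(\<integral>y. \<phi> y \<partial>lebesgue_on \<Omega>) = 0"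
    and r: "r \<ge> 0"
  shows "\<bar>\<integral>y. v y * \<phi> y \<partial>lebesgue_on \<Omega>\<bar> \<le>
    sqrt (integral\<^sup>L (lebesgue_on \<Omega> \<Otimes>\<^sub>M lebesgue_on \<Omega>) (gagliardo_kernel r v)) *
      (\<bar>A\<bar> * d powr (real CARD('m) / 2 + r))"
proof -
  let ?M = "lebesgue_on \<Omega>" and ?e = "real CARD('m) / 2 + r"
  interpret fM: finite_measure ?M using \<Omega> by (rule finite_measure_lebesgue_on)
  interpret pair_sigma_finite ?M ?M ..
  note fin_axs = fM.finite_measure_axioms and sf = fM.sigma_finite_measure_axioms
  have fin: "finite_measure (?M \<Otimes>\<^sub>M ?M)"
    by (rule finite_measure_pair_measure) (rule fin_axs)+
  have sp [simp]: "space ?M = \<Omega>" by simp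
  have [measurable]: "v \<in> borel_measurable ?M" "\<phi> \<in> borel_measurable ?M" "B \<in> sets ?M"
    using v \<phi> B by (auto dest: square_integrableD)
  define p where "p = (\<lambda>(y, z). (v y - v z) / norm (y - z) powr ?e)"
  define q where "q = (\<lambda>(y, z). norm (y - z) powr ?e * \<phi> y * indicator B z)"
  have B\<Omega>: "B \<inter> \<Omega> = B" using sets.sets_into_space[OF B(1)] by auto
  have p2: "(\<lambda>yz. (p yz)\<^sup>2) = gagliardo_kernel r v"
    by (auto simp: p_def gagliardo_kernel_eq fun_eq_iff)
  have p: "square_integrable (?M \<Otimes>\<^sub>M ?M) p"
    unfolding square_integrable_def p2 by (rule conjI[OF _ K]) (simp add: p_def)
  have q: "q \<in> borel_measurable (?M \<Otimes>\<^sub>M ?M)"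
    unfolding q_def by measurable
  have qb: "\<bar>q yz\<bar> \<le> d powr ?e * \<bar>A\<bar>" if yzM: "yz \<in> space (?M \<Otimes>\<^sub>M ?M)" for yz
  proof -
    obtain y z where yz: "yz = (y, z)" "y \<in> \<Omega>" "z \<in> \<Omega>"
      using yzM by (cases yz) (auto simp: space_pair_measure)
    show ?thesis
    proof (cases "y \<in> B \<and> z \<in> B")
      case True
      then have "norm (y - z) powr ?e \<le> d powr ?e" using d r by (intro powr_mono2) auto
      moreover have "\<bar>\<phi> y\<bar> \<le> \<bar>A\<bar>" using \<phi>(2)[OF yz(2)] by linarith
      ultimately show ?thesis using True by (simp add: yz q_def abs_mult mult_mono)
    next
      case False
      then show ?thesis using B(2)[OF yz(2)] by (auto simp: yz q_def)
    qed
  qed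
  have q0: "q yz = 0" if "yz \<in> space (?M \<Otimes>\<^sub>M ?M)" "yz \<notin> B \<times> B" for yz
    using that B(2) by (cases yz) (auto simp: q_def space_pair_measure indicator_def)
  have mB: "measure (?M \<Otimes>\<^sub>M ?M) (B \<times> B) = (measure ?M B)\<^sup>2"
    using fM.emeasure_pair_measure_Times[OF B(1) B(1)]
    by (simp add: measure_def enn2real_mult power2_eq_square)
  have "\<bar>\<integral>yz. p yz * q yz \<partial>(?M \<Otimes>\<^sub>M ?M)\<bar> \<le> sqrt (\<integral>yz. (p yz)\<^sup>2 \<partial>(?M \<Otimes>\<^sub>M ?M)) *
      (\<bar>d powr ?e * \<bar>A\<bar>\<bar> * sqrt (measure (?M \<Otimes>\<^sub>M ?M) (B \<times> B)))"
    by (rule integral_mult_square_bound[OF fin p q qb]) (use q0 in auto)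
  then have le: "\<bar>\<integral>yz. p yz * q yz \<partial>(?M \<Otimes>\<^sub>M ?M)\<bar> \<le>
      sqrt (integral\<^sup>L (?M \<Otimes>\<^sub>M ?M) (gagliardo_kernel r v)) * (\<bar>A\<bar> * d powr ?e) * measure ?M B"
    by (simp add: p2 mB abs_mult mult_ac)
  have iv: "integrable ?M v" by (rule square_integrable_integrable[OF fin_axs v])
  have i\<phi>: "integrable ?M \<phi>"
    using square_integrable_integrable[OF fin_axs square_integrable_bounded[OF fin_axs \<phi>(1)]] \<phi>(2)
    by auto
  have iv\<phi>: "integrable ?M (\<lambda>y. v y * \<phi> y)"
    by (rule integrable_mult_bounded[OF iv \<phi>(1)]) (use \<phi>(2) in auto)
  have iB: "integrable ?M (indicator B :: _ \<Rightarrow> real)"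
    using B(1) by (intro integrable_real_indicator) (auto simp: less_top[symmetric])
  have ivB: "integrable ?M (\<lambda>y. v y * indicator B y)"
    by (rule integrable_mult_bounded[OF iv, of _ 1]) auto
  \<comment> \<open>Off the diagonal the powers of the distance cancel; on it both sides are
    0.\<close>
  have "p (y, z) * q (y, z) = (v y * \<phi> y) * indicator B z - \<phi> y * (v z * indicator B z)" for y z
  proof (cases "y = z")
    case False
    then have "p (y, z) * q (y, z) = (v y - v z) * (\<phi> y * indicator B z)"
      by (simp add: p_def q_def)
    then show ?thesis by (simp add: algebra_simps)
  qed (simp add: p_def q_def)
  then have pq: "(\<lambda>yz. p yz * q yz) = (\<lambda>yz. (case yz of (y, z) \<Rightarrow> (v y * \<phi> y) * indicator B z) -
      (case yz of (y, z) \<Rightarrow> \<phi> y * (v z * indicator B z)))"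
    by (auto simp: fun_eq_iff)
  have "(\<integral>yz. p yz * q yz \<partial>(?M \<Otimes>\<^sub>M ?M)) =
      (\<integral>y. v y * \<phi> y \<partial>?M) * measure ?M B - (\<integral>y. \<phi> y \<partial>?M) * (\<integral>z. v z * indicator B z \<partial>?M)"
    unfolding pq
    by (subst Bochner_Integration.integral_diff)
      (auto intro!: integral_product sf iv\<phi> iB i\<phi> ivB
        simp: B\<Omega> integral_product(2)[OF sf sf iv\<phi> iB]
          integral_product(2)[OF sf sf i\<phi> ivB])
  then have "(\<integral>yz. p yz * q yz \<partial>(?M \<Otimes>\<^sub>M ?M)) = (\<integral>y. v y * \<phi> y \<partial>?M) * measure ?M B"
    by (simp add: \<phi>0)
  with le B0 show ?thesis by (simp add: abs_mult mult_le_cancel_right_pos)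
qed

section \<open>Bounds and dilations of tensor products\<close>

lemma smooth_compact_support_bounded:
  assumes "smooth f" "\<And>t. t \<notin> {a..b} \<Longrightarrow> f t = (0::real)"
  shows "\<exists>M>0. \<forall>t. \<bar>f t\<bar> \<le> M"
proof -
  have "bounded (f ` {a..b})"
    by (intro compact_imp_bounded compact_continuous_image smooth_continuous assms) simp
  then obtain M where M: "M > 0" "\<And>t. t \<in> {a..b} \<Longrightarrow> \<bar>f t\<bar> \<le> M"
    unfolding bounded_pos by auto
  then have "\<bar>f t\<bar> \<le> M" for t using assms(2)[of t] by (cases "t \<in> {a..b}") auto
  then show ?thesis using M by blast
qed

lemma tensor_bounded:
  assumes "\<And>i. smooth (f i)" "\<And>i t. t \<notin> {a $ i..b $ i} \<Longrightarrow> f i t = 0"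
  shows "\<exists>M>0. \<forall>y. \<bar>tensor f y\<bar> \<le> M"
proof -
  have "\<forall>i. \<exists>M>0. \<forall>t. \<bar>f i t\<bar> \<le> M"
    using smooth_compact_support_bounded assms by blast
  then obtain M where M: "\<And>i. M i > 0" "\<And>i t. \<bar>f i t\<bar> \<le> M i" by metis
  have "\<bar>tensor f y\<bar> \<le> (\<Prod>i\<in>UNIV. M i)" for y
    unfolding tensor_def abs_prod by (intro prod_mono) (auto simp: M)
  then show ?thesis using M(1) by (intro exI[of _ "\<Prod>i\<in>UNIV. M i"]) (auto intro: prod_pos)
qed

text \<open>Dilation acts on the family of factors, so tensors stay tensors and derivatives can be
  taken factor by factor; on points it is the substitution of (y - x) / h.\<close>

definition dilate :: "real \<Rightarrow> real^'m \<Rightarrow> ('m \<Rightarrow> real \<Rightarrow> real) \<Rightarrow> 'm \<Rightarrow> real \<Rightarrow> real" where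
  "dilate h x f = (\<lambda>i t. f i ((t - x $ i) / h))"

lemma dilate_affine: "dilate h x f i = (\<lambda>t. f i ((1 / h) * t + (- x $ i / h)))"
  by (simp add: dilate_def diff_divide_distrib)

lemma smooth_dilate: "smooth (f i) \<Longrightarrow> smooth (dilate h x f i)"
  unfolding dilate_affine by (rule smooth_affine)

lemma tensor_dilate: "tensor (dilate h x f) y = tensor f ((1 / h) *\<^sub>R (y - x))"
  by (simp add: tensor_def dilate_def)

lemma dilate_upd: "dilate h x (f(i := g)) = (dilate h x f)(i := (\<lambda>t. g ((t - x $ i) / h)))"
  by (auto simp: dilate_def fun_eq_iff)

lemma dilate_eq_0_outside:
  assumes "h > 0" "\<And>t. t \<notin> {a $ i..b $ i} \<Longrightarrow> f i t = 0"
    "t \<notin> {(x + h *\<^sub>R a) $ i..(x + h *\<^sub>R b) $ i}"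
  shows "dilate h x f i t = 0"
  unfolding dilate_def
  by (rule assms(2)) (use assms(1,3) in \<open>auto simp: pos_le_divide_eq pos_divide_le_eq algebra_simps\<close>)

lemma content_scaled_box:
  fixes a b x :: "real^'m"
  assumes "\<And>i. a $ i < b $ i" "h > 0"
  shows "measure lebesgue (cbox (x + h *\<^sub>R a) (x + h *\<^sub>R b)) = h ^ CARD('m) * (\<Prod>i\<in>UNIV. b $ i - a $ i)"
proof -
  have "(x + h *\<^sub>R a) $ i \<le> (x + h *\<^sub>R b) $ i" for i using assms(1)[of i] assms(2) by simp
  then have "cbox (x + h *\<^sub>R a) (x + h *\<^sub>R b) \<noteq> {}"
    by (simp only: interval_ne_empty_cart) auto
  from content_cbox_cart[OF this] show ?thesis
    by (simp add: right_diff_distrib[symmetric] prod.distrib)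
qed

section \<open>Averages against a scaled kernel\<close>

lemma integral_lebesgue_on_support:
  fixes f :: "'a::euclidean_space \<Rightarrow> real"
  assumes "f \<in> borel_measurable borel" "\<And>y. y \<notin> \<Omega> \<Longrightarrow> f y = 0" "\<Omega> \<in> sets lebesgue"
  shows "(\<integral>y. f y \<partial>lebesgue_on \<Omega>) = (\<integral>y. f y \<partial>lborel)"
proof -
  have eq: "(\<lambda>y. indicator \<Omega> y *\<^sub>R f y) = f"
    using assms(2) by (auto simp: indicator_def fun_eq_iff)
  have "(\<integral>y. f y \<partial>lebesgue_on \<Omega>) = (\<integral>y. f y \<partial>lebesgue)"
    by (subst integral_restrict_space) (use assms(3) in \<open>simp_all only: eq, simp\<close>)
  also have "\<dots> = (\<integral>y. f y \<partial>lborel)" using assms(1) by (intro integral_completion) simp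
  finally show ?thesis .
qed

lemma continuous_measurable_lebesgue_on:
  fixes f :: "'a::euclidean_space \<Rightarrow> real"
  assumes "continuous_on UNIV f"
  shows "f \<in> borel_measurable (lebesgue_on \<Omega>)"
  using borel_measurable_continuous_onI[OF assms]
  by (intro measurable_restrict_space1 measurable_completion) simp

abbreviation pure_index :: "nat \<Rightarrow> 'm \<Rightarrow> 'm \<Rightarrow> nat" where
  "pure_index k i \<equiv> (\<lambda>_. 0)(i := k)"

text \<open>The last assumption is A (\<open>\<Phi> i\<close>) = derivative of order k + 1 of
  \<open>\<kappa> i\<close>. The box need not contain 0: averages at x run over a scaled box
  displaced from x, which can be placed inside a cone with vertex x.\<close>

locale scaling_kernel =
  fixes a b :: "real^'m" and k :: nat and \<Phi> \<kappa> :: "'m \<Rightarrow> real \<Rightarrow> real"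
  assumes box: "\<And>i. a $ i < b $ i"
    and smooth_\<Phi>: "\<And>i. smooth (\<Phi> i)" and smooth_\<kappa>: "\<And>i. smooth (\<kappa> i)"
    and supp_\<Phi>: "\<And>i t. t \<notin> {a $ i..b $ i} \<Longrightarrow> \<Phi> i t = 0"
    and supp_\<kappa>: "\<And>i t. t \<notin> {a $ i..b $ i} \<Longrightarrow> \<kappa> i t = 0"
    and int_\<Phi>: "\<And>i. (LBINT t. \<Phi> i t) = 1"
    and scaling: "\<And>i t. - (\<Phi> i t + t * deriv (\<Phi> i) t) = (deriv ^^ Suc k) (\<kappa> i) t"
begin

definition kern :: "real \<Rightarrow> real^'m \<Rightarrow> real^'m \<Rightarrow> real" where
  "kern h x y = tensor (dilate h x \<Phi>) y / h ^ CARD('m)"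

text \<open>Slot i holds only the first derivative of \<open>\<kappa> i\<close>: the other k are
  recovered by the partial derivative of order k in direction i, up to a power of h, and the one
  kept makes the integral vanish.\<close>

definition test :: "real \<Rightarrow> real^'m \<Rightarrow> 'm \<Rightarrow> real^'m \<Rightarrow> real" where
  "test h x i = tensor (dilate h x (\<Phi>(i := deriv (\<kappa> i))))"

abbreviation sbox :: "real \<Rightarrow> real^'m \<Rightarrow> (real^'m) set" where
  "sbox h x \<equiv> cbox (x + h *\<^sub>R a) (x + h *\<^sub>R b)"

lemma smooth_upd: "smooth ((\<Phi>(i := (deriv ^^ n) (\<kappa> i))) j)"
  using smooth_\<Phi> smooth_\<kappa> smooth_deriv_funpow by auto

lemma supp_upd: "t \<notin> {a $ j..b $ j} \<Longrightarrow> (\<Phi>(i := (deriv ^^ n) (\<kappa> i))) j t = 0"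
  using supp_\<Phi> deriv_funpow_eq_0_outside[of "a $ i" "b $ i" "\<kappa> i" t n] supp_\<kappa> by auto

lemma kern_continuous: "h > 0 \<Longrightarrow> continuous_on A (kern h x)"
  unfolding kern_def by (intro continuous_intros tensor_continuous smooth_dilate smooth_\<Phi>) auto

lemma kern_measurable: "h > 0 \<Longrightarrow> kern h x \<in> borel_measurable (lebesgue_on \<Omega>)"
  by (rule continuous_measurable_lebesgue_on[OF kern_continuous])

lemma kern_bounded: "\<exists>M>0. \<forall>h>0. \<forall>x y. \<bar>kern h x y\<bar> \<le> M / h ^ CARD('m)"
  using tensor_bounded[of \<Phi> a b, OF smooth_\<Phi> supp_\<Phi>]
  by (auto simp: kern_def tensor_dilate abs_divide divide_right_mono)

lemma kern_eq_0: "h > 0 \<Longrightarrow> y \<notin> sbox h x \<Longrightarrow> kern h x y = 0"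
  unfolding kern_def
  using tensor_eq_0_outside[of "x + h *\<^sub>R a" "x + h *\<^sub>R b" "dilate h x \<Phi>" y]
    dilate_eq_0_outside[of h a _ b \<Phi>] supp_\<Phi> by auto

lemma test_eq_0: "h > 0 \<Longrightarrow> y \<notin> sbox h x \<Longrightarrow> test h x i y = 0"
  unfolding test_def
  using tensor_eq_0_outside[of "x + h *\<^sub>R a" "x + h *\<^sub>R b" "dilate h x (\<Phi>(i := deriv (\<kappa> i)))" y]
    dilate_eq_0_outside[of h a _ b "\<Phi>(i := deriv (\<kappa> i))"] supp_upd[of _ _ i 1] by auto

lemma test_bounded: "\<exists>M>0. \<forall>h>0. \<forall>x y i. \<bar>test h x i y\<bar> \<le> M"
proof -
  have "\<forall>i. \<exists>M>0. \<forall>y. \<bar>tensor (\<Phi>(i := deriv (\<kappa> i))) y\<bar> \<le> M"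
    using tensor_bounded[of "\<Phi>(i := deriv (\<kappa> i))" a b for i] smooth_upd[of _ 1] supp_upd[of _ _ _ 1] by auto
  then obtain M where M: "\<And>i. M i > 0" "\<And>i y. \<bar>tensor (\<Phi>(i := deriv (\<kappa> i))) y\<bar> \<le> M i" by metis
  have le: "M i \<le> (\<Sum>i\<in>UNIV. M i)" for i
    using M(1) by (intro member_le_sum) (auto intro: less_imp_le)
  have "\<bar>test h x i y\<bar> \<le> (\<Sum>i\<in>UNIV. M i)" for h x i y
    unfolding test_def tensor_dilate using M(2)[of i] le[of i] order_trans by blast
  moreover have "(\<Sum>i\<in>UNIV. M i) > 0" using M(1) by (intro sum_pos) auto
  ultimately show ?thesis by blast
qed

lemma test_test_function:
  assumes "h > 0" "sbox h x \<subseteq> \<Omega>"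
  shows "test h x i \<in> test_functions \<Omega>"
  unfolding test_def
proof (rule tensor_test_function[OF _ _ assms(2)])
  show "smooth (dilate h x (\<Phi>(i := deriv (\<kappa> i))) j)" for j
    using smooth_upd[of i 1 j] by (intro smooth_dilate) simp
  show "dilate h x (\<Phi>(i := deriv (\<kappa> i))) j t = 0"
    if "t \<notin> {(x + h *\<^sub>R a) $ j..(x + h *\<^sub>R b) $ j}" for j t
    using dilate_eq_0_outside[OF assms(1), of a j b "\<Phi>(i := deriv (\<kappa> i))" t] supp_upd[of _ j i 1] that by auto
qed

lemma integral_dilate:
  assumes "h > 0" "smooth (f i)" "\<And>t. t \<notin> {a $ i..b $ i} \<Longrightarrow> f i t = 0"
  shows "integrable lborel (dilate h x f i)" "(LBINT t. dilate h x f i t) = h * (LBINT t. f i t)"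
proof -
  show "integrable lborel (dilate h x f i)"
    using dilate_eq_0_outside[OF assms(1), of a i b f _ x] assms(3)
    by (intro integrable_compact_support[of _ "(x + h *\<^sub>R a) $ i" "(x + h *\<^sub>R b) $ i"]
        smooth_continuous smooth_dilate assms(2)) blast
  have "(LBINT t. dilate h x f i t) = \<bar>h\<bar> *\<^sub>R (LBINT t. dilate h x f i (x $ i + h * t))"
    by (rule lborel_integral_real_affine) (use assms(1) in simp)
  then show "(LBINT t. dilate h x f i t) = h * (LBINT t. f i t)"
    using assms(1) by (simp add: dilate_def)
qed

lemma integral_kern:
  assumes "h > 0" "sbox h x \<subseteq> \<Omega>" "\<Omega> \<in> sets lebesgue"
  shows "(\<integral>y. kern h x y \<partial>lebesgue_on \<Omega>) = 1"
proof -
  have "(\<integral>y. kern h x y \<partial>lebesgue_on \<Omega>) = (\<integral>y. kern h x y \<partial>lborel)"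
    using assms kern_eq_0[OF assms(1)] borel_measurable_continuous_onI[OF kern_continuous[OF assms(1)]]
    by (intro integral_lebesgue_on_support) blast+
  also have "\<dots> = (\<integral>y. tensor (dilate h x \<Phi>) y \<partial>lborel) / h ^ CARD('m)"
    by (simp add: kern_def)
  also have "\<dots> = 1"
    using assms(1) integral_dilate[OF assms(1) smooth_\<Phi> supp_\<Phi>] by (simp add: integral_tensor int_\<Phi>)
  finally show ?thesis .
qed

text \<open>By Fubini the integral is a product whose factor in slot i is the integral of a
  derivative with compact support.\<close>

lemma integral_test:
  assumes "h > 0" "sbox h x \<subseteq> \<Omega>" "\<Omega> \<in> sets lebesgue"
  shows "(\<integral>y. test h x i y \<partial>lebesgue_on \<Omega>) = 0"
proof -
  let ?f = "\<Phi>(i := deriv (\<kappa> i))"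
  have c: "continuous_on UNIV (test h x i)"
    unfolding test_def using smooth_upd[of i 1] by (intro tensor_continuous smooth_dilate) simp
  have "(\<integral>y. test h x i y \<partial>lebesgue_on \<Omega>) = (\<integral>y. test h x i y \<partial>lborel)"
    using assms test_eq_0[OF assms(1)] borel_measurable_continuous_onI[OF c]
    by (intro integral_lebesgue_on_support) blast+
  also have "\<dots> = (\<Prod>j\<in>UNIV. (LBINT t. dilate h x ?f j t))"
    unfolding test_def using smooth_upd[of i 1] supp_upd[of _ _ i 1]
    by (intro integral_tensor integral_dilate(1)[OF assms(1)]) auto
  also have "\<dots> = 0"
  proof (rule prod_zero)
    have "(LBINT t. dilate h x ?f i t) = h * (LBINT t. deriv (\<kappa> i) t)"
      using integral_dilate(2)[OF assms(1), of ?f i] smooth_upd[of i 1 i] supp_upd[of _ i i 1] by simp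
    also have "(LBINT t. deriv (\<kappa> i) t) = 0"
      by (rule integral_deriv_compact_support[OF smooth_\<kappa> supp_\<kappa>]) (use box[of i] in auto)
    finally have "(LBINT t. dilate h x ?f i t) = 0" by (simp only: mult_zero_right)
    then show "\<exists>j\<in>UNIV. (LBINT t. dilate h x ?f j t) = 0" by (rule bexI[OF _ UNIV_I])
  qed simp
  finally show ?thesis .
qed

text \<open>The chain rule costs 1 / h for each of the k derivatives in slot i. The right-hand side
  is a summand of the scale derivative of \<open>kern\<close>, up to powers of h.\<close>

lemma multi_partial_test:
  assumes "h > 0"
  shows "multi_partial (pure_index k i) (test h x i) =
    (\<lambda>y. tensor (dilate h x (\<Phi>(i := (deriv ^^ Suc k) (\<kappa> i)))) y / h ^ k)"
proof
  fix y
  have sm: "smooth (dilate h x (\<Phi>(i := deriv (\<kappa> i))) j)" for j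
    using smooth_upd[of i 1 j] by (intro smooth_dilate) simp
  have d: "(deriv ^^ k) (dilate h x (\<Phi>(i := deriv (\<kappa> i))) i) =
      (\<lambda>t. (1 / h) ^ k * dilate h x (\<Phi>(i := (deriv ^^ Suc k) (\<kappa> i))) i t)"
    unfolding dilate_affine
    by (simp only: fun_upd_same deriv_funpow_affine[OF smooth_deriv(1)[OF smooth_\<kappa>]] funpow_Suc_right comp_apply)
  have "multi_partial (pure_index k i) (test h x i) y =
      tensor (\<lambda>j. (deriv ^^ (if j = i then k else 0)) (dilate h x (\<Phi>(i := deriv (\<kappa> i))) j)) y"
    unfolding test_def by (subst multi_partial_tensor[OF sm]) (simp add: if_distrib)
  also have "(\<lambda>j. (deriv ^^ (if j = i then k else 0)) (dilate h x (\<Phi>(i := deriv (\<kappa> i))) j)) =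
      (dilate h x (\<Phi>(i := (deriv ^^ Suc k) (\<kappa> i))))(i := (\<lambda>t. (1 / h) ^ k * dilate h x (\<Phi>(i := (deriv ^^ Suc k) (\<kappa> i))) i t))"
    using d by (auto simp: fun_eq_iff dilate_def)
  also have "tensor \<dots> y = (1 / h) ^ k * tensor (dilate h x (\<Phi>(i := (deriv ^^ Suc k) (\<kappa> i)))) y"
    by (simp only: tensor_upd mult.assoc) (simp only: tensor_upd[symmetric] fun_upd_triv)
  finally show "multi_partial (pure_index k i) (test h x i) y =
      tensor (dilate h x (\<Phi>(i := (deriv ^^ Suc k) (\<kappa> i)))) y / h ^ k"
    by (simp only: power_one_over times_divide_eq_left mult_1_left)
qed

text \<open>With one factor 1 / h given to each slot, the differentiated slot contributes A
  (\<open>\<Phi> i\<close>) / h^2 and each of the m - 1 others 1 / h, whence h^(m + 1).\<close>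

lemma kern_has_derivative:
  assumes "h > 0"
  shows "((\<lambda>h. kern h x y) has_real_derivative
    (\<Sum>i\<in>UNIV. tensor (dilate h x (\<Phi>(i := (deriv ^^ Suc k) (\<kappa> i)))) y) / h ^ (CARD('m) + 1)) (at h)"
proof -
  have 1: "((\<lambda>h. \<Phi> i ((y $ i - x $ i) / h) / h) has_real_derivative
      (deriv ^^ Suc k) (\<kappa> i) ((y $ i - x $ i) / h) / h\<^sup>2) (at h)" for i
  proof -
    define \<tau> where "\<tau> = y $ i - x $ i"
    have q: "((\<lambda>h. \<tau> / h) has_real_derivative - \<tau> / h\<^sup>2) (at h)"
      using assms by (auto intro!: derivative_eq_intros simp: power2_eq_square)
    have "((\<lambda>h. \<Phi> i (\<tau> / h) / h) has_real_derivative
        (deriv (\<Phi> i) (\<tau> / h) * (- \<tau> / h\<^sup>2) * h - \<Phi> i (\<tau> / h) * 1) / (h * h)) (at h)"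
      by (intro DERIV_divide DERIV_chain2[OF smooth_deriv(2)[OF smooth_\<Phi>] q] DERIV_ident) (use assms in simp)
    moreover have "(deriv (\<Phi> i) (\<tau> / h) * (- \<tau> / h\<^sup>2) * h - \<Phi> i (\<tau> / h) * 1) / (h * h) =
        - (\<Phi> i (\<tau> / h) + (\<tau> / h) * deriv (\<Phi> i) (\<tau> / h)) / h\<^sup>2"
      using assms by (simp add: field_simps power2_eq_square)
    ultimately show ?thesis unfolding scaling \<tau>_def by simp
  qed
  have "((\<lambda>h. \<Prod>i\<in>UNIV. \<Phi> i ((y $ i - x $ i) / h) / h) has_derivative
      (\<lambda>d. \<Sum>i\<in>UNIV. ((deriv ^^ Suc k) (\<kappa> i) ((y $ i - x $ i) / h) / h\<^sup>2 * d) *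
        (\<Prod>j\<in>UNIV - {i}. \<Phi> j ((y $ j - x $ j) / h) / h))) (at h)"
    by (rule has_derivative_prod) (rule 1[unfolded has_field_derivative_def])
  moreover have "(\<lambda>d. \<Sum>i\<in>UNIV. ((deriv ^^ Suc k) (\<kappa> i) ((y $ i - x $ i) / h) / h\<^sup>2 * d) *
        (\<Prod>j\<in>UNIV - {i}. \<Phi> j ((y $ j - x $ j) / h) / h)) =
      (*) ((\<Sum>i\<in>UNIV. tensor (dilate h x (\<Phi>(i := (deriv ^^ Suc k) (\<kappa> i)))) y) / h ^ (CARD('m) + 1))"
  proof
    fix d
    have c: "CARD('m) + 1 = 2 + (CARD('m) - 1)"
      using zero_less_card_finite[where 'a='m] by simp
    have "((deriv ^^ Suc k) (\<kappa> i) ((y $ i - x $ i) / h) / h\<^sup>2 * d) *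
        (\<Prod>j\<in>UNIV - {i}. \<Phi> j ((y $ j - x $ j) / h) / h) =
        tensor (dilate h x (\<Phi>(i := (deriv ^^ Suc k) (\<kappa> i)))) y / h ^ (CARD('m) + 1) * d" for i
      unfolding dilate_upd tensor_upd c power_add
      by (simp add: prod_dividef card_Diff_singleton dilate_def del: funpow.simps)
    then show "(\<Sum>i\<in>UNIV. ((deriv ^^ Suc k) (\<kappa> i) ((y $ i - x $ i) / h) / h\<^sup>2 * d) *
        (\<Prod>j\<in>UNIV - {i}. \<Phi> j ((y $ j - x $ j) / h) / h)) =
      (\<Sum>i\<in>UNIV. tensor (dilate h x (\<Phi>(i := (deriv ^^ Suc k) (\<kappa> i)))) y) / h ^ (CARD('m) + 1) * d"
      by (simp only: sum_divide_distrib sum_distrib_right)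
  qed
  moreover have "(\<lambda>h. kern h x y) = (\<lambda>h. \<Prod>i\<in>UNIV. \<Phi> i ((y $ i - x $ i) / h) / h)"
    by (simp add: kern_def tensor_def dilate_def prod_dividef fun_eq_iff)
  ultimately show ?thesis by (simp add: has_field_derivative_def del: funpow.simps)
qed

end

definition seminorm_top :: "real \<Rightarrow> (real^'m) set \<Rightarrow> (real^'m \<Rightarrow> real) \<Rightarrow> real" where
  "seminorm_top r \<Omega> v = (if r > 0
     then sqrt (integral\<^sup>L (lebesgue_on \<Omega> \<Otimes>\<^sub>M lebesgue_on \<Omega>) (gagliardo_kernel r v))
     else sqrt (\<integral>y. (v y)\<^sup>2 \<partial>lebesgue_on \<Omega>))"

lemma seminorm_top_nonneg: "seminorm_top r \<Omega> v \<ge> 0"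
  by (auto simp: seminorm_top_def gagliardo_kernel_def case_prod_beta)

context scaling_kernel
begin

text \<open>The test functions are bounded independently of the scale. For r > 0 the diameter h *
  norm (b - a) of the box enters through the Gagliardo bound, for r = 0 its volume of order h^m
  through Cauchy-Schwarz; either way the power is m/2 + r. One constant serves all domains.\<close>

lemma test_pairing_bound:
  assumes r: "r \<ge> 0"
  shows "\<exists>C>0. \<forall>\<Omega> v x h i. \<Omega> \<in> lmeasurable \<longrightarrow> square_integrable (lebesgue_on \<Omega>) v \<longrightarrow>
    (r > 0 \<longrightarrow> integrable (lebesgue_on \<Omega> \<Otimes>\<^sub>M lebesgue_on \<Omega>) (gagliardo_kernel r v)) \<longrightarrow>
    h > 0 \<longrightarrow> sbox h x \<subseteq> \<Omega> \<longrightarrow>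
    \<bar>\<integral>y. v y * test h x i y \<partial>lebesgue_on \<Omega>\<bar> \<le>
      C * h powr (real CARD('m) / 2 + r) * seminorm_top r \<Omega> v"
proof -
  obtain M where M: "M > 0" "\<And>h x y i. h > 0 \<Longrightarrow> \<bar>test h x i y\<bar> \<le> M"
    using test_bounded by blast
  define Q where "Q = (\<Prod>i\<in>UNIV. b $ i - a $ i)"
  have Q: "Q > 0" unfolding Q_def using box by (intro prod_pos) simp
  define C where "C = M * (if r > 0 then norm (b - a) powr (real CARD('m) / 2 + r) else sqrt Q)"
  have "a \<noteq> b" using box by (metis less_irrefl)
  then have "C > 0" using M(1) Q by (simp add: C_def)
  moreover have "\<bar>\<integral>y. v y * test h x i y \<partial>lebesgue_on \<Omega>\<bar> \<le>
      C * h powr (real CARD('m) / 2 + r) * seminorm_top r \<Omega> v"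
    if \<Omega>: "\<Omega> \<in> lmeasurable" and v: "square_integrable (lebesgue_on \<Omega>) v"
      and K: "r > 0 \<longrightarrow> integrable (lebesgue_on \<Omega> \<Otimes>\<^sub>M lebesgue_on \<Omega>) (gagliardo_kernel r v)"
      and h: "h > 0" and sub: "sbox h x \<subseteq> \<Omega>" for \<Omega> v x h i
  proof -
    let ?B = "sbox h x"
    have tm: "test h x i \<in> borel_measurable (lebesgue_on \<Omega>)"
      using smooth_upd[of i 1] unfolding test_def
      by (intro continuous_measurable_lebesgue_on tensor_continuous smooth_dilate) simp
    have B: "?B \<in> sets (lebesgue_on \<Omega>)"
      using sub \<Omega> by (simp add: sets_restrict_space_iff fmeasurableD)
    have mB: "measure (lebesgue_on \<Omega>) ?B = h ^ CARD('m) * Q"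
    proof -
      have "measure (lebesgue_on \<Omega>) ?B = measure lebesgue ?B"
        using sub \<Omega> by (intro measure_restrict_space) (auto simp: fmeasurableD)
      then show ?thesis using content_scaled_box[OF box h, of x] by (simp only: Q_def)
    qed
    show ?thesis
    proof (cases "r > 0")
      case True
      have d: "norm (y - z) \<le> h * norm (b - a)" if "y \<in> ?B" "z \<in> ?B" for y z
      proof -
        have "norm (y - z) \<le> norm (h *\<^sub>R (b - a))"
        proof (rule norm_le_componentwise_cart)
          fix j
          have "(x + h *\<^sub>R a) $ j \<le> y $ j" "y $ j \<le> (x + h *\<^sub>R b) $ j"
            "(x + h *\<^sub>R a) $ j \<le> z $ j" "z $ j \<le> (x + h *\<^sub>R b) $ j"
            using that by (auto simp only: mem_box_cart)
          then show "norm ((y - z) $ j) \<le> norm ((h *\<^sub>R (b - a)) $ j)"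
            by (simp add: algebra_simps)
        qed
        then show ?thesis using h by simp
      qed
      have "\<bar>\<integral>y. v y * test h x i y \<partial>lebesgue_on \<Omega>\<bar> \<le>
          sqrt (integral\<^sup>L (lebesgue_on \<Omega> \<Otimes>\<^sub>M lebesgue_on \<Omega>) (gagliardo_kernel r v)) *
          (\<bar>M\<bar> * (h * norm (b - a)) powr (real CARD('m) / 2 + r))"
        by (rule gagliardo_integral_bound[OF \<Omega> v _ tm _ B _ d _ integral_test[OF h sub]])
          (use True K M(2)[OF h] test_eq_0[OF h] h Q \<Omega> mB in \<open>auto simp: fmeasurableD\<close>)
      also have "(h * norm (b - a)) powr (real CARD('m) / 2 + r) =
          h powr (real CARD('m) / 2 + r) * norm (b - a) powr (real CARD('m) / 2 + r)"
        using h by (simp add: powr_mult)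
      finally show ?thesis using True M(1) by (simp add: seminorm_top_def C_def mult_ac)
    next
      case False
      with r have r0: "r = 0" by simp
      have "\<bar>\<integral>y. v y * test h x i y \<partial>lebesgue_on \<Omega>\<bar> \<le>
          sqrt (\<integral>y. (v y)\<^sup>2 \<partial>lebesgue_on \<Omega>) * (\<bar>M\<bar> * sqrt (measure (lebesgue_on \<Omega>) ?B))"
        by (rule integral_mult_square_bound[OF finite_measure_lebesgue_on[OF \<Omega>] v tm _ B])
          (use M(2)[OF h] test_eq_0[OF h] in auto)
      also have "sqrt (measure (lebesgue_on \<Omega>) ?B) = h powr (real CARD('m) / 2) * sqrt Q"
        using h by (simp add: mB real_sqrt_mult powr_half_sqrt[symmetric] powr_realpow[symmetric] powr_powr)
      finally show ?thesis using False M(1) r0 by (simp add: seminorm_top_def C_def mult_ac)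
    qed
  qed
  ultimately show ?thesis by blast
qed

text \<open>An approximate identity without a sign: instead of positivity the bound M / h^m on a box
  of volume h^m Q is used, so the kernels are bounded in L1 by M Q.\<close>

lemma kern_average_tendsto:
  assumes \<Omega>: "\<Omega> \<in> lmeasurable" "x \<in> \<Omega>" and sub: "\<And>h. 0 < h \<Longrightarrow> h \<le> 1 \<Longrightarrow> sbox h x \<subseteq> \<Omega>"
    and u: "continuous_on \<Omega> u" "integrable (lebesgue_on \<Omega>) u" and e: "e > 0"
  shows "\<exists>d>0. \<forall>h. 0 < h \<longrightarrow> h < d \<longrightarrow> h \<le> 1 \<longrightarrow> \<bar>u x - (\<integral>y. u y * kern h x y \<partial>lebesgue_on \<Omega>)\<bar> \<le> e"
proof -
  interpret finite_measure "lebesgue_on \<Omega>" by (rule finite_measure_lebesgue_on[OF \<Omega>(1)])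
  obtain M where M: "M > 0" "\<And>h y. h > 0 \<Longrightarrow> \<bar>kern h x y\<bar> \<le> M / h ^ CARD('m)"
    using kern_bounded by blast
  define Q where "Q = (\<Prod>i\<in>UNIV. b $ i - a $ i)"
  have Q: "Q > 0" unfolding Q_def using box by (intro prod_pos) simp
  \<comment> \<open>The tolerance divided by the uniform L1 bound of the kernels.\<close>
  define e' where "e' = e / (M * Q)"
  have e': "e' > 0" using e M Q by (simp add: e'_def)
  obtain d where d: "d > 0" "\<And>y. y \<in> \<Omega> \<Longrightarrow> dist y x < d \<Longrightarrow> \<bar>u y - u x\<bar> < e'"
    using u(1)[unfolded continuous_on_iff, rule_format, OF \<Omega>(2) e'] by (auto simp: dist_real_def)
  obtain R where R: "R > 0" "\<And>z. z \<in> cbox a b \<Longrightarrow> norm z \<le> R"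
    using bounded_cbox[of a b] unfolding bounded_pos by blast
  have "\<bar>u x - (\<integral>y. u y * kern h x y \<partial>lebesgue_on \<Omega>)\<bar> \<le> e" if h: "0 < h" "h < d / R" "h \<le> 1" for h
  proof -
    let ?B = "sbox h x"
    have B: "?B \<in> sets (lebesgue_on \<Omega>)"
      using sub[OF h(1,3)] \<Omega> by (simp add: sets_restrict_space_iff fmeasurableD)
    have mB: "measure (lebesgue_on \<Omega>) ?B = h ^ CARD('m) * Q"
    proof -
      have "measure (lebesgue_on \<Omega>) ?B = measure lebesgue ?B"
        using sub[OF h(1,3)] \<Omega> by (intro measure_restrict_space) (auto simp: fmeasurableD)
      then show ?thesis using content_scaled_box[OF box h(1), of x] by (simp only: Q_def)
    qed
    have near: "dist y x < d" if "y \<in> ?B" for y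
    proof -
      have "(1 / h) *\<^sub>R (y - x) \<in> cbox a b"
        using that h(1) unfolding mem_box_cart
        by (auto simp: pos_le_divide_eq pos_divide_le_eq algebra_simps)
      then have "norm ((1 / h) *\<^sub>R (y - x)) \<le> R" by (rule R(2))
      then have "norm (y - x) \<le> h * R" using h(1) by (simp add: divide_le_eq mult.commute)
      also have "\<dots> < d" using h(2) R(1) by (simp add: pos_less_divide_eq)
      finally show ?thesis by (simp add: dist_norm)
    qed
    have km: "kern h x \<in> borel_measurable (lebesgue_on \<Omega>)" by (rule kern_measurable[OF h(1)])
    have ik: "integrable (lebesgue_on \<Omega>) (kern h x)"
      by (rule integrable_const_bound[of _ "M / h ^ CARD('m)"]) (use M(2)[OF h(1)] km in auto)
    have iuk: "integrable (lebesgue_on \<Omega>) (\<lambda>y. u y * kern h x y)"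
      by (rule integrable_mult_bounded[OF u(2) km]) (use M(2)[OF h(1)] in auto)
    have "(\<integral>y. (u x - u y) * kern h x y \<partial>lebesgue_on \<Omega>) =
        (\<integral>y. u x * kern h x y - u y * kern h x y \<partial>lebesgue_on \<Omega>)"
      by (simp add: left_diff_distrib)
    also have "\<dots> = u x - (\<integral>y. u y * kern h x y \<partial>lebesgue_on \<Omega>)"
      using integral_kern[OF h(1) sub[OF h(1,3)]] \<Omega>(1) ik iuk by (simp add: fmeasurableD)
    finally have eq: "u x - (\<integral>y. u y * kern h x y \<partial>lebesgue_on \<Omega>) = (\<integral>y. (u x - u y) * kern h x y \<partial>lebesgue_on \<Omega>)" ..
    have "\<bar>\<integral>y. (u x - u y) * kern h x y \<partial>lebesgue_on \<Omega>\<bar> \<le> (\<integral>y. \<bar>(u x - u y) * kern h x y\<bar> \<partial>lebesgue_on \<Omega>)"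
      by (rule integral_abs_bound)
    also have "\<dots> \<le> (\<integral>y. (e' * (M / h ^ CARD('m))) * indicator ?B y \<partial>lebesgue_on \<Omega>)"
    proof (rule integral_mono)
      show "integrable (lebesgue_on \<Omega>) (\<lambda>y. \<bar>(u x - u y) * kern h x y\<bar>)"
        using ik iuk by (intro integrable_abs) (simp add: left_diff_distrib)
      show "integrable (lebesgue_on \<Omega>) (\<lambda>y. (e' * (M / h ^ CARD('m))) * indicator ?B y)"
        using B by (intro integrable_mult_right integrable_real_indicator) (auto simp: less_top[symmetric])
      fix y assume y: "y \<in> space (lebesgue_on \<Omega>)"
      show "\<bar>(u x - u y) * kern h x y\<bar> \<le> (e' * (M / h ^ CARD('m))) * indicator ?B y"
      proof (cases "y \<in> ?B")
        case True
        then have "\<bar>u x - u y\<bar> \<le> e'" using d(2)[of y] near[OF True] y by (simp add: abs_minus_commute)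
        then have "\<bar>u x - u y\<bar> * \<bar>kern h x y\<bar> \<le> e' * (M / h ^ CARD('m))"
          using e' by (intro mult_mono M(2)[OF h(1)]) auto
        then show ?thesis using True by (simp add: abs_mult)
      qed (simp add: kern_eq_0[OF h(1)])
    qed
    also have "\<dots> = e' * (M / h ^ CARD('m)) * measure (lebesgue_on \<Omega>) ?B"
    proof -
      have "?B \<inter> \<Omega> = ?B" using sub[OF h(1,3)] by blast
      then show ?thesis using B by simp
    qed
    also have "\<dots> = e" using h(1) M(1) Q unfolding mB by (simp add: e'_def)
    finally show ?thesis unfolding eq .
  qed
  moreover have "d / R > 0" using d(1) R(1) by simp
  ultimately show ?thesis by blast
qed

end

context scaling_kernel
begin

lemma kern_average_has_derivative:
  assumes \<Omega>: "\<Omega> \<in> lmeasurable" and u: "integrable (lebesgue_on \<Omega>) u" and h: "h > 0"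
  shows "((\<lambda>h. \<integral>y. u y * kern h x y \<partial>lebesgue_on \<Omega>) has_real_derivative
    (\<Sum>i\<in>UNIV. \<integral>y. u y * tensor (dilate h x (\<Phi>(i := (deriv ^^ Suc k) (\<kappa> i)))) y \<partial>lebesgue_on \<Omega>) / h ^ (CARD('m) + 1)) (at h)"
proof -
  let ?t = "\<lambda>h i. tensor (dilate h x (\<Phi>(i := (deriv ^^ Suc k) (\<kappa> i))))"
  let ?n = "CARD('m) + 1"
  obtain M where M: "M > 0" "\<And>h y. h > 0 \<Longrightarrow> \<bar>kern h x y\<bar> \<le> M / h ^ CARD('m)"
    using kern_bounded by blast
  have "\<forall>i. \<exists>M>0. \<forall>y. \<bar>tensor (\<Phi>(i := (deriv ^^ Suc k) (\<kappa> i))) y\<bar> \<le> M"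
    by (intro allI tensor_bounded[of _ a b] smooth_upd supp_upd)
  then obtain N where N: "\<And>i. N i > 0" "\<And>i y. \<bar>tensor (\<Phi>(i := (deriv ^^ Suc k) (\<kappa> i))) y\<bar> \<le> N i" by metis
  have tb: "\<bar>?t h i y\<bar> \<le> N i" for h i y unfolding tensor_dilate by (rule N(2))
  have tm: "?t h i \<in> borel_measurable (lebesgue_on \<Omega>)" for h i
    by (intro continuous_measurable_lebesgue_on tensor_continuous smooth_dilate smooth_upd)
  have "((\<lambda>r. \<integral>y. u y * kern r x y \<partial>lebesgue_on \<Omega>) has_real_derivative
      (\<integral>y. u y * ((\<Sum>i\<in>UNIV. ?t h i y) / h ^ ?n) \<partial>lebesgue_on \<Omega>)) (at h)"
  \<comment> \<open>Between h / 2 and 2 h the scale stays away from 0, so the negative powers of r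
    admit a common bound.\<close>
  proof (rule has_derivative_under_integral[OF u, where p="h / 2" and q="2 * h" and
        B="(\<Sum>i\<in>UNIV. N i) / (h / 2) ^ ?n" and C="\<lambda>r. M / r ^ CARD('m)"
        and G'="\<lambda>r y. (\<Sum>i\<in>UNIV. ?t r i y) / r ^ ?n"])
    show "h \<in> {h / 2<..<2 * h}" using h by simp
    show "(\<lambda>y. (\<Sum>i\<in>UNIV. ?t h i y) / h ^ ?n) \<in> borel_measurable (lebesgue_on \<Omega>)"
      by (intro borel_measurable_divide borel_measurable_sum tm borel_measurable_const)
    fix r assume "r \<in> {h / 2<..<2 * h}"
    then have r: "r > 0" "r \<ge> h / 2" using h by auto
    show "kern r x \<in> borel_measurable (lebesgue_on \<Omega>)" by (rule kern_measurable[OF r(1)])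
    fix y
    show "((\<lambda>r. kern r x y) has_real_derivative (\<Sum>i\<in>UNIV. ?t r i y) / r ^ ?n) (at r)"
      by (rule kern_has_derivative[OF r(1)])
    show "\<bar>kern r x y\<bar> \<le> M / r ^ CARD('m)" by (rule M(2)[OF r(1)])
    have "\<bar>\<Sum>i\<in>UNIV. ?t r i y\<bar> \<le> (\<Sum>i\<in>UNIV. N i)"
      by (rule order_trans[OF sum_abs sum_mono]) (rule tb)
    then have "\<bar>(\<Sum>i\<in>UNIV. ?t r i y) / r ^ ?n\<bar> \<le> (\<Sum>i\<in>UNIV. N i) / r ^ ?n"
      using r(1) by (simp add: abs_divide divide_right_mono)
    also have "\<dots> \<le> (\<Sum>i\<in>UNIV. N i) / (h / 2) ^ ?n"
      using r h N(1) by (intro divide_left_mono power_mono mult_pos_pos sum_nonneg)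
        (auto intro: less_imp_le simp del: power_Suc power_add)
    finally show "\<bar>(\<Sum>i\<in>UNIV. ?t r i y) / r ^ ?n\<bar> \<le> (\<Sum>i\<in>UNIV. N i) / (h / 2) ^ ?n" .
  qed
  also have "(\<integral>y. u y * ((\<Sum>i\<in>UNIV. ?t h i y) / h ^ ?n) \<partial>lebesgue_on \<Omega>) =
      (\<integral>y. (\<Sum>i\<in>UNIV. u y * ?t h i y) / h ^ ?n \<partial>lebesgue_on \<Omega>)"
    by (simp only: times_divide_eq_right sum_distrib_left)
  also have "\<dots> = (\<integral>y. (\<Sum>i\<in>UNIV. u y * ?t h i y) \<partial>lebesgue_on \<Omega>) / h ^ ?n"
    by (rule integral_divide_zero)
  also have "(\<integral>y. (\<Sum>i\<in>UNIV. u y * ?t h i y) \<partial>lebesgue_on \<Omega>) = (\<Sum>i\<in>UNIV. \<integral>y. u y * ?t h i y \<partial>lebesgue_on \<Omega>)"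
    by (rule Bochner_Integration.integral_sum) (rule integrable_mult_bounded[OF u tm tb])
  finally show ?thesis .
qed

text \<open>The derivative of the averages with respect to the scale only sees derivatives of order
  \<open>k\<close>, which gives a power of the scale that is integrable at \<open>0\<close> precisely for \<open>k + r > m/2\<close>.\<close>

lemma pointwise_estimate:
  assumes r: "0 \<le> r" and \<gamma>: "real k + r > real CARD('m) / 2"
  shows "\<exists>C>0. \<forall>\<Omega> u v x. \<Omega> \<in> lmeasurable \<longrightarrow> x \<in> \<Omega> \<longrightarrow> (\<forall>h. 0 < h \<longrightarrow> h \<le> 1 \<longrightarrow> sbox h x \<subseteq> \<Omega>) \<longrightarrow>
    continuous_on \<Omega> u \<longrightarrow> integrable (lebesgue_on \<Omega>) u \<longrightarrow>
    (\<forall>i. is_weak_deriv \<Omega> (pure_index k i) u (v i) \<and> square_integrable (lebesgue_on \<Omega>) (v i) \<and>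
      (r > 0 \<longrightarrow> integrable (lebesgue_on \<Omega> \<Otimes>\<^sub>M lebesgue_on \<Omega>) (gagliardo_kernel r (v i)))) \<longrightarrow>
    (\<forall>h. 0 < h \<longrightarrow> h \<le> 1 \<longrightarrow> \<bar>u x - (\<integral>y. u y * kern h x y \<partial>lebesgue_on \<Omega>)\<bar> \<le>
      C * h powr (real k + r - real CARD('m) / 2) * (\<Sum>i\<in>UNIV. seminorm_top r \<Omega> (v i)))"
proof -
  define \<gamma> where "\<gamma> = real k + r - real CARD('m) / 2"
  have \<gamma>0: "\<gamma> > 0" using assms by (simp add: \<gamma>_def)
  obtain C where C: "C > 0" and tp: "\<And>\<Omega> v x h i. \<Omega> \<in> lmeasurable \<Longrightarrow> square_integrable (lebesgue_on \<Omega>) v \<Longrightarrow>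
    (r > 0 \<longrightarrow> integrable (lebesgue_on \<Omega> \<Otimes>\<^sub>M lebesgue_on \<Omega>) (gagliardo_kernel r v)) \<Longrightarrow>
    h > 0 \<Longrightarrow> sbox h x \<subseteq> \<Omega> \<Longrightarrow>
    \<bar>\<integral>y. v y * test h x i y \<partial>lebesgue_on \<Omega>\<bar> \<le>
      C * h powr (real CARD('m) / 2 + r) * seminorm_top r \<Omega> v"
    using test_pairing_bound[OF r] by blast
  have main: "\<bar>u x - (\<integral>y. u y * kern h x y \<partial>lebesgue_on \<Omega>)\<bar> \<le>
      C / \<gamma> * h powr \<gamma> * (\<Sum>i\<in>UNIV. seminorm_top r \<Omega> (v i))"
    if \<Omega>: "\<Omega> \<in> lmeasurable" "x \<in> \<Omega>" and sub: "\<And>h. 0 < h \<Longrightarrow> h \<le> 1 \<Longrightarrow> sbox h x \<subseteq> \<Omega>"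
      and u: "continuous_on \<Omega> u" "integrable (lebesgue_on \<Omega>) u"
      and v: "\<And>i. is_weak_deriv \<Omega> (pure_index k i) u (v i)" "\<And>i. square_integrable (lebesgue_on \<Omega>) (v i)"
        "\<And>i. r > 0 \<longrightarrow> integrable (lebesgue_on \<Omega> \<Otimes>\<^sub>M lebesgue_on \<Omega>) (gagliardo_kernel r (v i))"
      and h: "0 < h" "h \<le> 1" for \<Omega> u v x h
  proof -
    define S where "S = (\<Sum>i\<in>UNIV. seminorm_top r \<Omega> (v i))"
    define V where "V h = (\<integral>y. u y * kern h x y \<partial>lebesgue_on \<Omega>)" for h
    define V' where "V' h = (\<Sum>i\<in>UNIV. \<integral>y. u y * tensor (dilate h x (\<Phi>(i := (deriv ^^ Suc k) (\<kappa> i)))) y \<partial>lebesgue_on \<Omega>) / h ^ (CARD('m) + 1)" for h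
    have dV: "(V has_real_derivative V' t) (at t)" if "t > 0" for t
      unfolding V_def V'_def by (rule kern_average_has_derivative[OF \<Omega>(1) u(2) that])
    have S0: "S \<ge> 0" unfolding S_def by (intro sum_nonneg) (simp add: seminorm_top_nonneg)
    have bV: "\<bar>V' t\<bar> \<le> C * S * t powr (\<gamma> - 1)" if t: "0 < t" "t \<le> 1" for t
    proof -
      \<comment> \<open>\<open>multi_partial_test\<close> read backwards: k derivatives move from
        the test function to u at the price of t^k, and the sign disappears under the absolute
        value.\<close>
      have one: "\<bar>\<integral>y. u y * tensor (dilate t x (\<Phi>(i := (deriv ^^ Suc k) (\<kappa> i)))) y \<partial>lebesgue_on \<Omega>\<bar> \<le>
          t ^ k * (C * t powr (real CARD('m) / 2 + r) * seminorm_top r \<Omega> (v i))" for i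
      proof -
        have "(\<integral>y. u y * multi_partial (pure_index k i) (test t x i) y \<partial>lebesgue_on \<Omega>) =
            (-1) ^ multi_order (pure_index k i) * (\<integral>y. v i y * test t x i y \<partial>lebesgue_on \<Omega>)"
          using v(1)[of i] test_test_function[OF t(1) sub[OF t], of i] by (simp add: is_weak_deriv_def)
        then have "\<bar>(\<integral>y. u y * multi_partial (pure_index k i) (test t x i) y \<partial>lebesgue_on \<Omega>)\<bar> =
            \<bar>\<integral>y. v i y * test t x i y \<partial>lebesgue_on \<Omega>\<bar>"
          by (simp add: abs_mult power_abs)
        also have "\<dots> \<le> C * t powr (real CARD('m) / 2 + r) * seminorm_top r \<Omega> (v i)"
          by (rule tp[OF \<Omega>(1) v(2,3) t(1) sub[OF t]])
        finally have le: "\<bar>(\<integral>y. u y * multi_partial (pure_index k i) (test t x i) y \<partial>lebesgue_on \<Omega>)\<bar> \<le>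
          C * t powr (real CARD('m) / 2 + r) * seminorm_top r \<Omega> (v i)" .
        have "(\<integral>y. u y * tensor (dilate t x (\<Phi>(i := (deriv ^^ Suc k) (\<kappa> i)))) y \<partial>lebesgue_on \<Omega>) =
            (\<integral>y. t ^ k * (u y * multi_partial (pure_index k i) (test t x i) y) \<partial>lebesgue_on \<Omega>)"
          unfolding multi_partial_test[OF t(1)] using t(1) by (intro Bochner_Integration.integral_cong) auto
        also have "\<dots> = t ^ k * (\<integral>y. u y * multi_partial (pure_index k i) (test t x i) y \<partial>lebesgue_on \<Omega>)"
          by (rule integral_mult_right_zero)
        finally show ?thesis using le t(1) by (simp only: abs_mult) (auto intro: mult_left_mono)
      qed
      have "\<bar>V' t\<bar> \<le> (\<Sum>i\<in>UNIV. t ^ k * (C * t powr (real CARD('m) / 2 + r) * seminorm_top r \<Omega> (v i))) / t ^ (CARD('m) + 1)"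
        unfolding V'_def abs_divide using t(1)
        by (simp only: abs_of_pos zero_less_power) (intro divide_right_mono order_trans[OF sum_abs sum_mono] one, auto)
      also have "\<dots> = C * S * (t ^ k * t powr (real CARD('m) / 2 + r) / t ^ (CARD('m) + 1))"
        unfolding S_def sum_distrib_left[symmetric] by (simp add: mult_ac)
      also have "t ^ k * t powr (real CARD('m) / 2 + r) / t ^ (CARD('m) + 1) = t powr (\<gamma> - 1)"
      proof -
        have "t ^ k * t powr (real CARD('m) / 2 + r) / t ^ (CARD('m) + 1) =
            t powr real k * t powr (real CARD('m) / 2 + r) / t powr real (CARD('m) + 1)"
          using t(1) by (simp only: powr_realpow)
        also have "\<dots> = t powr (real k + (real CARD('m) / 2 + r) - real (CARD('m) + 1))"
          by (simp only: powr_add powr_diff)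
        also have "real k + (real CARD('m) / 2 + r) - real (CARD('m) + 1) = \<gamma> - 1"
          by (simp add: \<gamma>_def)
        finally show ?thesis .
      qed
      finally show ?thesis .
    qed
    have diff: "\<bar>V h - V t\<bar> \<le> C / \<gamma> * h powr \<gamma> * S" if t: "0 < t" "t < h" for t
    proof -
      \<comment> \<open>A primitive of the bound on V', compared with V by the mean value
        inequality; \<gamma> > 0 keeps it bounded down to scale 0.\<close>
      let ?\<phi> = "\<lambda>s. C * S / \<gamma> * s powr \<gamma>"
      have "norm (V h - V t) \<le> ?\<phi> h - ?\<phi> t"
      proof (rule differentiable_bound_general[OF t(2)])
        show "continuous_on {t..h} V"
          using t by (intro continuous_at_imp_continuous_on ballI DERIV_isCont[OF dV]) auto
        show "continuous_on {t..h} ?\<phi>" using t by (intro continuous_intros) auto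
        fix s assume s: "t < s" "s < h"
        then have s0: "0 < s" "s \<le> 1" using t h by auto
        show "(V has_vector_derivative V' s) (at s)"
          using dV[OF s0(1)] by (simp add: has_real_derivative_iff_has_vector_derivative)
        have "(?\<phi> has_real_derivative C * S / \<gamma> * (\<gamma> * s powr (\<gamma> - 1))) (at s)"
          by (intro DERIV_cmult has_real_derivative_powr s0(1))
        then show "(?\<phi> has_vector_derivative C * S * s powr (\<gamma> - 1)) (at s)"
          using \<gamma>0 by (simp add: has_real_derivative_iff_has_vector_derivative mult.assoc)
        show "norm (V' s) \<le> C * S * s powr (\<gamma> - 1)" using bV[OF s0] by simp
      qed
      also have "\<dots> \<le> ?\<phi> h" using C S0 \<gamma>0 by simp
      finally show ?thesis by (simp add: mult_ac)
    qed
    have "\<bar>u x - V h\<bar> \<le> C / \<gamma> * h powr \<gamma> * S"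
    \<comment> \<open>The limit t \<rightarrow> 0: the averages at scale t approach u x while the
      bound on V h - V t does not depend on t.\<close>
    proof (rule field_le_epsilon)
      fix e :: real assume "e > 0"
      from kern_average_tendsto[OF \<Omega> sub u this] obtain d where d: "d > 0"
        "\<And>h. 0 < h \<Longrightarrow> h < d \<Longrightarrow> h \<le> 1 \<Longrightarrow> \<bar>u x - V h\<bar> \<le> e"
        unfolding V_def by blast
      define t where "t = min (d / 2) (h / 2)"
      have t: "0 < t" "t < h" "t < d" "t \<le> 1" using d(1) h by (auto simp: t_def)
      show "\<bar>u x - V h\<bar> \<le> C / \<gamma> * h powr \<gamma> * S + e"
        using diff[OF t(1,2)] d(2)[OF t(1,3,4)] by linarith
    qed
    then show ?thesis by (simp add: V_def S_def)
  qed
  show ?thesis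
    unfolding \<gamma>_def[symmetric]
  proof (intro exI[of _ "C / \<gamma>"] conjI allI impI)
    show "C / \<gamma> > 0" using C \<gamma>0 by simp
  qed (rule main; simp)
qed

end

section \<open>Control of the supremum norm\<close>

lemma scaling_kernel_instance:
  fixes a b :: "real^'m"
  assumes "\<And>i. a $ i < b $ i"
  shows "\<exists>\<Phi> \<kappa>. scaling_kernel a b k \<Phi> \<kappa>"
proof -
  have "\<forall>i. \<exists>\<Phi> \<kappa>. smooth \<Phi> \<and> smooth \<kappa> \<and> (\<forall>t. t \<notin> {a $ i..b $ i} \<longrightarrow> \<Phi> t = 0) \<and> (\<forall>t. t \<notin> {a $ i..b $ i} \<longrightarrow> \<kappa> t = 0) \<and>
    (LBINT t. \<Phi> t) = 1 \<and> (\<forall>t. - (\<Phi> t + t * deriv \<Phi> t) = (deriv ^^ Suc k) \<kappa> t)"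
    using scaling_kernel_exists[OF assms] by blast
  then obtain \<Phi> where "\<forall>i. \<exists>\<kappa>. smooth (\<Phi> i) \<and> smooth \<kappa> \<and> (\<forall>t. t \<notin> {a $ i..b $ i} \<longrightarrow> \<Phi> i t = 0) \<and> (\<forall>t. t \<notin> {a $ i..b $ i} \<longrightarrow> \<kappa> t = 0) \<and>
    (LBINT t. \<Phi> i t) = 1 \<and> (\<forall>t. - (\<Phi> i t + t * deriv (\<Phi> i) t) = (deriv ^^ Suc k) \<kappa> t)"
    unfolding choice_iff by blast
  then obtain \<kappa> where "\<forall>i. smooth (\<Phi> i) \<and> smooth (\<kappa> i) \<and> (\<forall>t. t \<notin> {a $ i..b $ i} \<longrightarrow> \<Phi> i t = 0) \<and> (\<forall>t. t \<notin> {a $ i..b $ i} \<longrightarrow> \<kappa> i t = 0) \<and>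
    (LBINT t. \<Phi> i t) = 1 \<and> (\<forall>t. - (\<Phi> i t + t * deriv (\<Phi> i) t) = (deriv ^^ Suc k) (\<kappa> i) t)"
    unfolding choice_iff by blast
  then have "scaling_kernel a b k \<Phi> \<kappa>"
    unfolding scaling_kernel_def using assms by blast
  then show ?thesis by blast
qed

lemma finite_net:
  fixes S :: "'a::heine_borel set"
  assumes "bounded S" "e > 0"
  shows "\<exists>T. finite T \<and> T \<subseteq> closure S \<and> (\<forall>x\<in>S. \<exists>t\<in>T. dist x t < e)"
proof -
  have "compact (closure S)" using assms(1) by (simp add: compact_eq_bounded_closed bounded_closure)
  then obtain T where "T \<subseteq> closure S" "finite T" "closure S \<subseteq> (\<Union>t\<in>T. ball t e)"
    by (rule compactE_image[where f="\<lambda>t. ball t e" and C="closure S"]) (use assms(2) in auto)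
  then show ?thesis
    using closure_subset[of S] by (intro exI[of _ T]) (auto simp: dist_commute subset_iff)
qed

text \<open>The cone at x contains a ball around x + R \<xi> and its contractions towards x. The
  possible axes fill a compact sphere, so finitely many cubes suffice, one for each member of a net
  of directions.\<close>

lemma cone_property_boxes:
  fixes \<Omega> :: "(real^'m) set"
  assumes "cone_property \<Omega>"
  shows "\<exists>N. finite N \<and> (\<forall>(a, b)\<in>N. \<forall>i. a $ i < b $ i) \<and>
    (\<forall>x\<in>\<Omega>. \<exists>(a, b)\<in>N. \<forall>h. 0 < h \<longrightarrow> h \<le> 1 \<longrightarrow> cbox (x + h *\<^sub>R a) (x + h *\<^sub>R b) \<subseteq> \<Omega>)"
proof -
  obtain \<rho> \<theta> where \<rho>: "0 < \<rho>" and \<theta>: "0 < \<theta>" "\<theta> \<le> pi / 2"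
    and cone: "\<And>x. x \<in> \<Omega> \<Longrightarrow> \<exists>\<xi>. norm \<xi> = 1 \<and> finite_cone x \<xi> \<rho> \<theta> \<subseteq> \<Omega>"
    using assms unfolding cone_property_def by blast
  define c where "c = cos \<theta>"
  have c: "0 \<le> c" "c < 1"
    using \<theta> cos_ge_zero[of \<theta>] cos_monotone_0_pi[of 0 \<theta>] by (auto simp: c_def)
  define R where "R = \<rho> / 2"
  \<comment> \<open>The aperture gives c < 1, and 2 \<epsilon> = R (1 - c) yields c (R + \<epsilon>)
    \<le> R - \<epsilon>: all points z within \<epsilon> of R \<xi> satisfy the angle condition of
    the cone.\<close>
  define \<epsilon> where "\<epsilon> = R * (1 - c) / 2"
  have R: "R > 0" using \<rho> by (simp add: R_def)
  have \<epsilon>: "\<epsilon> > 0" using R c by (simp add: \<epsilon>_def)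
  have \<epsilon>R: "\<epsilon> \<le> R" using R c by (simp add: \<epsilon>_def field_simps)
  have \<epsilon>c: "c * (R + \<epsilon>) \<le> R - \<epsilon>"
  proof -
    have "R * (1 - c) = 2 * \<epsilon>" by (simp add: \<epsilon>_def)
    moreover have "c * \<epsilon> \<le> 1 * \<epsilon>" using c \<epsilon> by (intro mult_right_mono) auto
    ultimately show ?thesis by (simp add: algebra_simps)
  qed
  have in_cone: "x + h *\<^sub>R z \<in> finite_cone x \<xi> \<rho> \<theta>"
    if \<xi>: "norm \<xi> = 1" and z: "norm (z - R *\<^sub>R \<xi>) \<le> \<epsilon>" and h: "0 < h" "h \<le> 1" for x z \<xi> :: "real^'m" and h
  proof -
    have n: "norm z \<le> R + \<epsilon>"
      using norm_triangle_ineq[of "R *\<^sub>R \<xi>" "z - R *\<^sub>R \<xi>"] z \<xi> R by simp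
    have "(z - R *\<^sub>R \<xi>) \<bullet> \<xi> \<ge> - \<epsilon>"
      using Cauchy_Schwarz_ineq2[of "z - R *\<^sub>R \<xi>" \<xi>] z \<xi> by simp
    moreover have "\<xi> \<bullet> \<xi> = 1" using \<xi> by (simp add: dot_square_norm)
    ultimately have i: "z \<bullet> \<xi> \<ge> R - \<epsilon>" by (simp add: inner_diff_left)
    have "h * norm z \<le> 1 * norm z" using h by (intro mult_right_mono) auto
    then have 1: "h * norm z \<le> \<rho>" using n \<epsilon>R by (simp add: R_def)
    have "c * norm z \<le> c * (R + \<epsilon>)" using n c by (intro mult_left_mono) auto
    then have "c * norm z \<le> z \<bullet> \<xi>" using \<epsilon>c i by linarith
    then have "h * (c * norm z) \<le> h * (z \<bullet> \<xi>)" using h by (intro mult_left_mono) auto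
    then show ?thesis using 1 h by (simp add: finite_cone_def c_def mult.left_commute)
  qed
  obtain T :: "(real^'m) set" where T: "finite T" "\<And>x. norm x = R \<Longrightarrow> \<exists>t\<in>T. dist x t < \<epsilon> / 2"
    using finite_net[of "sphere (0::real^'m) R" "\<epsilon> / 2"] \<epsilon> by (auto simp: bounded_sphere)
  \<comment> \<open>Half of \<epsilon> is spent on the net of directions, half on the cube, whose
    points are within m \<delta> of the centre by the l1 bound.\<close>
  define \<delta> where "\<delta> = \<epsilon> / (2 * real CARD('m))"
  have \<delta>: "\<delta> > 0" using \<epsilon> by (simp add: \<delta>_def)
  define v where "v = (\<chi> i. \<delta> :: real^'m)"
  have "\<exists>(a, b)\<in>(\<lambda>t. (t - v, t + v)) ` T. \<forall>h. 0 < h \<longrightarrow> h \<le> 1 \<longrightarrow> cbox (x + h *\<^sub>R a) (x + h *\<^sub>R b) \<subseteq> \<Omega>"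
    if x: "x \<in> \<Omega>" for x
  proof -
    obtain \<xi> where \<xi>: "norm \<xi> = 1" "finite_cone x \<xi> \<rho> \<theta> \<subseteq> \<Omega>" using cone[OF x] by blast
    obtain t where t: "t \<in> T" "dist (R *\<^sub>R \<xi>) t < \<epsilon> / 2" using T(2)[of "R *\<^sub>R \<xi>"] \<xi> R by auto
    have "y \<in> \<Omega>" if y: "y \<in> cbox (x + h *\<^sub>R (t - v)) (x + h *\<^sub>R (t + v))" and h: "0 < h" "h \<le> 1" for y h
    proof -
      define z where "z = (1 / h) *\<^sub>R (y - x)"
      have yz: "y = x + h *\<^sub>R z" using h by (simp add: z_def)
      have "\<bar>(z - t) $ i\<bar> \<le> \<delta>" for i
      proof -
        have "h * (t $ i - \<delta>) \<le> h * z $ i" "h * z $ i \<le> h * (t $ i + \<delta>)"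
          using y unfolding yz mem_box_cart by (auto simp: v_def)
        then have "t $ i - \<delta> \<le> z $ i" "z $ i \<le> t $ i + \<delta>" using h by auto
        then show ?thesis by (simp add: abs_le_iff)
      qed
      then have "norm (z - t) \<le> real CARD('m) * \<delta>"
        using order_trans[OF norm_le_l1_cart sum_bounded_above[of UNIV "\<lambda>i. \<bar>(z - t) $ i\<bar>" \<delta>]] by simp
      also have "\<dots> = \<epsilon> / 2" by (simp add: \<delta>_def)
      finally have "norm (z - R *\<^sub>R \<xi>) \<le> \<epsilon>"
        using t(2) norm_triangle_ineq[of "z - t" "t - R *\<^sub>R \<xi>"] by (simp add: dist_norm norm_minus_commute)
      from in_cone[OF \<xi>(1) this h] show ?thesis using \<xi>(2) yz by blast
    qed
    then show ?thesis using t(1) by (intro bexI[of _ "(t - v, t + v)"]) auto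
  qed
  moreover have "\<forall>(a, b)\<in>(\<lambda>t. (t - v, t + v)) ` T. \<forall>i. a $ i < b $ i" using \<delta> by (auto simp: v_def)
  ultimately show ?thesis using T(1) by (intro exI[of _ "(\<lambda>t. (t - v, t + v)) ` T"]) blast
qed

context scaling_kernel
begin

text \<open>At fixed h the kernel depends on (y - x) / h only, which stays in a fixed ball; uniform
  continuity there turns a finite net of points x into a finite net of kernels.\<close>

lemma kern_net:
  assumes "h > 0" "bounded \<Omega>" "\<eta> > 0"
  shows "\<exists>T. finite T \<and> (\<forall>x\<in>\<Omega>. \<exists>t\<in>T. \<forall>y\<in>\<Omega>. \<bar>kern h x y - kern h t y\<bar> \<le> \<eta>)"
proof -
  obtain R where R: "\<And>x. x \<in> closure \<Omega> \<Longrightarrow> norm x \<le> R"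
    using bounded_closure[OF assms(2)] unfolding bounded_iff by blast
  let ?f = "\<lambda>w. tensor \<Phi> w / h ^ CARD('m)"
  have "uniformly_continuous_on (cball 0 (2 * R / h)) ?f"
    using assms(1) by (intro compact_uniformly_continuous continuous_intros tensor_continuous smooth_\<Phi>) auto
  then obtain d where d: "d > 0" "\<And>w w'. w \<in> cball 0 (2 * R / h) \<Longrightarrow> w' \<in> cball 0 (2 * R / h) \<Longrightarrow>
      dist w' w < d \<Longrightarrow> dist (?f w') (?f w) < \<eta>"
    using assms(3) unfolding uniformly_continuous_on_def by blast
  obtain T where T: "finite T" "T \<subseteq> closure \<Omega>" "\<And>x. x \<in> \<Omega> \<Longrightarrow> \<exists>t\<in>T. dist x t < d * h"
    using finite_net[OF assms(2), of "d * h"] d(1) assms(1) by auto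
  have "\<exists>t\<in>T. \<forall>y\<in>\<Omega>. \<bar>kern h x y - kern h t y\<bar> \<le> \<eta>" if x: "x \<in> \<Omega>" for x
  proof -
    obtain t where t: "t \<in> T" "dist x t < d * h" using T(3)[OF x] by blast
    have "\<bar>kern h x y - kern h t y\<bar> \<le> \<eta>" if y: "y \<in> \<Omega>" for y
    proof -
      have in_ball: "(1 / h) *\<^sub>R (y - z) \<in> cball 0 (2 * R / h)" if "z \<in> closure \<Omega>" for z
      proof -
        have "norm (y - z) \<le> 2 * R"
          using norm_triangle_ineq4[of y z] R[OF that] R[of y] y closure_subset[of \<Omega>] by auto
        then show ?thesis using assms(1) by (simp add: divide_right_mono)
      qed
      have "dist ((1 / h) *\<^sub>R (y - x)) ((1 / h) *\<^sub>R (y - t)) = dist x t / h"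
        using assms(1) by (simp add: dist_norm scaleR_diff_right[symmetric] norm_minus_commute)
      also have "\<dots> < d" using t(2) assms(1) by (simp add: pos_divide_less_eq)
      finally have "dist (?f ((1 / h) *\<^sub>R (y - x))) (?f ((1 / h) *\<^sub>R (y - t))) < \<eta>"
        using in_ball x t(1) T(2) closure_subset[of \<Omega>] by (intro d(2)) auto
      then show ?thesis by (simp add: kern_def tensor_dilate dist_real_def)
    qed
    then show ?thesis using t(1) by blast
  qed
  then show ?thesis using T(1) by blast
qed

end

definition top_deriv_family :: "nat \<Rightarrow> real \<Rightarrow> (real^'m) set \<Rightarrow> (real^'m \<Rightarrow> real) \<Rightarrow> ('m \<Rightarrow> real^'m \<Rightarrow> real) \<Rightarrow> bool" where
  "top_deriv_family k r \<Omega> u v \<longleftrightarrow> (\<forall>i. is_weak_deriv \<Omega> (pure_index k i) u (v i) \<and> square_integrable (lebesgue_on \<Omega>) (v i) \<and>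
      (r > 0 \<longrightarrow> integrable (lebesgue_on \<Omega> \<Otimes>\<^sub>M lebesgue_on \<Omega>) (gagliardo_kernel r (v i))))"

text \<open>At a small enough scale the averages are close to u x, with an error charged to the top
  seminorms. Replacing the kernel at x by one from a finite net costs an error charged to the L2
  norm, so finitely many integrals remain.\<close>

lemma (in scaling_kernel) box_sup_estimate:
  assumes r: "0 \<le> r" and \<gamma>: "real k + r > real CARD('m) / 2"
    and \<Omega>: "bounded \<Omega>" "\<Omega> \<in> lmeasurable" and e: "e > 0"
  shows "\<exists>G. finite G \<and> (\<forall>g\<in>G. continuous_on UNIV g) \<and> (\<forall>u v x. x \<in> \<Omega> \<longrightarrow>
    (\<forall>h. 0 < h \<longrightarrow> h \<le> 1 \<longrightarrow> sbox h x \<subseteq> \<Omega>) \<longrightarrow> continuous_on \<Omega> u \<longrightarrow> square_integrable (lebesgue_on \<Omega>) u \<longrightarrow>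
    top_deriv_family k r \<Omega> u v \<longrightarrow>
    \<bar>u x\<bar> \<le> (\<Sum>g\<in>G. \<bar>\<integral>y. u y * g y \<partial>lebesgue_on \<Omega>\<bar>) +
      e * ((\<Sum>i\<in>UNIV. seminorm_top r \<Omega> (v i)) + sqrt (\<integral>y. (u y)\<^sup>2 \<partial>lebesgue_on \<Omega>)))"
proof -
  let ?M = "lebesgue_on \<Omega>"
  interpret fM: finite_measure ?M by (rule finite_measure_lebesgue_on[OF \<Omega>(2)])
  define \<gamma>' where "\<gamma>' = real k + r - real CARD('m) / 2"
  have \<gamma>': "\<gamma>' > 0" using \<gamma> by (simp add: \<gamma>'_def)
  obtain C where C: "C > 0" and pe: "\<And>u v x h. x \<in> \<Omega> \<Longrightarrow> (\<forall>h. 0 < h \<longrightarrow> h \<le> 1 \<longrightarrow> sbox h x \<subseteq> \<Omega>) \<Longrightarrow>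
    continuous_on \<Omega> u \<Longrightarrow> integrable ?M u \<Longrightarrow> top_deriv_family k r \<Omega> u v \<Longrightarrow> 0 < h \<Longrightarrow> h \<le> 1 \<Longrightarrow>
    \<bar>u x - (\<integral>y. u y * kern h x y \<partial>?M)\<bar> \<le> C * h powr \<gamma>' * (\<Sum>i\<in>UNIV. seminorm_top r \<Omega> (v i))"
  proof -
    from pointwise_estimate[OF r \<gamma>] obtain C where C: "C > 0" and
      pe: "\<forall>\<Omega> u v x. \<Omega> \<in> lmeasurable \<longrightarrow> x \<in> \<Omega> \<longrightarrow> (\<forall>h. 0 < h \<longrightarrow> h \<le> 1 \<longrightarrow> sbox h x \<subseteq> \<Omega>) \<longrightarrow>
        continuous_on \<Omega> u \<longrightarrow> integrable (lebesgue_on \<Omega>) u \<longrightarrow> top_deriv_family k r \<Omega> u v \<longrightarrow>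
        (\<forall>h. 0 < h \<longrightarrow> h \<le> 1 \<longrightarrow> \<bar>u x - (\<integral>y. u y * kern h x y \<partial>lebesgue_on \<Omega>)\<bar> \<le>
          C * h powr \<gamma>' * (\<Sum>i\<in>UNIV. seminorm_top r \<Omega> (v i)))"
      unfolding \<gamma>'_def[symmetric] top_deriv_family_def by (elim exE conjE)
    show ?thesis by (rule that[OF C]) (rule pe[rule_format, OF \<Omega>(2)]; simp)
  qed
  \<comment> \<open>The scale at which C h powr \<gamma>' = e, capped at 1.\<close>
  define h where "h = min 1 ((e / C) powr (1 / \<gamma>'))"
  have h: "0 < h" "h \<le> 1" using e C by (auto simp: h_def)
  have "h powr \<gamma>' \<le> ((e / C) powr (1 / \<gamma>')) powr \<gamma>'"
    using h \<gamma>' by (intro powr_mono2) (auto simp: h_def)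
  also have "\<dots> = e / C" using e C \<gamma>' by (simp add: powr_powr)
  finally have hC: "C * h powr \<gamma>' \<le> e" using C by (simp add: field_simps)
  \<comment> \<open>Cauchy-Schwarz multiplies \<eta> by the root of the measure of \<Omega>; the
    summand 1 keeps the denominator positive.\<close>
  define \<eta> where "\<eta> = e / (1 + sqrt (measure ?M \<Omega>))"
  have \<eta>: "\<eta> > 0" using e by (auto simp: \<eta>_def intro!: divide_pos_pos add_pos_nonneg)
  have \<eta>e: "\<eta> * sqrt (measure ?M \<Omega>) \<le> e"
  proof -
    have "1 + sqrt (measure ?M \<Omega>) > 0" by (auto intro!: add_pos_nonneg)
    then have "\<eta> * (1 + sqrt (measure ?M \<Omega>)) = e" by (simp add: \<eta>_def)
    then show ?thesis using \<eta> by (simp add: distrib_left)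
  qed
  obtain T where T: "finite T" "\<And>x. x \<in> \<Omega> \<Longrightarrow> \<exists>t\<in>T. \<forall>y\<in>\<Omega>. \<bar>kern h x y - kern h t y\<bar> \<le> \<eta>"
    using kern_net[OF h(1) \<Omega>(1) \<eta>] by blast
  have "\<bar>u x\<bar> \<le> (\<Sum>g\<in>kern h ` T. \<bar>\<integral>y. u y * g y \<partial>?M\<bar>) +
      e * ((\<Sum>i\<in>UNIV. seminorm_top r \<Omega> (v i)) + sqrt (\<integral>y. (u y)\<^sup>2 \<partial>?M))"
    if x: "x \<in> \<Omega>" and sub: "\<forall>h. 0 < h \<longrightarrow> h \<le> 1 \<longrightarrow> sbox h x \<subseteq> \<Omega>"
      and u: "continuous_on \<Omega> u" "square_integrable ?M u" and v: "top_deriv_family k r \<Omega> u v" for u v x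
  proof -
    have iu: "integrable ?M u" by (rule square_integrable_integrable[OF fM.finite_measure_axioms u(2)])
    define S where "S = (\<Sum>i\<in>UNIV. seminorm_top r \<Omega> (v i))"
    have S: "S \<ge> 0" unfolding S_def by (intro sum_nonneg) (simp add: seminorm_top_nonneg)
    have "\<bar>u x - (\<integral>y. u y * kern h x y \<partial>?M)\<bar> \<le> C * h powr \<gamma>' * S"
      unfolding S_def by (rule pe[OF x sub u(1) iu v h])
    also have "\<dots> \<le> e * S" using hC S by (rule mult_right_mono)
    finally have 1: "\<bar>u x - (\<integral>y. u y * kern h x y \<partial>?M)\<bar> \<le> e * S" .
    obtain t where t: "t \<in> T" "\<And>y. y \<in> \<Omega> \<Longrightarrow> \<bar>kern h x y - kern h t y\<bar> \<le> \<eta>" using T(2)[OF x] by blast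
    obtain M where "\<forall>h>0. \<forall>x y. \<bar>kern h x y\<bar> \<le> M / h ^ CARD('m)" using kern_bounded by blast
    with h(1) have M: "\<bar>kern h x y\<bar> \<le> M / h ^ CARD('m)" for x y by blast
    have i: "integrable ?M (\<lambda>y. u y * kern h z y)" for z
      by (rule integrable_mult_bounded[OF iu kern_measurable[OF h(1)] M])
    have "(\<integral>y. u y * kern h x y \<partial>?M) - (\<integral>y. u y * kern h t y \<partial>?M) = (\<integral>y. u y * (kern h x y - kern h t y) \<partial>?M)"
      using i by (simp add: right_diff_distrib)
    also have "\<bar>\<dots>\<bar> \<le> sqrt (\<integral>y. (u y)\<^sup>2 \<partial>?M) * (\<bar>\<eta>\<bar> * sqrt (measure ?M \<Omega>))"
      by (rule integral_mult_square_bound[OF fM.finite_measure_axioms u(2)])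
        (use t(2) kern_measurable[OF h(1)] sets.top[of ?M] in auto)
    also have "\<dots> \<le> sqrt (\<integral>y. (u y)\<^sup>2 \<partial>?M) * e" using \<eta>e \<eta> by (intro mult_left_mono) auto
    finally have 2: "\<bar>(\<integral>y. u y * kern h x y \<partial>?M) - (\<integral>y. u y * kern h t y \<partial>?M)\<bar> \<le> sqrt (\<integral>y. (u y)\<^sup>2 \<partial>?M) * e" .
    have 3: "\<bar>\<integral>y. u y * kern h t y \<partial>?M\<bar> \<le> (\<Sum>g\<in>kern h ` T. \<bar>\<integral>y. u y * g y \<partial>?M\<bar>)"
      using t(1) T(1) by (intro member_le_sum[of "kern h t" "kern h ` T" "\<lambda>g. \<bar>\<integral>y. u y * g y \<partial>?M\<bar>"]) auto
    show ?thesis using 1 2 3 unfolding S_def[symmetric] by (simp add: distrib_left mult.commute)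
  qed
  moreover have "\<forall>g\<in>kern h ` T. continuous_on UNIV g" using kern_continuous[OF h(1)] by blast
  ultimately show ?thesis using T(1) by (intro exI[of _ "kern h ` T"]) blast
qed

text \<open>Each point uses one of finitely many boxes. The union of the families belonging to the
  boxes serves all points, as additional terms only increase the sum of absolute values.\<close>

lemma sup_estimate:
  fixes \<Omega> :: "(real^'m) set"
  assumes r: "0 \<le> r" and \<gamma>: "real k + r > real CARD('m) / 2"
    and \<Omega>: "bounded \<Omega>" "open \<Omega>" "cone_property \<Omega>" and e: "e > 0"
  shows "\<exists>G. finite G \<and> (\<forall>g\<in>G. continuous_on UNIV g) \<and> (\<forall>u v x. x \<in> \<Omega> \<longrightarrow>
    continuous_on \<Omega> u \<longrightarrow> square_integrable (lebesgue_on \<Omega>) u \<longrightarrow> top_deriv_family k r \<Omega> u v \<longrightarrow>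
    \<bar>u x\<bar> \<le> (\<Sum>g\<in>G. \<bar>\<integral>y. u y * g y \<partial>lebesgue_on \<Omega>\<bar>) +
      e * ((\<Sum>i\<in>UNIV. seminorm_top r \<Omega> (v i)) + sqrt (\<integral>y. (u y)\<^sup>2 \<partial>lebesgue_on \<Omega>)))"
proof -
  have lm: "\<Omega> \<in> lmeasurable" using \<Omega> by (simp add: lmeasurable_open)
  obtain N where N: "finite N" "\<forall>(a, b)\<in>N. \<forall>i. a $ i < b $ i"
    "\<forall>x\<in>\<Omega>. \<exists>(a, b)\<in>N. \<forall>h. 0 < h \<longrightarrow> h \<le> 1 \<longrightarrow> cbox (x + h *\<^sub>R a) (x + h *\<^sub>R b) \<subseteq> \<Omega>"
    using cone_property_boxes[OF \<Omega>(3)] by blast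
  define P where "P ab G \<longleftrightarrow> finite G \<and> (\<forall>g\<in>G. continuous_on UNIV g) \<and> (\<forall>u v x. x \<in> \<Omega> \<longrightarrow>
    (\<forall>h. 0 < h \<longrightarrow> h \<le> 1 \<longrightarrow> cbox (x + h *\<^sub>R fst ab) (x + h *\<^sub>R snd ab) \<subseteq> \<Omega>) \<longrightarrow> continuous_on \<Omega> u \<longrightarrow>
    square_integrable (lebesgue_on \<Omega>) u \<longrightarrow> top_deriv_family k r \<Omega> u v \<longrightarrow>
    \<bar>u x\<bar> \<le> (\<Sum>g\<in>G. \<bar>\<integral>y. u y * g y \<partial>lebesgue_on \<Omega>\<bar>) +
      e * ((\<Sum>i\<in>UNIV. seminorm_top r \<Omega> (v i)) + sqrt (\<integral>y. (u y)\<^sup>2 \<partial>lebesgue_on \<Omega>)))" for ab G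
  have "\<exists>G. P ab G" if ab: "ab \<in> N" for ab
  proof -
    have "fst ab $ i < snd ab $ i" for i using N(2) ab by (cases ab) auto
    from scaling_kernel_instance[OF this] obtain \<Phi> \<kappa> where "scaling_kernel (fst ab) (snd ab) k \<Phi> \<kappa>"
      by blast
    from scaling_kernel.box_sup_estimate[OF this r \<gamma> \<Omega>(1) lm e] show ?thesis
      unfolding P_def by blast
  qed
  then obtain G where G: "\<And>ab. ab \<in> N \<Longrightarrow> P ab (G ab)" by metis
  let ?G = "\<Union>ab\<in>N. G ab"
  have fin: "finite ?G" and cont: "\<forall>g\<in>?G. continuous_on UNIV g"
    using N(1) G unfolding P_def by blast+
  have "\<bar>u x\<bar> \<le> (\<Sum>g\<in>?G. \<bar>\<integral>y. u y * g y \<partial>lebesgue_on \<Omega>\<bar>) +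
      e * ((\<Sum>i\<in>UNIV. seminorm_top r \<Omega> (v i)) + sqrt (\<integral>y. (u y)\<^sup>2 \<partial>lebesgue_on \<Omega>))"
    if x: "x \<in> \<Omega>" and u: "continuous_on \<Omega> u" "square_integrable (lebesgue_on \<Omega>) u" "top_deriv_family k r \<Omega> u v" for u v x
  proof -
    obtain ab where ab: "ab \<in> N" "\<forall>h. 0 < h \<longrightarrow> h \<le> 1 \<longrightarrow> cbox (x + h *\<^sub>R fst ab) (x + h *\<^sub>R snd ab) \<subseteq> \<Omega>"
      using N(3) x by fastforce
    have "\<bar>u x\<bar> \<le> (\<Sum>g\<in>G ab. \<bar>\<integral>y. u y * g y \<partial>lebesgue_on \<Omega>\<bar>) +
      e * ((\<Sum>i\<in>UNIV. seminorm_top r \<Omega> (v i)) + sqrt (\<integral>y. (u y)\<^sup>2 \<partial>lebesgue_on \<Omega>))"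
      using G[OF ab(1)] x ab(2) u unfolding P_def by blast
    also have "(\<Sum>g\<in>G ab. \<bar>\<integral>y. u y * g y \<partial>lebesgue_on \<Omega>\<bar>) \<le> (\<Sum>g\<in>?G. \<bar>\<integral>y. u y * g y \<partial>lebesgue_on \<Omega>\<bar>)"
      using fin ab(1) by (intro sum_mono2) auto
    finally show ?thesis by simp
  qed
  with fin cont show ?thesis by (intro exI[of _ ?G]) blast
qed

section \<open>Uniqueness of weak derivatives\<close>

text \<open>Completeness of Lebesgue measure. It carries measurability over from one weak derivative
  to the one selected by \<open>weak_deriv\<close>.\<close>

lemma borel_measurable_lebesgue_on_AE_cong:
  fixes f g :: "'a::euclidean_space \<Rightarrow> real"
  assumes f: "f \<in> borel_measurable (lebesgue_on \<Omega>)" and \<Omega>: "\<Omega> \<in> sets lebesgue"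
    and eq: "AE y in lebesgue_on \<Omega>. f y = g y"
  shows "g \<in> borel_measurable (lebesgue_on \<Omega>)"
proof -
  have ae: "AE y in lebesgue. indicator \<Omega> y *\<^sub>R f y = indicator \<Omega> y *\<^sub>R g y"
    using eq \<Omega> by (subst (asm) AE_restrict_space_iff) (auto elim!: eventually_mono)
  have "(\<lambda>y. indicator \<Omega> y *\<^sub>R g y) \<in> borel_measurable lebesgue"
  proof (rule measurableI)
    fix A :: "real set" assume A: "A \<in> sets borel"
    have 1: "(\<lambda>y. indicator \<Omega> y *\<^sub>R f y) -` A \<inter> space lebesgue \<in> sets lebesgue"
      using f \<Omega> A by (intro measurable_sets[OF _ A]) (simp add: borel_measurable_restrict_space_iff)
    show "(\<lambda>y. indicator \<Omega> y *\<^sub>R g y) -` A \<inter> space lebesgue \<in> sets lebesgue"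
      by (rule completion.in_sets_AE[OF _ 1]) (use ae in \<open>auto elim!: eventually_mono\<close>)
  qed simp
  then show ?thesis using \<Omega> by (simp add: borel_measurable_restrict_space_iff)
qed

text \<open>Boxes form an intersection-stable generator of the Borel sets, so the integrals over all
  Borel sets vanish. The support condition makes the total integral one over a box, as complements
  require.\<close>

lemma AE_eq_0_if_box_integrals_0:
  fixes g :: "'a::euclidean_space \<Rightarrow> real"
  assumes g: "integrable lebesgue g" and 0: "\<And>c d. (\<integral>y. indicator (box c d) y * g y \<partial>lebesgue) = 0"
    and supp: "\<And>y. y \<notin> box p q \<Longrightarrow> g y = 0"
  shows "AE y in lebesgue. g y = 0"
proof -
  have i: "integrable lebesgue (\<lambda>y. indicator A y * g y)" if "A \<in> sets lebesgue" for A
    using integrable_mult_indicator[OF that g] by simp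
  have tot: "(\<integral>y. g y \<partial>lebesgue) = 0"
  proof -
    have "(\<lambda>y. indicator (box p q) y * g y) = g" using supp by (auto simp: indicator_def fun_eq_iff)
    then show ?thesis using 0[of p q] by simp
  qed
  have bor: "(\<integral>y. indicator A y * g y \<partial>lebesgue) = 0" if A: "A \<in> sets borel" for A :: "'a set"
  proof -
    have sb: "sigma_sets UNIV (range (\<lambda>(a, b). box a b :: 'a set)) = sets borel"
      by (simp add: borel_eq_box)
    have "Int_stable (range (\<lambda>(a, b). box a b :: 'a set))"
      by (auto simp: Int_stable_def box_Int_box)
    moreover have "range (\<lambda>(a, b). box a b :: 'a set) \<subseteq> Pow UNIV" by simp
    moreover have "A \<in> sigma_sets UNIV (range (\<lambda>(a, b). box a b))" using A unfolding sb .
    ultimately show ?thesis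
    proof (induction rule: sigma_sets_induct_disjoint)
      case (compl A)
      have A: "A \<in> sets lebesgue" using compl(1) unfolding sb by (simp add: sets_completionI_sets)
      have "(\<integral>y. indicator (UNIV - A) y * g y \<partial>lebesgue) = (\<integral>y. g y - indicator A y * g y \<partial>lebesgue)"
        by (intro Bochner_Integration.integral_cong) (auto simp: indicator_def)
      also have "\<dots> = 0" using g i[OF A] compl(2) tot by simp
      finally show ?case .
    next
      case (union A)
      have A: "A i \<in> sets lebesgue" for i using union(2) unfolding sb by (auto simp: sets_completionI_sets)
      have "(LINT y:(\<Union>i. A i)|lebesgue. g y) = (\<Sum>i. (LINT y:(A i)|lebesgue. g y))"
        using A union(1) i[of "\<Union>i. A i"]
        by (intro lebesgue_integral_countable_add) (auto simp: disjoint_family_on_def set_integrable_def)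
      then show ?case using union(3) by (simp add: set_lebesgue_integral_def)
    qed (auto simp: 0)
  qed
  \<comment> \<open>A Borel representative is taken so that the sets where it is positive or
    negative are Borel.\<close>
  obtain g' where g'm [measurable]: "g' \<in> borel_measurable borel" and eq': "AE y in lborel. g y = g' y"
    using completion_ex_borel_measurable_real[OF borel_measurable_integrable[OF g]] by auto
  have eq: "AE y in lebesgue. g y = g' y" using eq' by (rule AE_completion)
  have g'L: "g' \<in> borel_measurable lebesgue" by (rule measurable_completion) simp
  have ig': "integrable lebesgue g'" using g eq g'L by (subst integrable_cong_AE[of _ _ g]) auto
  have *: "AE y in lebesgue. c * g' y \<le> 0" for c :: real
  proof -
    let ?A = "{y. c * g' y > 0}"
    have A: "?A \<in> sets borel" by measurable
    have AL: "?A \<in> sets lebesgue" using A by (simp add: sets_completionI_sets)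
    have "integrable lebesgue (\<lambda>y. c * (indicator ?A y * g' y))"
      using integrable_mult_indicator[OF AL ig'] by (simp del: indicator_simps)
    then have 1: "integrable lebesgue (\<lambda>y. indicator ?A y * (c * g' y))"
      by (simp add: mult.left_commute)
    have "(\<integral>y. indicator ?A y * g y \<partial>lebesgue) = (\<integral>y. indicator ?A y * g' y \<partial>lebesgue)"
      using i[OF AL] integrable_mult_indicator[OF AL ig'] eq
      by (intro integral_cong_AE) (auto elim!: eventually_mono intro: borel_measurable_integrable)
    then have "(\<integral>y. c * (indicator ?A y * g' y) \<partial>lebesgue) = 0"
      using bor[OF A] by simp
    then have "(\<integral>y. indicator ?A y * (c * g' y) \<partial>lebesgue) = 0"
      by (simp add: mult.left_commute)
    then have "AE y in lebesgue. indicator ?A y * (c * g' y) = 0"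
      using integral_nonneg_eq_0_iff_AE[OF 1] by (auto simp: indicator_def)
    then show ?thesis by (rule eventually_mono) (auto simp: indicator_def split: if_splits)
  qed
  from eq *[of 1] *[of "-1"] show ?thesis by eventually_elim simp
qed

section \<open>Stability of test functions and integrability of products\<close>

lemma locally_integrable_lincomb:
  "locally_integrable \<Omega> u \<Longrightarrow> locally_integrable \<Omega> v \<Longrightarrow> locally_integrable \<Omega> (\<lambda>y. a * u y + b * v y)"
  unfolding locally_integrable_def by (auto intro!: set_integral_add set_integrable_mult_right)

text \<open>A function vanishing on the open complement of the support has vanishing derivatives
  there, so differentiation does not enlarge supports.\<close>

lemma foldr_partial_test_function:
  assumes "\<phi> \<in> test_functions \<Omega>"
  shows "foldr partial is \<phi> \<in> test_functions \<Omega>"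
proof -
  have "{x. foldr partial is \<phi> x \<noteq> 0} \<subseteq> closure {x. \<phi> x \<noteq> 0}"
  proof (induction "is")
    case (Cons i "is")
    have "partial i (foldr partial is \<phi>) x = 0" if x: "x \<notin> closure {x. \<phi> x \<noteq> 0}" for x
    proof -
      have "(foldr partial is \<phi> has_derivative (\<lambda>h. 0)) (at x)"
        by (rule has_derivative_transform_within_open[of "\<lambda>_. 0" _ _ UNIV "- closure {x. \<phi> x \<noteq> 0}"])
          (use x Cons in auto)
      from frechet_derivative_at[OF this, symmetric] show ?thesis by (simp add: partial_def)
    qed
    then show ?case by auto
  qed (simp add: closure_subset)
  then have sub: "closure {x. foldr partial is \<phi> x \<noteq> 0} \<subseteq> closure {x. \<phi> x \<noteq> 0}"
    by (simp add: closure_minimal)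
  have "foldr partial js (foldr partial is \<phi>) differentiable at x" for js x
    using assms unfolding test_functions_def by (simp only: foldr_append[symmetric] mem_Collect_eq)
  moreover have "compact (closure {x. foldr partial is \<phi> x \<noteq> 0})"
    using sub assms by (auto simp: test_functions_def compact_eq_bounded_closed intro: bounded_subset)
  ultimately show ?thesis
    using sub assms by (auto simp: test_functions_def)
qed

lemma multi_partial_test_function:
  assumes "\<phi> \<in> test_functions \<Omega>"
  shows "multi_partial \<alpha> \<phi> \<in> test_functions \<Omega>"
proof -
  have "foldr (\<lambda>i. partial i ^^ \<alpha> i) is \<phi> = foldr partial (concat (map (\<lambda>i. replicate (\<alpha> i) i) is)) \<phi>" for "is"
  proof (induction "is")
    case (Cons i "is")
    have "foldr partial (replicate n i) f = (partial i ^^ n) f" for n f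
      by (induction n) auto
    with Cons show ?case by simp
  qed simp
  then show ?thesis
    unfolding multi_partial_def using foldr_partial_test_function[OF assms] by simp
qed

lemma multi_partial_0: "multi_partial (\<lambda>_. 0) \<phi> = \<phi>"
proof -
  have "foldr (\<lambda>i. partial i ^^ 0) is \<phi> = \<phi>" for "is" by (induction "is") auto
  then show ?thesis by (simp add: multi_partial_def)
qed

lemma test_function_continuous: "\<phi> \<in> test_functions \<Omega> \<Longrightarrow> continuous_on A \<phi>"
proof -
  assume "\<phi> \<in> test_functions \<Omega>"
  then have "foldr partial [] \<phi> differentiable at x" for x unfolding test_functions_def by blast
  then show "continuous_on A \<phi>"
    by (intro continuous_at_imp_continuous_on) (auto intro: differentiable_imp_continuous_within)
qed

lemma test_function_bounded:
  assumes "\<phi> \<in> test_functions \<Omega>"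
  shows "\<exists>B>0. \<forall>x. \<bar>\<phi> x\<bar> \<le> B"
proof -
  let ?K = "closure {x. \<phi> x \<noteq> 0}"
  have "compact ?K" using assms by (simp add: test_functions_def)
  then have "bounded (\<phi> ` ?K)"
    by (intro compact_imp_bounded compact_continuous_image test_function_continuous[OF assms])
  then obtain B where B: "B > 0" "\<And>x. x \<in> ?K \<Longrightarrow> \<bar>\<phi> x\<bar> \<le> B" unfolding bounded_pos by auto
  have "\<bar>\<phi> x\<bar> \<le> B" for x
    using B closure_subset[of "{x. \<phi> x \<noteq> 0}"] by (cases "\<phi> x = 0") auto
  then show ?thesis using B(1) by blast
qed

lemma integrable_test_function_mult:
  assumes v: "locally_integrable \<Omega> v" and \<phi>: "\<phi> \<in> test_functions \<Omega>" and \<Omega>: "\<Omega> \<in> sets lebesgue"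
  shows "integrable (lebesgue_on \<Omega>) (\<lambda>y. v y * \<phi> y)"
proof -
  let ?K = "closure {x. \<phi> x \<noteq> 0}"
  have K: "compact ?K" "?K \<subseteq> \<Omega>" using \<phi> by (auto simp: test_functions_def)
  obtain B where B: "\<And>x. \<bar>\<phi> x\<bar> \<le> B" using test_function_bounded[OF \<phi>] by blast
  have \<phi>m: "\<phi> \<in> borel_measurable lebesgue"
    using borel_measurable_continuous_onI[OF test_function_continuous[OF \<phi>]] by (intro measurable_completion) simp
  have "integrable lebesgue (\<lambda>y. indicator ?K y * v y)"
    using v K unfolding locally_integrable_def set_integrable_def by simp
  from integrable_mult_bounded[OF this \<phi>m B]
  have 1: "integrable lebesgue (\<lambda>y. indicator ?K y * v y * \<phi> y)" by blast
  moreover have "(\<lambda>y. indicator ?K y * v y * \<phi> y) = (\<lambda>y. indicator \<Omega> y *\<^sub>R (v y * \<phi> y))"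
    using K closure_subset[of "{x. \<phi> x \<noteq> 0}"] by (auto simp: indicator_def fun_eq_iff)
  ultimately show ?thesis using \<Omega> by (subst integrable_restrict_space) auto
qed

text \<open>Products of one-dimensional bumps converge to indicators of boxes, so that \<open>f\<close> integrates to
  zero over every box in \<open>\<Omega>\<close>.\<close>

lemma du_Bois_Reymond:
  fixes \<Omega> :: "(real^'m) set"
  assumes \<Omega>: "open \<Omega>" and f: "locally_integrable \<Omega> f"
    and 0: "\<And>\<phi>. \<phi> \<in> test_functions \<Omega> \<Longrightarrow> (\<integral>y. f y * \<phi> y \<partial>lebesgue_on \<Omega>) = 0"
  shows "AE y in lebesgue_on \<Omega>. f y = 0"
proof -
  have \<Omega>L: "\<Omega> \<in> sets lebesgue" using \<Omega> by simp
  have box0: "(\<integral>y. indicator (box c d) y * f y \<partial>lebesgue) = 0"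
    if sub: "cbox c d \<subseteq> \<Omega>" for c d
  proof -
    define \<phi> where "\<phi> n = tensor (\<lambda>i. box_bump (real (Suc n)) (c $ i) (d $ i))" for n
    have \<phi>: "\<phi> n \<in> test_functions \<Omega>" for n
      unfolding \<phi>_def
      by (rule tensor_test_function[OF smooth_box_bump _ sub]) (auto intro: box_bump_eq_0)
    have \<phi>0: "\<phi> n y = 0" if "y \<notin> box c d" for n y
      using that unfolding \<phi>_def tensor_def
      by (auto simp: mem_box_cart intro!: box_bump_eq_0 bexI)
    have \<phi>1: "0 \<le> \<phi> n y" "\<phi> n y \<le> 1" for n y
      unfolding \<phi>_def tensor_def by (auto intro!: prod_nonneg prod_le_1 box_bump_nonneg box_bump_le_1)
    have \<phi>lim: "(\<lambda>n. \<phi> n y) \<longlonglongrightarrow> indicator (box c d) y" for y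
    proof (cases "y \<in> box c d")
      case True
      have "(\<lambda>n. \<phi> n y) \<longlonglongrightarrow> (\<Prod>i\<in>(UNIV::'m set). 1)"
        unfolding \<phi>_def tensor_def
        by (intro tendsto_prod box_bump_tendsto) (use True in \<open>auto simp: mem_box_cart\<close>)
      then show ?thesis using True by simp
    qed (simp add: \<phi>0)
    have int: "integrable lebesgue (\<lambda>y. indicator (cbox c d) y * f y)"
      using f sub unfolding locally_integrable_def set_integrable_def by simp
    have z: "(\<integral>y. indicator (cbox c d) y * f y * \<phi> n y \<partial>lebesgue) = 0" for n
    proof -
      have "(\<lambda>y. indicator (cbox c d) y * f y * \<phi> n y) = (\<lambda>y. indicator \<Omega> y *\<^sub>R (f y * \<phi> n y))"
        using sub \<phi>0 box_subset_cbox[of c d] by (auto simp: indicator_def fun_eq_iff subset_iff)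
      then show ?thesis using 0[OF \<phi>, of n] \<Omega>L by (subst (asm) integral_restrict_space) auto
    qed
    have "(\<lambda>n. \<integral>y. indicator (cbox c d) y * f y * \<phi> n y \<partial>lebesgue) \<longlonglongrightarrow>
        (\<integral>y. indicator (cbox c d) y * f y * indicator (box c d) y \<partial>lebesgue)"
    proof (rule integral_dominated_convergence[where w="\<lambda>y. \<bar>indicator (cbox c d) y * f y\<bar>"])
      show "integrable lebesgue (\<lambda>y. \<bar>indicator (cbox c d) y * f y\<bar>)" using int by (rule integrable_abs)
      have m: "(\<lambda>y. indicator (cbox c d) y * f y) \<in> borel_measurable lebesgue" using int by simp
      show "(\<lambda>y. indicator (cbox c d) y * f y * indicator (box c d) y) \<in> borel_measurable lebesgue"
        by (intro borel_measurable_times m borel_measurable_indicator) simp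
      show "(\<lambda>y. indicator (cbox c d) y * f y * \<phi> n y) \<in> borel_measurable lebesgue" for n
        using borel_measurable_continuous_onI[OF test_function_continuous[OF \<phi>[of n]]]
        by (intro borel_measurable_times m measurable_completion) simp
      show "AE y in lebesgue. (\<lambda>n. indicator (cbox c d) y * f y * \<phi> n y) \<longlonglongrightarrow> indicator (cbox c d) y * f y * indicator (box c d) y"
        by (intro AE_I2 tendsto_mult_left \<phi>lim)
      show "AE y in lebesgue. norm (indicator (cbox c d) y * f y * \<phi> n y) \<le> \<bar>indicator (cbox c d) y * f y\<bar>" for n
        by (intro AE_I2) (use \<phi>1[of n] in \<open>simp add: abs_mult mult_left_le\<close>)
    qed
    then have "(\<integral>y. indicator (cbox c d) y * f y * indicator (box c d) y \<partial>lebesgue) = 0"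
      by (simp add: z LIMSEQ_const_iff)
    moreover have "(\<lambda>y. indicator (cbox c d) y * f y * indicator (box c d) y) = (\<lambda>y. indicator (box c d) y * f y)"
      using box_subset_cbox[of c d] by (auto simp: indicator_def fun_eq_iff)
    ultimately show ?thesis by simp
  qed
  \<comment> \<open>Cut off to an open cell, f has integral zero over every box of the whole space,
    since the intersection of two boxes is a box.\<close>
  have local: "AE y in lebesgue. y \<in> cbox p q \<longrightarrow> f y = 0" if sub: "cbox p q \<subseteq> \<Omega>" for p q
  proof -
    have int: "integrable lebesgue (\<lambda>y. indicator (cbox p q) y *\<^sub>R f y)"
      using f sub unfolding locally_integrable_def set_integrable_def by simp
    have "AE y in lebesgue. indicator (box p q) y * f y = 0"
    proof (rule AE_eq_0_if_box_integrals_0[of _ p q])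
      have "integrable lebesgue (\<lambda>y. indicator (box p q) y *\<^sub>R (indicator (cbox p q) y *\<^sub>R f y))"
        by (rule integrable_mult_indicator[OF _ int]) simp
      moreover have "(\<lambda>y. indicator (box p q) y *\<^sub>R (indicator (cbox p q) y *\<^sub>R f y)) = (\<lambda>y. indicator (box p q) y * f y)"
        using box_subset_cbox[of p q] by (auto simp: indicator_def fun_eq_iff)
      ultimately show "integrable lebesgue (\<lambda>y. indicator (box p q) y * f y)" by simp
      fix c d :: "real^'m"
      obtain c' d' where cd: "box c d \<inter> box p q = box c' d'" using box_Int_box by blast
      have eq: "(\<lambda>y. indicator (box c d) y * (indicator (box p q) y * f y)) = (\<lambda>y. indicator (box c' d') y * f y)"
        unfolding cd[symmetric] by (auto simp: indicator_def fun_eq_iff)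
      show "(\<integral>y. indicator (box c d) y * (indicator (box p q) y * f y) \<partial>lebesgue) = 0"
      proof (cases "box c' d' = {}")
        case False
        have "box c' d' \<subseteq> cbox p q" using cd box_subset_cbox[of p q] by blast
        then have "cbox c' d' \<subseteq> cbox p q"
          using closure_box[OF False] closure_minimal[OF _ closed_cbox] by metis
        then show ?thesis using box0[of c' d'] sub by (simp add: eq)
      qed (simp add: eq)
    qed simp
    \<comment> \<open>The closed cells that cover \<Omega> differ from the open ones by null
      sets.\<close>
    moreover have "AE y in lebesgue. y \<notin> cbox p q - box p q"
      using negligible_frontier_interval[of p q]
      by (intro AE_not_in) (simp add: negligible_iff_null_sets)
    ultimately show ?thesis by eventually_elim (auto simp: indicator_def split: if_splits)
  qed
  obtain \<D> where \<D>: "countable \<D>" "\<D> \<subseteq> Pow \<Omega>" "\<And>X. X \<in> \<D> \<Longrightarrow> \<exists>a b. X = cbox a b" "\<Union>\<D> = \<Omega>"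
    using open_countable_Union_open_cbox[OF \<Omega>] by metis
  \<comment> \<open>Countability of the cover allows the exceptional null sets to be united.\<close>
  have "AE y in lebesgue. \<forall>X\<in>\<D>. y \<in> X \<longrightarrow> f y = 0"
    unfolding AE_ball_countable[OF \<D>(1)] using \<D>(2,3) local by blast
  then have "AE y in lebesgue. y \<in> \<Omega> \<longrightarrow> f y = 0"
    by (rule eventually_mono) (use \<D>(4) in blast)
  then show ?thesis using \<Omega>L by (simp add: AE_restrict_space_iff)
qed

lemma weak_deriv_AE_unique:
  assumes \<Omega>: "open \<Omega>" and v: "is_weak_deriv \<Omega> \<alpha> u v" and w: "is_weak_deriv \<Omega> \<alpha> u w"
  shows "AE y in lebesgue_on \<Omega>. v y = w y"
proof -
  have li: "locally_integrable \<Omega> v" "locally_integrable \<Omega> w" using v w by (auto simp: is_weak_deriv_def)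
  have \<Omega>L: "\<Omega> \<in> sets lebesgue" using \<Omega> by simp
  have "AE y in lebesgue_on \<Omega>. 1 * v y + (- 1) * w y = 0"
  proof (rule du_Bois_Reymond[OF \<Omega> locally_integrable_lincomb[OF li]])
    fix \<phi> assume \<phi>: "\<phi> \<in> test_functions \<Omega>"
    have "(-1) ^ multi_order \<alpha> * (\<integral>y. v y * \<phi> y \<partial>lebesgue_on \<Omega>) = (-1) ^ multi_order \<alpha> * (\<integral>y. w y * \<phi> y \<partial>lebesgue_on \<Omega>)"
      using v[unfolded is_weak_deriv_def, THEN conjunct2, THEN conjunct2, THEN bspec, OF \<phi>]
        w[unfolded is_weak_deriv_def, THEN conjunct2, THEN conjunct2, THEN bspec, OF \<phi>] by (rule trans[OF sym])
    then have "(\<integral>y. v y * \<phi> y \<partial>lebesgue_on \<Omega>) = (\<integral>y. w y * \<phi> y \<partial>lebesgue_on \<Omega>)" by simp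
    moreover have "(\<integral>y. (1 * v y + (- 1) * w y) * \<phi> y \<partial>lebesgue_on \<Omega>) =
        (\<integral>y. v y * \<phi> y \<partial>lebesgue_on \<Omega>) - (\<integral>y. w y * \<phi> y \<partial>lebesgue_on \<Omega>)"
      using integrable_test_function_mult[OF li(1) \<phi> \<Omega>L] integrable_test_function_mult[OF li(2) \<phi> \<Omega>L]
      by (simp add: left_diff_distrib)
    ultimately show "(\<integral>y. (1 * v y + (- 1) * w y) * \<phi> y \<partial>lebesgue_on \<Omega>) = 0" by simp
  qed
  then show ?thesis by (rule eventually_mono) simp
qed

section \<open>The Sobolev norm as a Hilbert seminorm\<close>

text \<open>A root of the Gagliardo kernel that is linear in v: it turns the Gagliardo seminorm into
  an L2 norm on the product space, which comes from a bilinear form.\<close>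

definition difference_quotient :: "real \<Rightarrow> (real^'m \<Rightarrow> real) \<Rightarrow> (real^'m) \<times> (real^'m) \<Rightarrow> real" where
  "difference_quotient r v = (\<lambda>(y, z). (v y - v z) / norm (y - z) powr (real CARD('m) / 2 + r))"

lemma gagliardo_kernel_square: "gagliardo_kernel r v = (\<lambda>p. (difference_quotient r v p)\<^sup>2)"
  by (auto simp: fun_eq_iff difference_quotient_def gagliardo_kernel_eq)

lemma difference_quotient_measurable [measurable]:
  assumes [measurable]: "v \<in> borel_measurable (lebesgue_on \<Omega>)"
  shows "difference_quotient r v \<in> borel_measurable (lebesgue_on \<Omega> \<Otimes>\<^sub>M lebesgue_on \<Omega>)"
  unfolding difference_quotient_def by measurable

lemma difference_quotient_lincomb:
  "difference_quotient r (\<lambda>y. a * v y + b * w y) p = a * difference_quotient r v p + b * difference_quotient r w p"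
  by (cases p) (simp add: difference_quotient_def add_divide_distrib[symmetric] algebra_simps)

lemma AE_pair_both:
  assumes M: "sigma_finite_measure M" and P: "AE x in M. P x"
  shows "AE p in M \<Otimes>\<^sub>M M. P (fst p) \<and> P (snd p)"
proof -
  interpret sigma_finite_measure M by fact
  interpret pair_sigma_finite M M ..
  from P obtain N where N: "{x\<in>space M. \<not> P x} \<subseteq> N" "N \<in> null_sets M"
    by (auto simp: eventually_ae_filter)
  then have [measurable]: "N \<in> sets M" by auto
  have ae: "AE x in M. x \<notin> N" using N(2) by (rule AE_not_in)
  have "AE p in M \<Otimes>\<^sub>M M. fst p \<notin> N \<and> snd p \<notin> N"
  proof (rule AE_pair_measure)
    show "{p \<in> space (M \<Otimes>\<^sub>M M). fst p \<notin> N \<and> snd p \<notin> N} \<in> sets (M \<Otimes>\<^sub>M M)" by measurable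
    show "AE x in M. AE y in M. fst (x, y) \<notin> N \<and> snd (x, y) \<notin> N"
      using ae by eventually_elim (use ae in simp)
  qed
  with AE_space show ?thesis
    by eventually_elim (use N(1) in \<open>auto simp: space_pair_measure\<close>)
qed

lemma difference_quotient_AE_cong:
  fixes \<Omega> :: "(real^'m) set"
  assumes "\<Omega> \<in> lmeasurable"
    and "AE y in lebesgue_on \<Omega>. v y = w y"
  shows "AE p in lebesgue_on \<Omega> \<Otimes>\<^sub>M lebesgue_on \<Omega>. difference_quotient r v p = difference_quotient r w p"
proof -
  interpret finite_measure "lebesgue_on \<Omega>" using assms(1) by (rule finite_measure_lebesgue_on)
  show ?thesis
    using AE_pair_both[OF sigma_finite_measure_axioms assms(2)]
    by eventually_elim (auto simp: difference_quotient_def split: prod.split)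
qed

lemma square_integrable_AE_cong:
  assumes "square_integrable M f" "g \<in> borel_measurable M" "AE x in M. f x = g x"
  shows "square_integrable M g" "(\<integral>x. (g x)\<^sup>2 \<partial>M) = (\<integral>x. (f x)\<^sup>2 \<partial>M)"
proof -
  have m: "(\<lambda>x. (f x)\<^sup>2) \<in> borel_measurable M" "(\<lambda>x. (g x)\<^sup>2) \<in> borel_measurable M"
    using assms(2) square_integrableD(1)[OF assms(1)] by auto
  have ae: "AE x in M. (f x)\<^sup>2 = (g x)\<^sup>2" using assms(3) by eventually_elim simp
  show "square_integrable M g"
    using integrable_cong_AE[OF m ae] assms by (simp add: square_integrable_def)
  show "(\<integral>x. (g x)\<^sup>2 \<partial>M) = (\<integral>x. (f x)\<^sup>2 \<partial>M)"
    using integral_cong_AE[OF m ae] by simp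
qed

lemma finite_multi_indices: "finite {\<alpha> :: 'm::finite \<Rightarrow> nat. multi_order \<alpha> \<le> k}"
proof (rule finite_subset)
  show "{\<alpha> :: 'm \<Rightarrow> nat. multi_order \<alpha> \<le> k} \<subseteq> PiE UNIV (\<lambda>_. {..k})"
  proof
    fix \<alpha> :: "'m \<Rightarrow> nat" assume "\<alpha> \<in> {\<alpha>. multi_order \<alpha> \<le> k}"
    then have "\<alpha> i \<le> k" for i
      using member_le_sum[of i UNIV \<alpha>] by (simp add: multi_order_def)
    then show "\<alpha> \<in> PiE UNIV (\<lambda>_. {..k})" by auto
  qed
qed (auto intro: finite_PiE)

text \<open>Membership in the Sobolev space witnessed by any family v of weak derivatives. Families
  can be combined linearly, whereas the choice made by \<open>weak_deriv\<close> commutes with sums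
  only almost everywhere.\<close>

definition sobolev_data :: "real \<Rightarrow> (real^'m) set \<Rightarrow> (real^'m \<Rightarrow> real) \<Rightarrow> (('m \<Rightarrow> nat) \<Rightarrow> real^'m \<Rightarrow> real) \<Rightarrow> bool" where
  "sobolev_data s \<Omega> u v \<longleftrightarrow>
     (\<forall>\<alpha>. multi_order \<alpha> \<le> nat \<lfloor>s\<rfloor> \<longrightarrow> is_weak_deriv \<Omega> \<alpha> u (v \<alpha>) \<and> square_integrable (lebesgue_on \<Omega>) (v \<alpha>)) \<and>
     (0 < frac s \<longrightarrow> (\<forall>\<alpha>. multi_order \<alpha> = nat \<lfloor>s\<rfloor> \<longrightarrow>
        square_integrable (lebesgue_on \<Omega> \<Otimes>\<^sub>M lebesgue_on \<Omega>) (difference_quotient (frac s) (v \<alpha>))))"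

text \<open>The scalar product whose quadratic form is the square of \<open>sobolev_norm\<close>,
  expressed through the families of derivatives.\<close>

definition data_inner :: "real \<Rightarrow> (real^'m) set \<Rightarrow> (('m \<Rightarrow> nat) \<Rightarrow> real^'m \<Rightarrow> real) \<Rightarrow> (('m \<Rightarrow> nat) \<Rightarrow> real^'m \<Rightarrow> real) \<Rightarrow> real" where
  "data_inner s \<Omega> v w =
     (\<Sum>\<alpha> | multi_order \<alpha> \<le> nat \<lfloor>s\<rfloor>. \<integral>y. v \<alpha> y * w \<alpha> y \<partial>lebesgue_on \<Omega>) +
     (if 0 < frac s then (\<Sum>\<alpha> | multi_order \<alpha> = nat \<lfloor>s\<rfloor>.
        \<integral>p. difference_quotient (frac s) (v \<alpha>) p * difference_quotient (frac s) (w \<alpha>) p \<partial>(lebesgue_on \<Omega> \<Otimes>\<^sub>M lebesgue_on \<Omega>))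
      else 0)"

lemma data_inner_self:
  "data_inner s \<Omega> v v = (\<Sum>\<alpha> | multi_order \<alpha> \<le> nat \<lfloor>s\<rfloor>. \<integral>y. (v \<alpha> y)\<^sup>2 \<partial>lebesgue_on \<Omega>) +
     (if 0 < frac s then (\<Sum>\<alpha> | multi_order \<alpha> = nat \<lfloor>s\<rfloor>.
        integral\<^sup>L (lebesgue_on \<Omega> \<Otimes>\<^sub>M lebesgue_on \<Omega>) (gagliardo_kernel (frac s) (v \<alpha>))) else 0)"
  by (simp add: data_inner_def gagliardo_kernel_square power2_eq_square)

lemma gagliardo_integral_nonneg: "integral\<^sup>L M (gagliardo_kernel r v) \<ge> 0"
  unfolding gagliardo_kernel_square by simp

lemma data_inner_nonneg: "data_inner s \<Omega> v v \<ge> 0"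
  unfolding data_inner_self by (auto intro!: add_nonneg_nonneg sum_nonneg gagliardo_integral_nonneg)

lemma square_integral_le_data_inner:
  fixes \<Omega> :: "(real^'m) set"
  assumes "multi_order \<alpha> \<le> nat \<lfloor>s\<rfloor>"
  shows "(\<integral>y. (v \<alpha> y)\<^sup>2 \<partial>lebesgue_on \<Omega>) \<le> data_inner s \<Omega> v v"
proof -
  have "(\<integral>y. (v \<alpha> y)\<^sup>2 \<partial>lebesgue_on \<Omega>) \<le> (\<Sum>\<alpha> | multi_order \<alpha> \<le> nat \<lfloor>s\<rfloor>. \<integral>y. (v \<alpha> y)\<^sup>2 \<partial>lebesgue_on \<Omega>)"
    using assms by (intro member_le_sum[of \<alpha> _ "\<lambda>\<alpha>. \<integral>y. (v \<alpha> y)\<^sup>2 \<partial>lebesgue_on \<Omega>"]) (auto simp: finite_multi_indices)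
  also have "\<dots> \<le> data_inner s \<Omega> v v"
    unfolding data_inner_self by (auto intro!: sum_nonneg gagliardo_integral_nonneg)
  finally show ?thesis .
qed

lemma gagliardo_integral_le_data_inner:
  fixes \<Omega> :: "(real^'m) set"
  assumes "multi_order \<alpha> = nat \<lfloor>s\<rfloor>" "0 < frac s"
  shows "integral\<^sup>L (lebesgue_on \<Omega> \<Otimes>\<^sub>M lebesgue_on \<Omega>) (gagliardo_kernel (frac s) (v \<alpha>)) \<le> data_inner s \<Omega> v v"
proof -
  have "finite {\<alpha> :: 'm \<Rightarrow> nat. multi_order \<alpha> = nat \<lfloor>s\<rfloor>}"
    by (rule finite_subset[OF _ finite_multi_indices[of "nat \<lfloor>s\<rfloor>"]]) auto
  then have "integral\<^sup>L (lebesgue_on \<Omega> \<Otimes>\<^sub>M lebesgue_on \<Omega>) (gagliardo_kernel (frac s) (v \<alpha>)) \<le>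
      (\<Sum>\<alpha> | multi_order \<alpha> = nat \<lfloor>s\<rfloor>. integral\<^sup>L (lebesgue_on \<Omega> \<Otimes>\<^sub>M lebesgue_on \<Omega>) (gagliardo_kernel (frac s) (v \<alpha>)))"
    using assms(1) by (intro member_le_sum[of \<alpha> _ "\<lambda>\<alpha>. integral\<^sup>L (lebesgue_on \<Omega> \<Otimes>\<^sub>M lebesgue_on \<Omega>) (gagliardo_kernel (frac s) (v \<alpha>))"])
      (auto simp: gagliardo_integral_nonneg)
  also have "\<dots> \<le> data_inner s \<Omega> v v"
    using assms(2) unfolding data_inner_self by (auto intro!: sum_nonneg)
  finally show ?thesis .
qed

text \<open>Weak derivatives agree almost everywhere, hence so do their difference quotients on the
  product space. Therefore no integral in the norm depends on the family chosen.\<close>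

lemma sobolev_data_unique:
  fixes \<Omega> :: "(real^'m) set"
  assumes \<Omega>: "open \<Omega>" "bounded \<Omega>" and v: "sobolev_data s \<Omega> u v"
    and \<alpha>: "multi_order \<alpha> \<le> nat \<lfloor>s\<rfloor>" and w: "is_weak_deriv \<Omega> \<alpha> u w"
  shows "square_integrable (lebesgue_on \<Omega>) w" "AE y in lebesgue_on \<Omega>. v \<alpha> y = w y"
    "(\<integral>y. (w y)\<^sup>2 \<partial>lebesgue_on \<Omega>) = (\<integral>y. (v \<alpha> y)\<^sup>2 \<partial>lebesgue_on \<Omega>)"
    "0 < frac s \<Longrightarrow> multi_order \<alpha> = nat \<lfloor>s\<rfloor> \<Longrightarrow> square_integrable (lebesgue_on \<Omega> \<Otimes>\<^sub>M lebesgue_on \<Omega>) (difference_quotient (frac s) w)"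
    "0 < frac s \<Longrightarrow> multi_order \<alpha> = nat \<lfloor>s\<rfloor> \<Longrightarrow>
      integral\<^sup>L (lebesgue_on \<Omega> \<Otimes>\<^sub>M lebesgue_on \<Omega>) (gagliardo_kernel (frac s) w) =
      integral\<^sup>L (lebesgue_on \<Omega> \<Otimes>\<^sub>M lebesgue_on \<Omega>) (gagliardo_kernel (frac s) (v \<alpha>))"
proof -
  have v\<alpha>: "is_weak_deriv \<Omega> \<alpha> u (v \<alpha>)" "square_integrable (lebesgue_on \<Omega>) (v \<alpha>)"
    using v \<alpha> by (auto simp: sobolev_data_def)
  show eq: "AE y in lebesgue_on \<Omega>. v \<alpha> y = w y" by (rule weak_deriv_AE_unique[OF \<Omega>(1) v\<alpha>(1) w])
  have wm: "w \<in> borel_measurable (lebesgue_on \<Omega>)"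
    by (rule borel_measurable_lebesgue_on_AE_cong[OF square_integrableD(1)[OF v\<alpha>(2)] _ eq]) (use \<Omega> in simp)
  show "square_integrable (lebesgue_on \<Omega>) w" "(\<integral>y. (w y)\<^sup>2 \<partial>lebesgue_on \<Omega>) = (\<integral>y. (v \<alpha> y)\<^sup>2 \<partial>lebesgue_on \<Omega>)"
    using square_integrable_AE_cong[OF v\<alpha>(2) wm eq] by auto
  assume r: "0 < frac s" "multi_order \<alpha> = nat \<lfloor>s\<rfloor>"
  have q: "square_integrable (lebesgue_on \<Omega> \<Otimes>\<^sub>M lebesgue_on \<Omega>) (difference_quotient (frac s) (v \<alpha>))"
    using v r by (auto simp: sobolev_data_def)
  have lm: "\<Omega> \<in> lmeasurable" using \<Omega> by (simp add: lmeasurable_open)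
  note c = square_integrable_AE_cong[OF q difference_quotient_measurable[OF wm]
      difference_quotient_AE_cong[OF lm eq]]
  show "square_integrable (lebesgue_on \<Omega> \<Otimes>\<^sub>M lebesgue_on \<Omega>) (difference_quotient (frac s) w)" by (rule c(1))
  show "integral\<^sup>L (lebesgue_on \<Omega> \<Otimes>\<^sub>M lebesgue_on \<Omega>) (gagliardo_kernel (frac s) w) =
      integral\<^sup>L (lebesgue_on \<Omega> \<Otimes>\<^sub>M lebesgue_on \<Omega>) (gagliardo_kernel (frac s) (v \<alpha>))"
    unfolding gagliardo_kernel_square by (rule c(2))
qed

lemma L2_space_iff: "f \<in> L2_space \<Omega> \<longleftrightarrow> square_integrable (lebesgue_on \<Omega>) f"
  by (simp add: L2_space_def square_integrable_def)

lemma sobolev_data_imp: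
  fixes \<Omega> :: "(real^'m) set"
  assumes \<Omega>: "open \<Omega>" "bounded \<Omega>" and v: "sobolev_data s \<Omega> u v"
  shows "u \<in> sobolev s \<Omega>" "sobolev_norm s \<Omega> u = sqrt (data_inner s \<Omega> v v)"
proof -
  have wd: "is_weak_deriv \<Omega> \<alpha> u (weak_deriv \<Omega> \<alpha> u)" if "multi_order \<alpha> \<le> nat \<lfloor>s\<rfloor>" for \<alpha>
    unfolding weak_deriv_def using v that by (intro someI[of "is_weak_deriv \<Omega> \<alpha> u" "v \<alpha>"]) (auto simp: sobolev_data_def)
  note U = sobolev_data_unique[OF \<Omega> v _ wd]
  have "\<exists>v\<in>L2_space \<Omega>. is_weak_deriv \<Omega> \<alpha> u v" if "multi_order \<alpha> \<le> nat \<lfloor>s\<rfloor>" for \<alpha>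
    using v that by (auto simp: sobolev_data_def L2_space_iff)
  moreover have "integrable (lebesgue_on \<Omega> \<Otimes>\<^sub>M lebesgue_on \<Omega>) (gagliardo_kernel (frac s) (weak_deriv \<Omega> \<alpha> u))"
    if "0 < frac s" "multi_order \<alpha> = nat \<lfloor>s\<rfloor>" for \<alpha>
    using U(4)[of \<alpha>] that unfolding gagliardo_kernel_square by (auto dest: square_integrableD)
  ultimately show "u \<in> sobolev s \<Omega>" unfolding sobolev_def by blast
  have L2: "(L2_norm \<Omega> f)\<^sup>2 = (\<integral>y. (f y)\<^sup>2 \<partial>lebesgue_on \<Omega>)" for f by (simp add: L2_norm_def)
  show "sobolev_norm s \<Omega> u = sqrt (data_inner s \<Omega> v v)"
  proof -
    have 1: "(\<Sum>\<alpha> | multi_order \<alpha> \<le> nat \<lfloor>s\<rfloor>. \<integral>y. (weak_deriv \<Omega> \<alpha> u y)\<^sup>2 \<partial>lebesgue_on \<Omega>) =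
        (\<Sum>\<alpha> | multi_order \<alpha> \<le> nat \<lfloor>s\<rfloor>. \<integral>y. (v \<alpha> y)\<^sup>2 \<partial>lebesgue_on \<Omega>)"
      using U(3) by (intro sum.cong) auto
    have 2: "(\<Sum>\<alpha> | multi_order \<alpha> = nat \<lfloor>s\<rfloor>. integral\<^sup>L (lebesgue_on \<Omega> \<Otimes>\<^sub>M lebesgue_on \<Omega>) (gagliardo_kernel (frac s) (weak_deriv \<Omega> \<alpha> u))) =
        (\<Sum>\<alpha> | multi_order \<alpha> = nat \<lfloor>s\<rfloor>. integral\<^sup>L (lebesgue_on \<Omega> \<Otimes>\<^sub>M lebesgue_on \<Omega>) (gagliardo_kernel (frac s) (v \<alpha>)))"
      if "0 < frac s" using U(5) that by (intro sum.cong) auto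
    show ?thesis unfolding sobolev_norm_def data_inner_self L2 1 using 2 by (cases "0 < frac s") simp_all
  qed
qed

lemma sobolev_imp_data:
  fixes \<Omega> :: "(real^'m) set"
  assumes \<Omega>: "open \<Omega>" "bounded \<Omega>" and u: "u \<in> sobolev s \<Omega>"
  shows "sobolev_data s \<Omega> u (\<lambda>\<alpha>. weak_deriv \<Omega> \<alpha> u)"
proof -
  have *: "is_weak_deriv \<Omega> \<alpha> u (weak_deriv \<Omega> \<alpha> u) \<and> square_integrable (lebesgue_on \<Omega>) (weak_deriv \<Omega> \<alpha> u)"
    if "multi_order \<alpha> \<le> nat \<lfloor>s\<rfloor>" for \<alpha>
  proof -
    obtain v where v: "square_integrable (lebesgue_on \<Omega>) v" "is_weak_deriv \<Omega> \<alpha> u v"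
      using u \<open>multi_order \<alpha> \<le> nat \<lfloor>s\<rfloor>\<close> unfolding sobolev_def L2_space_iff[symmetric] by blast
    then have wd: "is_weak_deriv \<Omega> \<alpha> u (weak_deriv \<Omega> \<alpha> u)"
      unfolding weak_deriv_def by (intro someI[of "is_weak_deriv \<Omega> \<alpha> u" v])
    have eq: "AE y in lebesgue_on \<Omega>. v y = weak_deriv \<Omega> \<alpha> u y" by (rule weak_deriv_AE_unique[OF \<Omega>(1) v(2) wd])
    have "weak_deriv \<Omega> \<alpha> u \<in> borel_measurable (lebesgue_on \<Omega>)"
      by (rule borel_measurable_lebesgue_on_AE_cong[OF square_integrableD(1)[OF v(1)] _ eq]) (use \<Omega> in simp)
    from square_integrable_AE_cong(1)[OF v(1) this eq] wd show ?thesis by simp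
  qed
  moreover have "square_integrable (lebesgue_on \<Omega> \<Otimes>\<^sub>M lebesgue_on \<Omega>) (difference_quotient (frac s) (weak_deriv \<Omega> \<alpha> u))"
    if "0 < frac s" "multi_order \<alpha> = nat \<lfloor>s\<rfloor>" for \<alpha>
    using *[of \<alpha>] that u unfolding sobolev_def gagliardo_kernel_square square_integrable_def
    by (auto intro: difference_quotient_measurable)
  ultimately show ?thesis unfolding sobolev_data_def by blast
qed

section \<open>Linear combinations and the quadratic form\<close>

lemma is_weak_deriv_lincomb:
  assumes \<Omega>: "\<Omega> \<in> sets lebesgue" and v: "is_weak_deriv \<Omega> \<alpha> u v" and w: "is_weak_deriv \<Omega> \<alpha> u' w"
  shows "is_weak_deriv \<Omega> \<alpha> (\<lambda>y. a * u y + b * u' y) (\<lambda>y. a * v y + b * w y)"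
proof -
  have li: "locally_integrable \<Omega> u" "locally_integrable \<Omega> u'" "locally_integrable \<Omega> v" "locally_integrable \<Omega> w"
    using v w by (auto simp: is_weak_deriv_def)
  have "(\<integral>y. (a * u y + b * u' y) * multi_partial \<alpha> \<phi> y \<partial>lebesgue_on \<Omega>) =
      (-1) ^ multi_order \<alpha> * (\<integral>y. (a * v y + b * w y) * \<phi> y \<partial>lebesgue_on \<Omega>)"
    if \<phi>: "\<phi> \<in> test_functions \<Omega>" for \<phi>
  proof -
    note i = integrable_test_function_mult[OF _ _ \<Omega>] and \<phi>' = multi_partial_test_function[OF \<phi>, of \<alpha>]
    have "(\<integral>y. (a * u y + b * u' y) * multi_partial \<alpha> \<phi> y \<partial>lebesgue_on \<Omega>) =
        a * (\<integral>y. u y * multi_partial \<alpha> \<phi> y \<partial>lebesgue_on \<Omega>) + b * (\<integral>y. u' y * multi_partial \<alpha> \<phi> y \<partial>lebesgue_on \<Omega>)"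
      using i[OF li(1) \<phi>'] i[OF li(2) \<phi>'] by (simp add: distrib_right mult.assoc)
    also have "(\<integral>y. u y * multi_partial \<alpha> \<phi> y \<partial>lebesgue_on \<Omega>) = (-1) ^ multi_order \<alpha> * (\<integral>y. v y * \<phi> y \<partial>lebesgue_on \<Omega>)"
      using v \<phi> by (simp add: is_weak_deriv_def)
    also have "(\<integral>y. u' y * multi_partial \<alpha> \<phi> y \<partial>lebesgue_on \<Omega>) = (-1) ^ multi_order \<alpha> * (\<integral>y. w y * \<phi> y \<partial>lebesgue_on \<Omega>)"
      using w \<phi> by (simp add: is_weak_deriv_def)
    also have "a * ((-1) ^ multi_order \<alpha> * (\<integral>y. v y * \<phi> y \<partial>lebesgue_on \<Omega>)) + b * ((-1) ^ multi_order \<alpha> * (\<integral>y. w y * \<phi> y \<partial>lebesgue_on \<Omega>)) =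
        (-1) ^ multi_order \<alpha> * (\<integral>y. (a * v y + b * w y) * \<phi> y \<partial>lebesgue_on \<Omega>)"
      using i[OF li(3) \<phi>] i[OF li(4) \<phi>] by (simp add: distrib_right distrib_left mult.assoc mult.left_commute)
    finally show ?thesis .
  qed
  then show ?thesis using locally_integrable_lincomb li unfolding is_weak_deriv_def by blast
qed

lemma sobolev_data_lincomb:
  fixes \<Omega> :: "(real^'m) set"
  assumes \<Omega>: "open \<Omega>" and v: "sobolev_data s \<Omega> u v" and w: "sobolev_data s \<Omega> u' w"
  shows "sobolev_data s \<Omega> (\<lambda>y. a * u y + b * u' y) (\<lambda>\<alpha> y. a * v \<alpha> y + b * w \<alpha> y)"
    and "data_inner s \<Omega> (\<lambda>\<alpha> y. a * v \<alpha> y + b * w \<alpha> y) (\<lambda>\<alpha> y. a * v \<alpha> y + b * w \<alpha> y) =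
      a\<^sup>2 * data_inner s \<Omega> v v + 2 * a * b * data_inner s \<Omega> v w + b\<^sup>2 * data_inner s \<Omega> w w"
proof -
  have dq: "difference_quotient r (\<lambda>y. a * f y + b * g y) = (\<lambda>p. a * difference_quotient r f p + b * difference_quotient r g p)"
    for r and f g :: "real^'m \<Rightarrow> real" by (rule ext) (rule difference_quotient_lincomb)
  show "sobolev_data s \<Omega> (\<lambda>y. a * u y + b * u' y) (\<lambda>\<alpha> y. a * v \<alpha> y + b * w \<alpha> y)"
    using v w \<Omega> unfolding sobolev_data_def dq
    by (auto intro!: is_weak_deriv_lincomb square_integrable_lincomb)
  have 1: "(\<integral>y. (a * v \<alpha> y + b * w \<alpha> y)\<^sup>2 \<partial>lebesgue_on \<Omega>) =
      a\<^sup>2 * (\<integral>y. v \<alpha> y * v \<alpha> y \<partial>lebesgue_on \<Omega>) + 2 * a * b * (\<integral>y. v \<alpha> y * w \<alpha> y \<partial>lebesgue_on \<Omega>) +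
      b\<^sup>2 * (\<integral>y. w \<alpha> y * w \<alpha> y \<partial>lebesgue_on \<Omega>)" if "multi_order \<alpha> \<le> nat \<lfloor>s\<rfloor>" for \<alpha>
    using integral_square_lincomb[of "lebesgue_on \<Omega>" "v \<alpha>" "w \<alpha>" a b] v w that
    by (simp add: sobolev_data_def power2_eq_square)
  have 2: "integral\<^sup>L (lebesgue_on \<Omega> \<Otimes>\<^sub>M lebesgue_on \<Omega>) (gagliardo_kernel (frac s) (\<lambda>y. a * v \<alpha> y + b * w \<alpha> y)) =
      a\<^sup>2 * (\<integral>p. difference_quotient (frac s) (v \<alpha>) p * difference_quotient (frac s) (v \<alpha>) p \<partial>(lebesgue_on \<Omega> \<Otimes>\<^sub>M lebesgue_on \<Omega>)) +
      2 * a * b * (\<integral>p. difference_quotient (frac s) (v \<alpha>) p * difference_quotient (frac s) (w \<alpha>) p \<partial>(lebesgue_on \<Omega> \<Otimes>\<^sub>M lebesgue_on \<Omega>)) +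
      b\<^sup>2 * (\<integral>p. difference_quotient (frac s) (w \<alpha>) p * difference_quotient (frac s) (w \<alpha>) p \<partial>(lebesgue_on \<Omega> \<Otimes>\<^sub>M lebesgue_on \<Omega>))"
    if "0 < frac s" "multi_order \<alpha> = nat \<lfloor>s\<rfloor>" for \<alpha>
    unfolding gagliardo_kernel_square dq
    using integral_square_lincomb[of "lebesgue_on \<Omega> \<Otimes>\<^sub>M lebesgue_on \<Omega>" "difference_quotient (frac s) (v \<alpha>)" "difference_quotient (frac s) (w \<alpha>)" a b] v w that
    by (simp add: sobolev_data_def power2_eq_square)
  show "data_inner s \<Omega> (\<lambda>\<alpha> y. a * v \<alpha> y + b * w \<alpha> y) (\<lambda>\<alpha> y. a * v \<alpha> y + b * w \<alpha> y) =
      a\<^sup>2 * data_inner s \<Omega> v v + 2 * a * b * data_inner s \<Omega> v w + b\<^sup>2 * data_inner s \<Omega> w w"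
  proof -
    let ?D = "\<lambda>f g \<alpha>. \<integral>p. difference_quotient (frac s) (f \<alpha>) p * difference_quotient (frac s) (g \<alpha>) p \<partial>(lebesgue_on \<Omega> \<Otimes>\<^sub>M lebesgue_on \<Omega>)"
    have S1: "(\<Sum>\<alpha> | multi_order \<alpha> \<le> nat \<lfloor>s\<rfloor>. \<integral>y. (a * v \<alpha> y + b * w \<alpha> y)\<^sup>2 \<partial>lebesgue_on \<Omega>) =
        a\<^sup>2 * (\<Sum>\<alpha> | multi_order \<alpha> \<le> nat \<lfloor>s\<rfloor>. \<integral>y. v \<alpha> y * v \<alpha> y \<partial>lebesgue_on \<Omega>) +
        2 * a * b * (\<Sum>\<alpha> | multi_order \<alpha> \<le> nat \<lfloor>s\<rfloor>. \<integral>y. v \<alpha> y * w \<alpha> y \<partial>lebesgue_on \<Omega>) +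
        b\<^sup>2 * (\<Sum>\<alpha> | multi_order \<alpha> \<le> nat \<lfloor>s\<rfloor>. \<integral>y. w \<alpha> y * w \<alpha> y \<partial>lebesgue_on \<Omega>)"
      unfolding sum_distrib_left sum.distrib[symmetric] using 1 by (intro sum.cong) auto
    have S2: "(\<Sum>\<alpha> | multi_order \<alpha> = nat \<lfloor>s\<rfloor>. integral\<^sup>L (lebesgue_on \<Omega> \<Otimes>\<^sub>M lebesgue_on \<Omega>) (gagliardo_kernel (frac s) (\<lambda>y. a * v \<alpha> y + b * w \<alpha> y))) =
        a\<^sup>2 * (\<Sum>\<alpha> | multi_order \<alpha> = nat \<lfloor>s\<rfloor>. ?D v v \<alpha>) + 2 * a * b * (\<Sum>\<alpha> | multi_order \<alpha> = nat \<lfloor>s\<rfloor>. ?D v w \<alpha>) +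
        b\<^sup>2 * (\<Sum>\<alpha> | multi_order \<alpha> = nat \<lfloor>s\<rfloor>. ?D w w \<alpha>)" if "0 < frac s"
      unfolding sum_distrib_left sum.distrib[symmetric] using 2[OF that] by (intro sum.cong) auto
    show ?thesis
    proof (cases "0 < frac s")
      case True
      show ?thesis
        unfolding data_inner_self[of s \<Omega> "\<lambda>\<alpha> y. a * v \<alpha> y + b * w \<alpha> y"] if_P[OF True] S1 S2[OF True]
        unfolding data_inner_def if_P[OF True]
        by (simp only: distrib_left add_ac)
    next
      case False
      show ?thesis
        unfolding data_inner_self[of s \<Omega> "\<lambda>\<alpha> y. a * v \<alpha> y + b * w \<alpha> y"] if_not_P[OF False] S1
        unfolding data_inner_def if_not_P[OF False]
        by (simp only: add_0_right)
    qed
  qed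
qed

text \<open>B is the scalar product of u and w. Having one B for all a and b packs closure under
  linear combinations, polarization and the parallelogram law into a statement free of
  derivatives.\<close>

lemma sobolev_norm_quadratic:
  fixes \<Omega> :: "(real^'m) set"
  assumes \<Omega>: "open \<Omega>" "bounded \<Omega>" and "u \<in> sobolev s \<Omega>" "w \<in> sobolev s \<Omega>"
  shows "\<exists>B. \<forall>a b. (\<lambda>t. a * u t + b * w t) \<in> sobolev s \<Omega> \<and>
    (sobolev_norm s \<Omega> (\<lambda>t. a * u t + b * w t))\<^sup>2 =
      a\<^sup>2 * (sobolev_norm s \<Omega> u)\<^sup>2 + 2 * a * b * B + b\<^sup>2 * (sobolev_norm s \<Omega> w)\<^sup>2"
proof -
  note du = sobolev_imp_data[OF \<Omega> assms(3)] and dw = sobolev_imp_data[OF \<Omega> assms(4)]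
  note l = sobolev_data_lincomb[OF \<Omega>(1) du dw]
  have "(sobolev_norm s \<Omega> (\<lambda>t. a * u t + b * w t))\<^sup>2 =
      a\<^sup>2 * (sobolev_norm s \<Omega> u)\<^sup>2 + 2 * a * b * data_inner s \<Omega> (\<lambda>\<alpha>. weak_deriv \<Omega> \<alpha> u) (\<lambda>\<alpha>. weak_deriv \<Omega> \<alpha> w) +
      b\<^sup>2 * (sobolev_norm s \<Omega> w)\<^sup>2" for a b
    unfolding sobolev_data_imp(2)[OF \<Omega> l(1)] sobolev_data_imp(2)[OF \<Omega> du] sobolev_data_imp(2)[OF \<Omega> dw]
      real_sqrt_pow2[OF data_inner_nonneg] by (rule l(2))
  then show ?thesis using sobolev_data_imp(1)[OF \<Omega> l(1)] by blast
qed

text \<open>u is its own weak derivative of order 0, so uniqueness gives it the integrability and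
  the norm of the corresponding member of the family.\<close>

lemma sobolev_data_0:
  fixes \<Omega> :: "(real^'m) set"
  assumes \<Omega>: "open \<Omega>" "bounded \<Omega>" and v: "sobolev_data s \<Omega> u v"
  shows "square_integrable (lebesgue_on \<Omega>) u" "(\<integral>y. (u y)\<^sup>2 \<partial>lebesgue_on \<Omega>) \<le> data_inner s \<Omega> v v"
proof -
  have 0: "multi_order (\<lambda>_::'m. 0) \<le> nat \<lfloor>s\<rfloor>" by (simp add: multi_order_def)
  have "locally_integrable \<Omega> u" using v 0 unfolding sobolev_data_def is_weak_deriv_def by blast
  then have "is_weak_deriv \<Omega> (\<lambda>_. 0) u u"
    by (simp add: is_weak_deriv_def multi_order_def multi_partial_0)
  from sobolev_data_unique[OF \<Omega> v 0 this] square_integral_le_data_inner[OF 0, of \<Omega> v]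
  show "square_integrable (lebesgue_on \<Omega>) u" "(\<integral>y. (u y)\<^sup>2 \<partial>lebesgue_on \<Omega>) \<le> data_inner s \<Omega> v v" by auto
qed

lemma sobolev_sup_estimate:
  fixes \<Omega> :: "(real^'m) set"
  assumes \<Omega>: "open \<Omega>" "bounded \<Omega>" "cone_property \<Omega>" and s: "s > real CARD('m) / 2" and e: "e > 0"
  shows "\<exists>G. finite G \<and> (\<forall>g\<in>G. continuous_on UNIV g) \<and> (\<forall>u\<in>sobolev s \<Omega>. continuous_on \<Omega> u \<longrightarrow>
    (\<forall>x\<in>\<Omega>. \<bar>u x\<bar> \<le> (\<Sum>g\<in>G. \<bar>\<integral>y. u y * g y \<partial>lebesgue_on \<Omega>\<bar>) + e * sobolev_norm s \<Omega> u))"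
proof -
  let ?k = "nat \<lfloor>s\<rfloor>" and ?r = "frac s"
  \<comment> \<open>The m top seminorms and the L2 norm are each at most the Sobolev norm.\<close>
  define e' where "e' = e / (real CARD('m) + 1)"
  have e': "e' > 0" using e by (simp add: e'_def)
  have "s > 0" by (rule le_less_trans[OF _ s]) simp
  then have kr: "real ?k + ?r = s" by (simp add: frac_def)
  obtain G where G: "finite G" "\<forall>g\<in>G. continuous_on UNIV g" and est: "\<And>u v x. x \<in> \<Omega> \<Longrightarrow>
    continuous_on \<Omega> u \<Longrightarrow> square_integrable (lebesgue_on \<Omega>) u \<Longrightarrow> top_deriv_family ?k ?r \<Omega> u v \<Longrightarrow>
    \<bar>u x\<bar> \<le> (\<Sum>g\<in>G. \<bar>\<integral>y. u y * g y \<partial>lebesgue_on \<Omega>\<bar>) +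
      e' * ((\<Sum>i\<in>UNIV. seminorm_top ?r \<Omega> (v i)) + sqrt (\<integral>y. (u y)\<^sup>2 \<partial>lebesgue_on \<Omega>))"
  proof -
    from sup_estimate[OF _ _ \<Omega>(2,1,3) e', of ?r ?k] s kr obtain G where "finite G" "\<forall>g\<in>G. continuous_on UNIV g" and
      "\<forall>u v x. x \<in> \<Omega> \<longrightarrow> continuous_on \<Omega> u \<longrightarrow> square_integrable (lebesgue_on \<Omega>) u \<longrightarrow> top_deriv_family ?k ?r \<Omega> u v \<longrightarrow>
    \<bar>u x\<bar> \<le> (\<Sum>g\<in>G. \<bar>\<integral>y. u y * g y \<partial>lebesgue_on \<Omega>\<bar>) +
      e' * ((\<Sum>i\<in>UNIV. seminorm_top ?r \<Omega> (v i)) + sqrt (\<integral>y. (u y)\<^sup>2 \<partial>lebesgue_on \<Omega>))"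
      by auto
    then show ?thesis by (intro that[of G]) simp_all
  qed
  have "\<bar>u x\<bar> \<le> (\<Sum>g\<in>G. \<bar>\<integral>y. u y * g y \<partial>lebesgue_on \<Omega>\<bar>) + e * sobolev_norm s \<Omega> u"
    if u: "u \<in> sobolev s \<Omega>" "continuous_on \<Omega> u" and x: "x \<in> \<Omega>" for u x
  proof -
    define v where "v = (\<lambda>\<alpha>. weak_deriv \<Omega> \<alpha> u)"
    have v: "sobolev_data s \<Omega> u v" unfolding v_def by (rule sobolev_imp_data[OF \<Omega>(1,2) u(1)])
    let ?N = "sqrt (data_inner s \<Omega> v v)"
    have o: "multi_order (pure_index ?k i) = ?k" for i :: 'm by (simp add: multi_order_def)
    have top: "top_deriv_family ?k ?r \<Omega> u (\<lambda>i. v (pure_index ?k i))"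
      using v o unfolding top_deriv_family_def sobolev_data_def gagliardo_kernel_square
      by (auto dest: square_integrableD)
    have sem: "seminorm_top ?r \<Omega> (v (pure_index ?k i)) \<le> ?N" for i
    proof (cases "0 < ?r")
      case True
      then show ?thesis using gagliardo_integral_le_data_inner[of "pure_index ?k i" s \<Omega> v] o[of i]
        by (simp add: seminorm_top_def)
    next
      case False
      then show ?thesis using square_integral_le_data_inner[of "pure_index ?k i" s \<Omega> v] o[of i]
        by (simp add: seminorm_top_def)
    qed
    have "(\<Sum>i\<in>UNIV. seminorm_top ?r \<Omega> (v (pure_index ?k i))) \<le> real CARD('m) * ?N"
      using sum_bounded_above[of UNIV "\<lambda>i. seminorm_top ?r \<Omega> (v (pure_index ?k i))" ?N] sem by simp
    moreover have "sqrt (\<integral>y. (u y)\<^sup>2 \<partial>lebesgue_on \<Omega>) \<le> ?N"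
      by (rule real_sqrt_le_mono) (rule sobolev_data_0(2)[OF \<Omega>(1,2) v])
    ultimately have "(\<Sum>i\<in>UNIV. seminorm_top ?r \<Omega> (v (pure_index ?k i))) + sqrt (\<integral>y. (u y)\<^sup>2 \<partial>lebesgue_on \<Omega>) \<le>
        (real CARD('m) + 1) * ?N"
      by (simp only: distrib_right mult_1_left add_mono)
    then have "e' * ((\<Sum>i\<in>UNIV. seminorm_top ?r \<Omega> (v (pure_index ?k i))) + sqrt (\<integral>y. (u y)\<^sup>2 \<partial>lebesgue_on \<Omega>)) \<le>
        e' * ((real CARD('m) + 1) * ?N)"
      using e' by (intro mult_left_mono) auto
    also have "\<dots> = e * sobolev_norm s \<Omega> u"
      unfolding sobolev_data_imp(2)[OF \<Omega>(1,2) v] e'_def by simp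
    finally show ?thesis
      using est[OF x u(2) sobolev_data_0(1)[OF \<Omega>(1,2) v] top] by linarith
  qed
  with G show ?thesis by blast
qed

section \<open>Completeness\<close>

lemma square_integrable_Fatou:
  assumes h: "\<And>j. square_integrable M (h j)" and lim: "AE x in M. (\<lambda>j. h j x) \<longlonglongrightarrow> g x"
    and g: "g \<in> borel_measurable M" and e: "0 \<le> e" "\<forall>\<^sub>F j in sequentially. (\<integral>x. (h j x)\<^sup>2 \<partial>M) \<le> e"
  shows "square_integrable M g" "(\<integral>x. (g x)\<^sup>2 \<partial>M) \<le> e"
proof -
  have hm [measurable]: "h j \<in> borel_measurable M" for j using h by (rule square_integrableD)
  have "(\<integral>\<^sup>+x. ennreal ((g x)\<^sup>2) \<partial>M) = (\<integral>\<^sup>+x. liminf (\<lambda>j. ennreal ((h j x)\<^sup>2)) \<partial>M)"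
  proof (rule nn_integral_cong_AE)
    show "AE x in M. ennreal ((g x)\<^sup>2) = liminf (\<lambda>j. ennreal ((h j x)\<^sup>2))"
      using lim
    proof eventually_elim
      case (elim x)
      then have "(\<lambda>j. ennreal ((h j x)\<^sup>2)) \<longlonglongrightarrow> ennreal ((g x)\<^sup>2)"
        by (intro tendsto_ennrealI tendsto_power)
      then show ?case using lim_imp_Liminf[OF sequentially_bot] by metis
    qed
  qed
  also have "\<dots> \<le> liminf (\<lambda>j. \<integral>\<^sup>+x. ennreal ((h j x)\<^sup>2) \<partial>M)"
    by (rule nn_integral_liminf) measurable
  also have "\<dots> = liminf (\<lambda>j. ennreal (\<integral>x. (h j x)\<^sup>2 \<partial>M))"
    using square_integrableD(2)[OF h] by (simp add: nn_integral_eq_integral)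
  also have "\<dots> \<le> liminf (\<lambda>j. ennreal e)"
    using e by (intro Liminf_mono) (auto elim!: eventually_mono intro: ennreal_leI)
  also have "\<dots> = ennreal e" by (simp add: Liminf_const)
  finally have le: "(\<integral>\<^sup>+x. ennreal ((g x)\<^sup>2) \<partial>M) \<le> ennreal e" .
  then have "integrable M (\<lambda>x. (g x)\<^sup>2)"
    using g le_less_trans[OF le ennreal_less_top] by (intro integrableI_bounded) auto
  then show "square_integrable M g" using g by (simp add: square_integrable_def)
  show "(\<integral>x. (g x)\<^sup>2 \<partial>M) \<le> e"
    using le nn_integral_eq_integral[OF \<open>integrable M (\<lambda>x. (g x)\<^sup>2)\<close>] e(1) by simp
qed

text \<open>Riesz-Fischer: on a finite measure an L2-Cauchy sequence is L1-Cauchy and so has a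
  subsequence converging almost everywhere. Fatou's lemma passes the Cauchy estimate to the
  limit.\<close>

lemma square_integrable_complete:
  fixes f :: "nat \<Rightarrow> 'a \<Rightarrow> real"
  assumes M: "finite_measure M" and f: "\<And>n. square_integrable M (f n)"
    and cau: "\<And>e. e > 0 \<Longrightarrow> \<exists>N. \<forall>n\<ge>N. \<forall>m\<ge>N. (\<integral>x. (f n x - f m x)\<^sup>2 \<partial>M) \<le> e"
  shows "\<exists>g. square_integrable M g \<and> (\<lambda>n. \<integral>x. (f n x - g x)\<^sup>2 \<partial>M) \<longlonglongrightarrow> 0"
proof -
  interpret finite_measure M by fact
  have d: "square_integrable M (\<lambda>x. f n x - f m x)" for n m
    using square_integrable_lincomb[OF f f, of 1 n "-1" m] by simp
  have [measurable]: "f n \<in> borel_measurable M" for n using f by (rule square_integrableD)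
  have one: "square_integrable M (\<lambda>_. 1)" by (rule square_integrable_bounded[OF M, of _ 1]) auto
  obtain r :: "nat \<Rightarrow> nat" where r: "strict_mono r" "AE x in M. Cauchy (\<lambda>i. f (r i) x)"
  proof (rule cauchy_L1_AE_cauchy_subseq[of M f])
    show "integrable M (f n)" for n by (rule square_integrable_integrable[OF M f])
    fix e :: real assume e: "e > 0"
    define c where "c = e / (1 + sqrt (measure M (space M)))"
    have s: "1 + sqrt (measure M (space M)) > 0" by (intro add_pos_nonneg) auto
    then have c: "c > 0" using e by (simp add: c_def)
    obtain N where N: "\<And>n m. n \<ge> N \<Longrightarrow> m \<ge> N \<Longrightarrow> (\<integral>x. (f n x - f m x)\<^sup>2 \<partial>M) \<le> c\<^sup>2"
      using cau[of "c\<^sup>2"] c by (metis zero_less_power)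
    have "(\<integral>x. norm (f n x - f m x) \<partial>M) < e" if "n \<ge> N" "m \<ge> N" for n m
    proof -
      have "square_integrable M (\<lambda>x. \<bar>f n x - f m x\<bar>)" using d[of n m] by (simp add: square_integrable_def)
      from Cauchy_Schwarz_integral[OF this one]
      have "(\<integral>x. \<bar>f n x - f m x\<bar> \<partial>M) \<le> sqrt (\<integral>x. (f n x - f m x)\<^sup>2 \<partial>M) * sqrt (measure M (space M))" by simp
      also have "\<dots> \<le> c * sqrt (measure M (space M))"
        using N[OF that] c by (intro mult_right_mono real_le_lsqrt) auto
      also have "\<dots> < c * (1 + sqrt (measure M (space M)))" using c by simp
      also have "\<dots> = e" using s by (simp add: c_def)
      finally show ?thesis by simp
    qed
    then show "\<exists>N. \<forall>i\<ge>N. \<forall>j\<ge>N. (LINT x|M. norm (f i x - f j x)) < e" by blast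
  qed
  define g where "g x = lim (\<lambda>i. f (r i) x)" for x
  have gm [measurable]: "g \<in> borel_measurable M" unfolding g_def by measurable
  have lim: "AE x in M. (\<lambda>i. f (r i) x) \<longlonglongrightarrow> g x"
    using r(2) by eventually_elim (simp add: g_def Cauchy_convergent_iff convergent_LIMSEQ_iff)
  have F: "square_integrable M (\<lambda>x. f n x - g x) \<and> (\<integral>x. (f n x - g x)\<^sup>2 \<partial>M) \<le> e"
    if e: "e > 0" and N: "\<forall>n\<ge>N. \<forall>m\<ge>N. (\<integral>x. (f n x - f m x)\<^sup>2 \<partial>M) \<le> e" and n: "n \<ge> N" for e N n
  proof -
    have 1: "AE x in M. (\<lambda>i. f n x - f (r i) x) \<longlonglongrightarrow> f n x - g x"
      using lim by eventually_elim (intro tendsto_intros)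
    have 2: "\<forall>\<^sub>F i in sequentially. (\<integral>x. (f n x - f (r i) x)\<^sup>2 \<partial>M) \<le> e"
      using N n seq_suble[OF r(1)] by (intro eventually_sequentiallyI[of N]) (meson le_trans)
    from square_integrable_Fatou[OF d 1 _ _ 2] e show ?thesis by simp
  qed
  obtain N1 where N1: "\<forall>n\<ge>N1. \<forall>m\<ge>N1. (\<integral>x. (f n x - f m x)\<^sup>2 \<partial>M) \<le> 1" using cau[of 1] by auto
  have "square_integrable M (\<lambda>x. 1 * f N1 x + (-1) * (f N1 x - g x))"
    using F[OF _ N1, of N1] by (intro square_integrable_lincomb f) auto
  then have "square_integrable M g" by simp
  moreover have "(\<lambda>n. \<integral>x. (f n x - g x)\<^sup>2 \<partial>M) \<longlonglongrightarrow> 0"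
  proof (rule LIMSEQ_I)
    fix e :: real assume e: "e > 0"
    obtain N where N: "\<forall>n\<ge>N. \<forall>m\<ge>N. (\<integral>x. (f n x - f m x)\<^sup>2 \<partial>M) \<le> e / 2" using cau[of "e / 2"] e by auto
    have "norm ((\<integral>x. (f n x - g x)\<^sup>2 \<partial>M) - 0) < e" if "n \<ge> N" for n
      using F[OF _ N that] e by simp
    then show "\<exists>N. \<forall>n\<ge>N. norm ((\<integral>x. (f n x - g x)\<^sup>2 \<partial>M) - 0) < e" by blast
  qed
  ultimately show ?thesis by blast
qed

lemma L2_limit_AE_subseq:
  fixes f :: "nat \<Rightarrow> 'a \<Rightarrow> real"
  assumes f: "\<And>n. square_integrable M (f n)" and g: "square_integrable M g"
    and lim: "(\<lambda>n. \<integral>x. (f n x - g x)\<^sup>2 \<partial>M) \<longlonglongrightarrow> 0"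
  shows "\<exists>r::nat \<Rightarrow> nat. strict_mono r \<and> (AE x in M. (\<lambda>n. f (r n) x) \<longlonglongrightarrow> g x)"
proof -
  have "integrable M (\<lambda>x. (f n x - g x)\<^sup>2)" for n
    using square_integrable_lincomb[OF f g, of 1 n "-1"] by (simp add: square_integrable_def)
  from tendsto_L1_AE_subseq[of M "\<lambda>n x. (f n x - g x)\<^sup>2", OF this] lim
  obtain r where r: "strict_mono r" "AE x in M. (\<lambda>n. (f (r n) x - g x)\<^sup>2) \<longlonglongrightarrow> 0" by auto
  have "AE x in M. (\<lambda>n. f (r n) x) \<longlonglongrightarrow> g x"
    using r(2)
  proof eventually_elim
    case (elim x)
    then have "(\<lambda>n. sqrt ((f (r n) x - g x)\<^sup>2)) \<longlonglongrightarrow> sqrt 0" by (rule tendsto_real_sqrt)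
    then show ?case by (simp add: tendsto_rabs_zero_iff LIM_zero_iff)
  qed
  with r(1) show ?thesis by blast
qed

lemma L2_limit_integral_mult:
  assumes f: "\<And>n. square_integrable M (f n)" and g: "square_integrable M g" and \<phi>: "square_integrable M \<phi>"
    and lim: "(\<lambda>n. \<integral>x. (f n x - g x)\<^sup>2 \<partial>M) \<longlonglongrightarrow> 0"
  shows "(\<lambda>n. \<integral>x. f n x * \<phi> x \<partial>M) \<longlonglongrightarrow> (\<integral>x. g x * \<phi> x \<partial>M)"
proof (rule LIM_zero_cancel, rule Lim_null_comparison)
  have d: "square_integrable M (\<lambda>x. f n x - g x)" for n
    using square_integrable_lincomb[OF f g, of 1 n "-1"] by simp
  have "(\<integral>x. f n x * \<phi> x \<partial>M) - (\<integral>x. g x * \<phi> x \<partial>M) = (\<integral>x. (f n x - g x) * \<phi> x \<partial>M)" for n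
    using square_integrable_mult[OF f \<phi>] square_integrable_mult[OF g \<phi>] by (simp add: left_diff_distrib)
  then show "\<forall>\<^sub>F n in sequentially. norm ((\<integral>x. f n x * \<phi> x \<partial>M) - (\<integral>x. g x * \<phi> x \<partial>M)) \<le>
      sqrt (\<integral>x. (f n x - g x)\<^sup>2 \<partial>M) * sqrt (\<integral>x. (\<phi> x)\<^sup>2 \<partial>M)"
    using Cauchy_Schwarz_integral[OF d \<phi>] by simp
  show "(\<lambda>n. sqrt (\<integral>x. (f n x - g x)\<^sup>2 \<partial>M) * sqrt (\<integral>x. (\<phi> x)\<^sup>2 \<partial>M)) \<longlonglongrightarrow> 0"
    using tendsto_mult_right[OF tendsto_real_sqrt[OF lim], of "sqrt (\<integral>x. (\<phi> x)\<^sup>2 \<partial>M)"] by simp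
qed

text \<open>The L2 limits of the derivatives are weak derivatives of u because pairings with test
  functions pass to the limit. For the fractional part the L2 limit of the difference quotients has
  to be recognized as a difference quotient.\<close>

lemma sobolev_limit:
  fixes \<Omega> :: "(real^'m) set" and Y :: "nat \<Rightarrow> real^'m \<Rightarrow> real"
  assumes \<Omega>: "open \<Omega>" "bounded \<Omega>" and Y: "\<And>n. Y n \<in> sobolev s \<Omega>"
    and cau: "\<And>e. e > 0 \<Longrightarrow> \<exists>N. \<forall>n\<ge>N. \<forall>m\<ge>N. (sobolev_norm s \<Omega> (\<lambda>t. 1 * Y n t + (- 1) * Y m t))\<^sup>2 \<le> e"
    and unif: "\<And>e. e > 0 \<Longrightarrow> \<exists>N. \<forall>n\<ge>N. \<forall>t\<in>\<Omega>. \<bar>Y n t - u t\<bar> \<le> e"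
  shows "u \<in> sobolev s \<Omega>" "(\<lambda>n. sobolev_norm s \<Omega> (\<lambda>t. 1 * Y n t + (- 1) * u t)) \<longlonglongrightarrow> 0"
proof -
  let ?M = "lebesgue_on \<Omega>" and ?k = "nat \<lfloor>s\<rfloor>" and ?r = "frac s"
  let ?P = "?M \<Otimes>\<^sub>M ?M" and ?q = "difference_quotient (frac s)"
  have lm: "\<Omega> \<in> lmeasurable" and \<Omega>L: "\<Omega> \<in> sets lebesgue" using \<Omega> by (auto simp: lmeasurable_open)
  interpret fM: finite_measure ?M by (rule finite_measure_lebesgue_on[OF lm])
  note fin = fM.finite_measure_axioms
  have finP: "finite_measure ?P" by (rule finite_measure_pair_measure[OF fin fin])
  define v where "v n = (\<lambda>\<alpha>. weak_deriv \<Omega> \<alpha> (Y n))" for n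
  have v: "sobolev_data s \<Omega> (Y n) (v n)" for n unfolding v_def by (rule sobolev_imp_data[OF \<Omega> Y])
  have vd: "sobolev_data s \<Omega> (\<lambda>t. 1 * Y n t + (- 1) * Y m t) (\<lambda>\<alpha> t. 1 * v n \<alpha> t + (- 1) * v m \<alpha> t)" for n m
    by (rule sobolev_data_lincomb(1)[OF \<Omega>(1) v v])
  have sqv: "square_integrable ?M (v n \<alpha>)" "is_weak_deriv \<Omega> \<alpha> (Y n) (v n \<alpha>)" if "multi_order \<alpha> \<le> ?k" for n \<alpha>
    using v that by (auto simp: sobolev_data_def)
  have nrm: "data_inner s \<Omega> (\<lambda>\<alpha> t. 1 * v n \<alpha> t + (- 1) * v m \<alpha> t) (\<lambda>\<alpha> t. 1 * v n \<alpha> t + (- 1) * v m \<alpha> t) =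
      (sobolev_norm s \<Omega> (\<lambda>t. 1 * Y n t + (- 1) * Y m t))\<^sup>2" for n m
    unfolding sobolev_data_imp(2)[OF \<Omega> vd] by (simp only: real_sqrt_pow2[OF data_inner_nonneg])
  have cauv: "\<exists>N. \<forall>n\<ge>N. \<forall>m\<ge>N. (\<integral>t. (v n \<alpha> t - v m \<alpha> t)\<^sup>2 \<partial>?M) \<le> e" if "multi_order \<alpha> \<le> ?k" "e > 0" for \<alpha> e
  proof -
    have "(\<integral>t. (v n \<alpha> t - v m \<alpha> t)\<^sup>2 \<partial>?M) \<le> (sobolev_norm s \<Omega> (\<lambda>t. 1 * Y n t + (- 1) * Y m t))\<^sup>2" for n m
      using square_integral_le_data_inner[OF that(1), of \<Omega> "\<lambda>\<alpha> t. 1 * v n \<alpha> t + (- 1) * v m \<alpha> t"]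
      unfolding nrm by simp
    then show ?thesis using cau[OF that(2)] by (meson order_trans)
  qed
  have "\<forall>\<alpha>. \<exists>f. multi_order \<alpha> \<le> ?k \<longrightarrow> square_integrable ?M f \<and> (\<lambda>n. \<integral>t. (v n \<alpha> t - f t)\<^sup>2 \<partial>?M) \<longlonglongrightarrow> 0"
    using square_integrable_complete[OF fin sqv(1) cauv] by blast
  then obtain f where "\<forall>\<alpha>. multi_order \<alpha> \<le> ?k \<longrightarrow> square_integrable ?M (f \<alpha>) \<and> (\<lambda>n. \<integral>t. (v n \<alpha> t - f \<alpha> t)\<^sup>2 \<partial>?M) \<longlonglongrightarrow> 0"
    unfolding choice_iff by blast
  then have f: "square_integrable ?M (f \<alpha>)" "(\<lambda>n. \<integral>t. (v n \<alpha> t - f \<alpha> t)\<^sup>2 \<partial>?M) \<longlonglongrightarrow> 0" if "multi_order \<alpha> \<le> ?k" for \<alpha>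
    using that by auto
  have Ysq: "square_integrable ?M (Y n)" for n by (rule sobolev_data_0(1)[OF \<Omega> v])
  have um: "u \<in> borel_measurable ?M"
  proof (rule borel_measurable_LIMSEQ_real)
    show "Y n \<in> borel_measurable ?M" for n by (rule square_integrableD[OF Ysq])
    fix t assume "t \<in> space ?M"
    then have "t \<in> \<Omega>" by simp
    show "(\<lambda>n. Y n t) \<longlonglongrightarrow> u t"
    proof (rule LIMSEQ_I)
      fix e :: real assume "e > 0"
      then obtain N where "\<forall>n\<ge>N. \<forall>t\<in>\<Omega>. \<bar>Y n t - u t\<bar> \<le> e / 2" using unif[of "e / 2"] by auto
      then have "\<forall>n\<ge>N. norm (Y n t - u t) < e" using \<open>t \<in> \<Omega>\<close> \<open>e > 0\<close> by fastforce
      then show "\<exists>N. \<forall>n\<ge>N. norm (Y n t - u t) < e" by blast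
    qed
  qed
  have dsq: "square_integrable ?M (\<lambda>t. Y n t - u t)" if "\<forall>t\<in>\<Omega>. \<bar>Y n t - u t\<bar> \<le> e" for n e
    by (rule square_integrable_bounded[OF fin, of _ e]) (use that um square_integrableD(1)[OF Ysq] in auto)
  have usq: "square_integrable ?M u"
  proof -
    obtain N where N: "\<forall>t\<in>\<Omega>. \<bar>Y N t - u t\<bar> \<le> 1" using unif[of 1] by auto
    from square_integrable_lincomb[OF Ysq dsq[OF N], of 1 N "-1"] show ?thesis by simp
  qed
  have Yu: "(\<lambda>n. \<integral>t. (Y n t - u t)\<^sup>2 \<partial>?M) \<longlonglongrightarrow> 0"
  proof (rule LIMSEQ_I)
    fix e :: real assume e: "e > 0"
    define c where "c = e / (2 * (measure ?M \<Omega> + 1))"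
    have c: "c > 0" using e by (simp add: c_def add_nonneg_pos)
    obtain N where N: "\<forall>n\<ge>N. \<forall>t\<in>\<Omega>. \<bar>Y n t - u t\<bar> \<le> sqrt c" using unif[of "sqrt c"] c by auto
    have "norm ((\<integral>t. (Y n t - u t)\<^sup>2 \<partial>?M) - 0) < e" if "n \<ge> N" for n
    proof -
      have le: "(Y n t - u t)\<^sup>2 \<le> c" if "t \<in> \<Omega>" for t
      proof -
        have "\<bar>Y n t - u t\<bar>\<^sup>2 \<le> (sqrt c)\<^sup>2" using N \<open>n \<ge> N\<close> that by (intro power_mono) auto
        then show ?thesis using c by simp
      qed
      have "(\<integral>t. (Y n t - u t)\<^sup>2 \<partial>?M) \<le> (\<integral>t. c \<partial>?M)"
        using dsq[of n "sqrt c"] N that le by (intro integral_mono) (auto dest: square_integrableD)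
      also have "\<dots> = measure ?M \<Omega> * c" by simp
      also have "\<dots> \<le> (measure ?M \<Omega> + 1) * c" using c by (intro mult_right_mono) auto
      also have "\<dots> = e / 2"
      proof -
        have "measure ?M \<Omega> + 1 \<noteq> 0" using measure_nonneg[of ?M \<Omega>] by linarith
        moreover have "z * (e / (2 * z)) = e / 2" if "z \<noteq> 0" for z :: real using that by simp
        ultimately show ?thesis by (simp only: c_def)
      qed
      finally show ?thesis using e by simp
    qed
    then show "\<exists>N. \<forall>n\<ge>N. norm ((\<integral>t. (Y n t - u t)\<^sup>2 \<partial>?M) - 0) < e" by blast
  qed
  have loc: "locally_integrable \<Omega> g" if "square_integrable ?M g" for g
    unfolding locally_integrable_def
  proof (intro allI impI)
    fix K assume K: "compact K \<and> K \<subseteq> \<Omega>"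
    have "integrable lebesgue (\<lambda>x. indicator \<Omega> x *\<^sub>R g x)"
      using square_integrable_integrable[OF fin that] \<Omega>L by (simp add: integrable_restrict_space)
    from integrable_mult_indicator[OF _ this, of K] K
    have "integrable lebesgue (\<lambda>x. indicator K x *\<^sub>R (indicator \<Omega> x *\<^sub>R g x))"
      by (auto intro: lmeasurable_compact fmeasurableD)
    moreover have "(\<lambda>x. indicator K x *\<^sub>R (indicator \<Omega> x *\<^sub>R g x)) = (\<lambda>x. indicator K x *\<^sub>R g x)"
      using K by (auto simp: indicator_def fun_eq_iff)
    ultimately show "set_integrable lebesgue K g" by (simp add: set_integrable_def)
  qed
  have wd: "is_weak_deriv \<Omega> \<alpha> u (f \<alpha>)" if \<alpha>: "multi_order \<alpha> \<le> ?k" for \<alpha>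
  proof -
    have "(\<integral>t. u t * multi_partial \<alpha> \<phi> t \<partial>?M) = (-1) ^ multi_order \<alpha> * (\<integral>t. f \<alpha> t * \<phi> t \<partial>?M)"
      if \<phi>: "\<phi> \<in> test_functions \<Omega>" for \<phi>
    proof (rule LIMSEQ_unique)
      have tsq: "square_integrable ?M \<psi>" if \<psi>: "\<psi> \<in> test_functions \<Omega>" for \<psi>
      proof -
        obtain B where "\<forall>x. \<bar>\<psi> x\<bar> \<le> B" using test_function_bounded[OF \<psi>] by blast
        then show ?thesis
          by (intro square_integrable_bounded[OF fin, of _ B] continuous_measurable_lebesgue_on test_function_continuous[OF \<psi>]) simp
      qed
      show "(\<lambda>n. \<integral>t. Y n t * multi_partial \<alpha> \<phi> t \<partial>?M) \<longlonglongrightarrow> (\<integral>t. u t * multi_partial \<alpha> \<phi> t \<partial>?M)"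
        by (rule L2_limit_integral_mult[OF Ysq usq tsq[OF multi_partial_test_function[OF \<phi>]] Yu])
      have "(\<lambda>n. (-1) ^ multi_order \<alpha> * (\<integral>t. v n \<alpha> t * \<phi> t \<partial>?M)) \<longlonglongrightarrow> (-1) ^ multi_order \<alpha> * (\<integral>t. f \<alpha> t * \<phi> t \<partial>?M)"
        by (intro tendsto_mult_left L2_limit_integral_mult[OF sqv(1)[OF \<alpha>] f(1)[OF \<alpha>] tsq[OF \<phi>] f(2)[OF \<alpha>]])
      moreover have "(\<integral>t. Y n t * multi_partial \<alpha> \<phi> t \<partial>?M) = (-1) ^ multi_order \<alpha> * (\<integral>t. v n \<alpha> t * \<phi> t \<partial>?M)" for n
        using sqv(2)[OF \<alpha>, of n] \<phi> by (simp add: is_weak_deriv_def)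
      ultimately show "(\<lambda>n. \<integral>t. Y n t * multi_partial \<alpha> \<phi> t \<partial>?M) \<longlonglongrightarrow> (-1) ^ multi_order \<alpha> * (\<integral>t. f \<alpha> t * \<phi> t \<partial>?M)"
        by simp
    qed
    then show ?thesis using loc[OF usq] loc[OF f(1)[OF \<alpha>]] by (simp add: is_weak_deriv_def)
  qed
  have dq: "square_integrable ?P (?q (f \<alpha>)) \<and> (\<lambda>n. \<integral>p. (?q (v n \<alpha>) p - ?q (f \<alpha>) p)\<^sup>2 \<partial>?P) \<longlonglongrightarrow> 0"
    if r: "0 < ?r" and \<alpha>: "multi_order \<alpha> = ?k" for \<alpha>
  proof -
    have \<alpha>': "multi_order \<alpha> \<le> ?k" using \<alpha> by simp
    have qv: "square_integrable ?P (?q (v n \<alpha>))" for n using v r \<alpha> by (auto simp: sobolev_data_def)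
    have eq: "gagliardo_kernel ?r (\<lambda>t. 1 * v n \<alpha> t + (- 1) * v m \<alpha> t) = (\<lambda>p. (?q (v n \<alpha>) p - ?q (v m \<alpha>) p)\<^sup>2)" for n m
      unfolding gagliardo_kernel_square difference_quotient_lincomb by simp
    have qle: "(\<integral>p. (?q (v n \<alpha>) p - ?q (v m \<alpha>) p)\<^sup>2 \<partial>?P) \<le> (sobolev_norm s \<Omega> (\<lambda>t. 1 * Y n t + (- 1) * Y m t))\<^sup>2" for n m
      using gagliardo_integral_le_data_inner[OF \<alpha> r, of \<Omega> "\<lambda>\<alpha> t. 1 * v n \<alpha> t + (- 1) * v m \<alpha> t"]
      unfolding nrm eq .
    have "\<exists>N. \<forall>n\<ge>N. \<forall>m\<ge>N. (\<integral>p. (?q (v n \<alpha>) p - ?q (v m \<alpha>) p)\<^sup>2 \<partial>?P) \<le> e" if "e > 0" for e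
      using cau[OF that] qle by (meson order_trans)
    from square_integrable_complete[OF finP qv this]
    obtain g where g: "square_integrable ?P g" "(\<lambda>n. \<integral>p. (?q (v n \<alpha>) p - g p)\<^sup>2 \<partial>?P) \<longlonglongrightarrow> 0" by blast
    from L2_limit_AE_subseq[OF sqv(1)[OF \<alpha>'] f(1)[OF \<alpha>'] f(2)[OF \<alpha>']]
    obtain r1 where r1: "strict_mono r1" "AE t in ?M. (\<lambda>n. v (r1 n) \<alpha> t) \<longlonglongrightarrow> f \<alpha> t" by blast
    \<comment> \<open>A second subsequence inside the first makes functions and difference quotients
      converge almost everywhere together, which identifies g.\<close>
    have "(\<lambda>n. \<integral>p. (?q (v (r1 n) \<alpha>) p - g p)\<^sup>2 \<partial>?P) \<longlonglongrightarrow> 0"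
      using LIMSEQ_subseq_LIMSEQ[OF g(2) r1(1)] by (simp add: comp_def)
    from L2_limit_AE_subseq[OF qv g(1) this]
    obtain r2 where r2: "strict_mono r2" "AE p in ?P. (\<lambda>n. ?q (v (r1 (r2 n)) \<alpha>) p) \<longlonglongrightarrow> g p" by blast
    have AEt: "AE t in ?M. (\<lambda>n. v (r1 (r2 n)) \<alpha> t) \<longlonglongrightarrow> f \<alpha> t"
      using r1(2) by eventually_elim (use r2(1) LIMSEQ_subseq_LIMSEQ in \<open>force simp: comp_def\<close>)
    have vm [measurable]: "v n \<alpha> \<in> borel_measurable ?M" for n by (rule square_integrableD[OF sqv(1)[OF \<alpha>']])
    have fm [measurable]: "f \<alpha> \<in> borel_measurable ?M" by (rule square_integrableD[OF f(1)[OF \<alpha>']])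
    from AE_pair_both[OF fM.sigma_finite_measure_axioms AEt] r2(2)
    have gq: "AE p in ?P. g p = ?q (f \<alpha>) p"
    proof eventually_elim
      case (elim p)
      then have "(\<lambda>n. ?q (v (r1 (r2 n)) \<alpha>) p) \<longlonglongrightarrow> ?q (f \<alpha>) p"
        unfolding difference_quotient_def case_prod_beta divide_inverse by (intro tendsto_mult_right tendsto_diff) auto
      then show ?case using elim LIMSEQ_unique by blast
    qed
    have "(\<integral>p. (?q (v n \<alpha>) p - ?q (f \<alpha>) p)\<^sup>2 \<partial>?P) = (\<integral>p. (?q (v n \<alpha>) p - g p)\<^sup>2 \<partial>?P)" for n
      using square_integrableD(1)[OF g(1)] gq by (intro integral_cong_AE) (auto elim: eventually_mono)
    then show ?thesis
      using g(2) square_integrable_AE_cong(1)[OF g(1) difference_quotient_measurable[OF fm] gq] by simp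
  qed
  have fd: "sobolev_data s \<Omega> u f"
    using wd f(1) dq by (simp add: sobolev_data_def)
  show "u \<in> sobolev s \<Omega>" by (rule sobolev_data_imp(1)[OF \<Omega> fd])
  have "(\<lambda>n. data_inner s \<Omega> (\<lambda>\<alpha> t. 1 * v n \<alpha> t + (- 1) * f \<alpha> t) (\<lambda>\<alpha> t. 1 * v n \<alpha> t + (- 1) * f \<alpha> t)) \<longlonglongrightarrow> 0"
  proof -
    have 1: "(\<lambda>n. \<Sum>\<alpha> | multi_order \<alpha> \<le> ?k. \<integral>t. (1 * v n \<alpha> t + (- 1) * f \<alpha> t)\<^sup>2 \<partial>?M) \<longlonglongrightarrow> 0"
      using f(2) by (intro tendsto_null_sum) simp
    have 2: "(\<lambda>n. \<Sum>\<alpha> | multi_order \<alpha> = ?k. integral\<^sup>L ?P (gagliardo_kernel ?r (\<lambda>t. 1 * v n \<alpha> t + (- 1) * f \<alpha> t))) \<longlonglongrightarrow> 0" if "0 < ?r"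
      unfolding gagliardo_kernel_square difference_quotient_lincomb
      using dq[OF that] by (intro tendsto_null_sum) simp
    show ?thesis
      unfolding data_inner_self using tendsto_add[OF 1 2] 1 by (cases "0 < ?r") simp_all
  qed
  then have "(\<lambda>n. sqrt (data_inner s \<Omega> (\<lambda>\<alpha> t. 1 * v n \<alpha> t + (- 1) * f \<alpha> t) (\<lambda>\<alpha> t. 1 * v n \<alpha> t + (- 1) * f \<alpha> t))) \<longlonglongrightarrow> sqrt 0"
    by (rule tendsto_real_sqrt)
  then show "(\<lambda>n. sobolev_norm s \<Omega> (\<lambda>t. 1 * Y n t + (- 1) * u t)) \<longlonglongrightarrow> 0"
    unfolding sobolev_data_imp(2)[OF \<Omega> sobolev_data_lincomb(1)[OF \<Omega>(1) v fd]] by simp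
qed

section \<open>Weak limits of bounded uniformly convergent sequences\<close>

text \<open>Midpoints are the only convex combinations that the parallelogram law uses, and every
  property stable under averaging two functions extends to the hull by induction.\<close>

inductive_set midpoint_hull :: "('a \<Rightarrow> real) set \<Rightarrow> ('a \<Rightarrow> real) set" for S where
  base: "f \<in> S \<Longrightarrow> f \<in> midpoint_hull S"
| mid: "f \<in> midpoint_hull S \<Longrightarrow> g \<in> midpoint_hull S \<Longrightarrow> (\<lambda>t. (1 / 2) * f t + (1 / 2) * g t) \<in> midpoint_hull S"

lemma midpoint_hull_mono: "S \<subseteq> T \<Longrightarrow> midpoint_hull S \<subseteq> midpoint_hull T"
proof
  fix f assume "S \<subseteq> T" "f \<in> midpoint_hull S"
  from this(2,1) show "f \<in> midpoint_hull T"
    by induction (blast intro: midpoint_hull.base, rule midpoint_hull.mid)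
qed

text \<open>Elements of almost minimal norm in the hulls of the tails form a Cauchy sequence, by the
  parallelogram law.\<close>

lemma sobolev_midpoints_Cauchy:
  fixes \<Omega> :: "(real^'m) set" and X :: "nat \<Rightarrow> real^'m \<Rightarrow> real"
  assumes \<Omega>: "open \<Omega>" "bounded \<Omega>" and X: "\<And>n. X n \<in> sobolev s \<Omega>" and B: "\<And>n. sobolev_norm s \<Omega> (X n) \<le> B"
  shows "\<exists>Y. (\<forall>n. Y n \<in> midpoint_hull (X ` {n..})) \<and> (\<forall>n. Y n \<in> sobolev s \<Omega>) \<and>
    (\<forall>e>0. \<exists>N. \<forall>n\<ge>N. \<forall>m\<ge>N. (sobolev_norm s \<Omega> (\<lambda>t. 1 * Y n t + (- 1) * Y m t))\<^sup>2 \<le> e)"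
proof -
  let ?N2 = "\<lambda>f. (sobolev_norm s \<Omega> f)\<^sup>2"
  define C where "C n = midpoint_hull (X ` {n..})" for n
  have Csob: "f \<in> sobolev s \<Omega>" if "f \<in> C n" for f n
    using that unfolding C_def
  proof induction
    case (mid f g)
    then show ?case using sobolev_norm_quadratic[OF \<Omega>, of f s g] by blast
  qed (use X in auto)
  have Cne: "X n \<in> C n" for n unfolding C_def by (rule midpoint_hull.base) auto
  have Cmono: "C m \<subseteq> C n" if "n \<le> m" for n m
    unfolding C_def using that by (intro midpoint_hull_mono) auto
  \<comment> \<open>Squared distance of the hulls from 0. It increases as the hulls shrink and stays
    below B^2, so it converges.\<close>
  define d where "d n = Inf (?N2 ` C n)" for n
  have bdd: "bdd_below (?N2 ` C n)" for n by (rule bdd_belowI[of _ 0]) auto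
  have d_le: "d n \<le> ?N2 f" if "f \<in> C n" for n f
    unfolding d_def by (rule cInf_lower[OF _ bdd]) (use that in auto)
  have "incseq d"
  proof (rule incseq_SucI)
    fix n
    have "?N2 ` C (Suc n) \<subseteq> ?N2 ` C n" "?N2 ` C (Suc n) \<noteq> {}"
      using Cmono[of n "Suc n"] Cne[of "Suc n"] by auto
    then show "d n \<le> d (Suc n)" unfolding d_def by (intro cInf_superset_mono bdd)
  qed
  moreover have "d n \<le> B\<^sup>2" for n
  proof -
    have "0 \<le> sobolev_norm s \<Omega> (X n)"
      unfolding sobolev_data_imp(2)[OF \<Omega> sobolev_imp_data[OF \<Omega> X]] by (simp add: data_inner_nonneg)
    then have "?N2 (X n) \<le> B\<^sup>2" by (intro power_mono B)
    then show ?thesis using d_le[OF Cne] by (rule order_trans[rotated])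
  qed
  ultimately obtain L where "d \<longlonglongrightarrow> L" using incseq_convergent[of d "B\<^sup>2"] by blast
  then have "Cauchy d" by (rule LIMSEQ_imp_Cauchy)
  have "\<exists>f\<in>C n. ?N2 f < d n + 1 / real (Suc n)" for n
  proof -
    have "Inf (?N2 ` C n) < d n + 1 / real (Suc n)" by (simp add: d_def)
    from cInf_lessD[OF _ this] Cne show ?thesis by blast
  qed
  then obtain Y where Y: "\<And>n. Y n \<in> C n" "\<And>n. ?N2 (Y n) < d n + 1 / real (Suc n)" by metis
  have key: "?N2 (\<lambda>t. 1 * Y n t + (- 1) * Y m t) \<le> 2 * (d m - d n) + 2 / real (Suc n) + 2 / real (Suc m)"
    if "n \<le> m" for n m
  proof -
    obtain P where P: "\<And>a b. ?N2 (\<lambda>t. a * Y n t + b * Y m t) = a\<^sup>2 * ?N2 (Y n) + 2 * a * b * P + b\<^sup>2 * ?N2 (Y m)"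
      using sobolev_norm_quadratic[OF \<Omega> Csob[OF Y(1)] Csob[OF Y(1)]] by blast
    \<comment> \<open>For n \<le> m both functions lie in the larger hull \<open>C n\<close>; the
      lower bound \<open>d n\<close> for their midpoint turns the parallelogram law into an upper
      bound for their difference.\<close>
    have "(\<lambda>t. (1 / 2) * Y n t + (1 / 2) * Y m t) \<in> C n"
      using Y(1)[of n] Y(1)[of m] Cmono[OF that] unfolding C_def by (blast intro: midpoint_hull.mid)
    from d_le[OF this] have "4 * d n \<le> ?N2 (Y n) + 2 * P + ?N2 (Y m)"
      unfolding P by (simp add: power2_eq_square)
    moreover have "?N2 (\<lambda>t. 1 * Y n t + (- 1) * Y m t) = ?N2 (Y n) - 2 * P + ?N2 (Y m)"
      unfolding P by simp
    ultimately have "?N2 (\<lambda>t. 1 * Y n t + (- 1) * Y m t) \<le> 2 * ?N2 (Y n) + 2 * ?N2 (Y m) - 4 * d n" by linarith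
    also have "\<dots> \<le> 2 * (d n + 1 / real (Suc n)) + 2 * (d m + 1 / real (Suc m)) - 4 * d n"
      by (intro diff_right_mono add_mono mult_left_mono less_imp_le[OF Y(2)]) simp_all
    finally show ?thesis by (simp add: algebra_simps)
  qed
  have sym: "?N2 (\<lambda>t. 1 * Y n t + (- 1) * Y m t) = ?N2 (\<lambda>t. 1 * Y m t + (- 1) * Y n t)" for n m
  proof -
    obtain P where P: "\<And>a b. ?N2 (\<lambda>t. a * Y n t + b * Y m t) = a\<^sup>2 * ?N2 (Y n) + 2 * a * b * P + b\<^sup>2 * ?N2 (Y m)"
      using sobolev_norm_quadratic[OF \<Omega> Csob[OF Y(1)] Csob[OF Y(1)]] by blast
    have "(\<lambda>t. 1 * Y m t + (- 1) * Y n t) = (\<lambda>t. (- 1) * Y n t + 1 * Y m t)" by auto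
    then show ?thesis unfolding P by (simp only: P) simp
  qed
  have "\<exists>N. \<forall>n\<ge>N. \<forall>m\<ge>N. ?N2 (\<lambda>t. 1 * Y n t + (- 1) * Y m t) \<le> e" if e: "e > 0" for e
  proof -
    \<comment> \<open>The budget is 2 * (e / 6) + e / 3 + e / 3 = e.\<close>
    obtain N1 where N1: "\<And>n m. n \<ge> N1 \<Longrightarrow> m \<ge> N1 \<Longrightarrow> \<bar>d m - d n\<bar> < e / 6"
      using \<open>Cauchy d\<close>[unfolded Cauchy_def, rule_format, of "e / 6"] e by (auto simp: dist_real_def)
    obtain N2 :: nat where N2: "6 / e < real N2" using reals_Archimedean2 by blast
    have sm: "2 / real (Suc n) \<le> e / 3" if "n \<ge> N2" for n
    proof -
      have "6 / e \<le> real (Suc n)" using N2 that by linarith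
      then show ?thesis using e by (simp add: field_simps)
    qed
    have le: "?N2 (\<lambda>t. 1 * Y n t + (- 1) * Y m t) \<le> e" if "n \<le> m" "n \<ge> max N1 N2" for n m
    proof -
      have "\<bar>d m - d n\<bar> < e / 6" "2 / real (Suc n) \<le> e / 3" "2 / real (Suc m) \<le> e / 3"
        using that by (intro N1 sm; simp)+
      then have "2 * (d m - d n) + 2 / real (Suc n) + 2 / real (Suc m) \<le> 2 * (e / 6) + e / 3 + e / 3"
      proof (intro add_mono)
        show "2 * (d m - d n) \<le> 2 * (e / 6)" using order_le_less_trans[OF abs_ge_self \<open>\<bar>d m - d n\<bar> < e / 6\<close>] by simp
      qed
      with key[OF that(1)] show ?thesis by simp
    qed
    have "?N2 (\<lambda>t. 1 * Y n t + (- 1) * Y m t) \<le> e" if "n \<ge> max N1 N2" "m \<ge> max N1 N2" for n m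
      using le[of n m] le[of m n] sym[of n m] that by (cases "n \<le> m") auto
    then show ?thesis by blast
  qed
  with Y(1) Csob show ?thesis unfolding C_def by blast
qed

lemma midpoint_hull_uniform:
  assumes "f \<in> midpoint_hull S" "\<And>g t. g \<in> S \<Longrightarrow> t \<in> \<Omega> \<Longrightarrow> \<bar>g t - u t\<bar> \<le> e" "t \<in> \<Omega>"
  shows "\<bar>f t - u t\<bar> \<le> (e::real)"
  using assms(1)
proof induction
  case (mid f g)
  then show ?case by (simp add: abs_le_iff)
qed (use assms in auto)

text \<open>Bounds on the distance to u survive midpoints, so sequences from the hulls of the tails
  also tend to u uniformly. This identifies the limit of the norm-Cauchy sequence.\<close>

lemma sobolev_uniform_limit_midpoints:
  fixes \<Omega> :: "(real^'m) set" and X :: "nat \<Rightarrow> real^'m \<Rightarrow> real"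
  assumes \<Omega>: "open \<Omega>" "bounded \<Omega>" and X: "\<And>n. X n \<in> sobolev s \<Omega>" and B: "\<And>n. sobolev_norm s \<Omega> (X n) \<le> B"
    and unif: "\<And>e. e > 0 \<Longrightarrow> \<exists>N. \<forall>n\<ge>N. \<forall>t\<in>\<Omega>. \<bar>X n t - u t\<bar> \<le> e"
  shows "u \<in> sobolev s \<Omega> \<and> (\<exists>Y. (\<forall>n. Y n \<in> midpoint_hull (range X) \<and> Y n \<in> sobolev s \<Omega>) \<and>
    (\<lambda>n. sobolev_norm s \<Omega> (\<lambda>t. 1 * Y n t + (- 1) * u t)) \<longlonglongrightarrow> 0)"
proof -
  obtain Y where Y: "\<And>n. Y n \<in> midpoint_hull (X ` {n..})" "\<And>n. Y n \<in> sobolev s \<Omega>"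
    "\<And>e. e > 0 \<Longrightarrow> \<exists>N. \<forall>n\<ge>N. \<forall>m\<ge>N. (sobolev_norm s \<Omega> (\<lambda>t. 1 * Y n t + (- 1) * Y m t))\<^sup>2 \<le> e"
    using sobolev_midpoints_Cauchy[where X=X, OF \<Omega> X B] by blast
  have u: "\<exists>N. \<forall>n\<ge>N. \<forall>t\<in>\<Omega>. \<bar>Y n t - u t\<bar> \<le> e" if e: "e > 0" for e
  proof -
    obtain N where N: "\<forall>n\<ge>N. \<forall>t\<in>\<Omega>. \<bar>X n t - u t\<bar> \<le> e" using unif[OF e] by blast
    have "\<bar>Y n t - u t\<bar> \<le> e" if "n \<ge> N" "t \<in> \<Omega>" for n t
      by (rule midpoint_hull_uniform[OF Y(1) _ that(2)]) (use N that in auto)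
    then show ?thesis by blast
  qed
  have "Y n \<in> midpoint_hull (range X)" for n
    using Y(1)[of n] midpoint_hull_mono[of "X ` {n..}" "range X"] by blast
  with sobolev_limit[OF \<Omega> Y(2,3) u] Y(2) show ?thesis by blast
qed

lemma sobolev_dual_lincomb:
  fixes \<Omega> :: "(real^'m) set"
  assumes \<Omega>: "open \<Omega>" "bounded \<Omega>" and l: "l \<in> sobolev_dual s \<Omega>" and "f \<in> sobolev s \<Omega>" "g \<in> sobolev s \<Omega>"
  shows "l (\<lambda>t. a * f t + b * g t) = a * l f + b * l g"
proof -
  have sc: "(\<lambda>t. c * h t) \<in> sobolev s \<Omega>" if "h \<in> sobolev s \<Omega>" for c h
    using sobolev_norm_quadratic[OF \<Omega> that that] by (metis (no_types, lifting) add.right_neutral mult_zero_left ext)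
  have "l (\<lambda>t. a * f t + b * g t) = l (\<lambda>t. a * f t) + l (\<lambda>t. b * g t)"
    using l sc[OF assms(4)] sc[OF assms(5)] by (simp add: sobolev_dual_def)
  then show ?thesis using l assms(4,5) by (simp add: sobolev_dual_def)
qed

text \<open>If the values l (X k) stayed at distance e on one side of l u for infinitely many k, so
  would the values at all midpoint combinations of this subsequence; yet some of these converge to u
  in norm.\<close>

lemma bounded_uniform_limit_sobolev_weak_lim:
  fixes \<Omega> :: "(real^'m) set" and X :: "nat \<Rightarrow> real^'m \<Rightarrow> real"
  assumes \<Omega>: "open \<Omega>" "bounded \<Omega>" and X: "\<And>n. X n \<in> sobolev s \<Omega>" and B: "\<And>n. sobolev_norm s \<Omega> (X n) \<le> B"
    and unif: "\<And>e. e > 0 \<Longrightarrow> \<exists>N. \<forall>n\<ge>N. \<forall>t\<in>\<Omega>. \<bar>X n t - u t\<bar> \<le> e"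
  shows "u \<in> sobolev s \<Omega>" "sobolev_weak_lim s \<Omega> X u"
proof -
  show u: "u \<in> sobolev s \<Omega>"
    using sobolev_uniform_limit_midpoints[where X=X and u=u, OF \<Omega> X B unif] by blast
  show "sobolev_weak_lim s \<Omega> X u"
    unfolding sobolev_weak_lim_def
  proof
    fix l assume l: "l \<in> sobolev_dual s \<Omega>"
    obtain K where K: "\<And>f. f \<in> sobolev s \<Omega> \<Longrightarrow> \<bar>l f\<bar> \<le> K * sobolev_norm s \<Omega> f"
      using l unfolding sobolev_dual_def by blast
    \<comment> \<open>Used with c = 1 and c = - 1. The sides are treated separately because a lower
      bound on \<bar>l f - l u\<bar> would not survive midpoints.\<close>
    have no: "finite {k. e \<le> c * (l (X k) - l u)}" if e: "e > 0" for e c :: real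
    proof (rule ccontr)
      assume inf: "infinite {k. e \<le> c * (l (X k) - l u)}"
      obtain r :: "nat \<Rightarrow> nat" where r: "strict_mono r" "\<And>n. r n \<in> {k. e \<le> c * (l (X k) - l u)}"
        using infinite_enumerate[OF inf] by blast
      have "\<exists>N. \<forall>n\<ge>N. \<forall>t\<in>\<Omega>. \<bar>X (r n) t - u t\<bar> \<le> e" if "e > 0" for e
        using unif[OF that] seq_suble[OF r(1)] by (meson le_trans)
      then obtain Y where Y: "\<And>n. Y n \<in> midpoint_hull (range (\<lambda>n. X (r n)))" "\<And>n. Y n \<in> sobolev s \<Omega>"
        "(\<lambda>n. sobolev_norm s \<Omega> (\<lambda>t. 1 * Y n t + (- 1) * u t)) \<longlonglongrightarrow> 0"
        using sobolev_uniform_limit_midpoints[where X="\<lambda>n. X (r n)" and u=u and s=s and B=B, OF \<Omega> X B] by blast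
      have "f \<in> sobolev s \<Omega> \<and> e \<le> c * (l f - l u)" if "f \<in> midpoint_hull (range (\<lambda>n. X (r n)))" for f
        using that
      proof induction
        case (mid f g)
        have "c * (l (\<lambda>t. (1 / 2) * f t + (1 / 2) * g t) - l u) = (1 / 2) * (c * (l f - l u)) + (1 / 2) * (c * (l g - l u))"
          using mid sobolev_dual_lincomb[OF \<Omega> l, of f g "1 / 2" "1 / 2"] by (simp add: algebra_simps)
        moreover have "(\<lambda>t. (1 / 2) * f t + (1 / 2) * g t) \<in> sobolev s \<Omega>"
          using mid sobolev_norm_quadratic[OF \<Omega>, of f s g] by blast
        ultimately show ?case using mid by simp
      qed (use X r(2) in auto)
      then have ge: "e \<le> c * (l (Y n) - l u)" for n using Y(1) by blast
      have "e \<le> \<bar>c\<bar> * (K * sobolev_norm s \<Omega> (\<lambda>t. 1 * Y n t + (- 1) * u t))" for n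
      proof -
        have "(\<lambda>t. 1 * Y n t + (- 1) * u t) \<in> sobolev s \<Omega>"
          using sobolev_norm_quadratic[OF \<Omega> Y(2) u] by blast
        from K[OF this] have "\<bar>l (Y n) - l u\<bar> \<le> K * sobolev_norm s \<Omega> (\<lambda>t. 1 * Y n t + (- 1) * u t)"
          using sobolev_dual_lincomb[OF \<Omega> l Y(2) u, of 1 n "-1"] by simp
        then have "\<bar>c\<bar> * \<bar>l (Y n) - l u\<bar> \<le> \<bar>c\<bar> * (K * sobolev_norm s \<Omega> (\<lambda>t. 1 * Y n t + (- 1) * u t))"
          by (rule mult_left_mono) simp
        moreover have "e \<le> \<bar>c\<bar> * \<bar>l (Y n) - l u\<bar>" using ge[of n] abs_ge_self[of "c * (l (Y n) - l u)"] by (simp add: abs_mult)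
        ultimately show ?thesis by linarith
      qed
      moreover have "(\<lambda>n. \<bar>c\<bar> * (K * sobolev_norm s \<Omega> (\<lambda>t. 1 * Y n t + (- 1) * u t))) \<longlonglongrightarrow> \<bar>c\<bar> * (K * 0)"
        by (intro tendsto_mult_left Y(3))
      ultimately have "e \<le> \<bar>c\<bar> * (K * 0)" by (intro LIMSEQ_le_const) auto
      then show False using e by simp
    qed
    show "(\<lambda>k. l (X k)) \<longlonglongrightarrow> l u"
    proof (rule LIMSEQ_I)
      fix e :: real assume e: "e > 0"
      have "finite ({k. e \<le> 1 * (l (X k) - l u)} \<union> {k. e \<le> (- 1) * (l (X k) - l u)})"
        using no[OF e] by blast
      then obtain N where N: "\<forall>k\<in>{k. e \<le> 1 * (l (X k) - l u)} \<union> {k. e \<le> (- 1) * (l (X k) - l u)}. k < N"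
        using finite_nat_set_iff_bounded by blast
      have "norm (l (X k) - l u) < e" if "k \<ge> N" for k
      proof (rule ccontr)
        assume "\<not> norm (l (X k) - l u) < e"
        then have "k \<in> {k. e \<le> 1 * (l (X k) - l u)} \<union> {k. e \<le> (- 1) * (l (X k) - l u)}"
          by (auto simp: abs_if split: if_splits)
        with N have "k < N" by (rule bspec)
        then show False using that by simp
      qed
      then show "\<exists>N. \<forall>k\<ge>N. norm (l (X k) - l u) < e" by blast
    qed
  qed
qed

section \<open>Compactness\<close>

lemma diagonal_convergent_subsequence:
  fixes a :: "nat \<Rightarrow> nat \<Rightarrow> real"
  assumes "\<And>i. bounded (range (a i))"
  shows "\<exists>r::nat \<Rightarrow> nat. strict_mono r \<and> (\<forall>i. convergent (\<lambda>n. a i (r n)))"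
proof -
  interpret subseqs "\<lambda>i s. convergent (\<lambda>n. a i (s n))"
  proof
    fix i and s :: "nat \<Rightarrow> nat" assume "strict_mono s"
    have "bounded (range (\<lambda>n. a i (s n)))" using assms[of i] by (rule bounded_subset) auto
    then obtain l r where "strict_mono r" "((\<lambda>n. a i (s n)) \<circ> r) \<longlonglongrightarrow> l"
      using bounded_imp_convergent_subsequence by blast
    then show "\<exists>r'. strict_mono r' \<and> convergent (\<lambda>n. a i ((s \<circ> r') n))"
      by (auto simp: comp_def intro: convergentI)
  qed
  have "convergent (\<lambda>n. a i (diagseq n))" for i
  proof -
    \<comment> \<open>Only from index i + 1 on is the diagonal sequence known to run inside the
      subsequence chosen for i.\<close>
    have "convergent (\<lambda>n. a i ((diagseq \<circ> (+) (Suc i)) n))"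
    proof (rule diagseq_holds)
      fix r s :: "nat \<Rightarrow> nat" and n assume "strict_mono r" "convergent (\<lambda>k. a n (s k))"
      then obtain l where l: "(\<lambda>k. a n (s k)) \<longlonglongrightarrow> l" by (auto simp: convergent_def)
      from LIMSEQ_subseq_LIMSEQ[OF this \<open>strict_mono r\<close>] show "convergent (\<lambda>k. a n ((s \<circ> r) k))"
        by (auto simp: comp_def intro: convergentI)
    qed
    then have "convergent (\<lambda>n. a i (diagseq (n + Suc i)))" by (simp add: add.commute)
    then show ?thesis using convergent_ignore_initial_segment[of "\<lambda>n. a i (diagseq n)" "Suc i"] by blast
  qed
  with subseq_diagseq show ?thesis by blast
qed

lemma continuous_square_integrable:
  fixes g :: "'a::euclidean_space \<Rightarrow> real"
  assumes c: "continuous_on UNIV g" and \<Omega>: "open \<Omega>" "bounded \<Omega>"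
  shows "square_integrable (lebesgue_on \<Omega>) g"
proof -
  have fin: "finite_measure (lebesgue_on \<Omega>)"
    using \<Omega> by (intro finite_measure_lebesgue_on) (simp add: lmeasurable_open)
  have "compact (g ` closure \<Omega>)"
    using \<Omega>(2) by (intro compact_continuous_image continuous_on_subset[OF c]) (auto simp: compact_eq_bounded_closed bounded_closure)
  then have "bounded (g ` closure \<Omega>)" by (rule compact_imp_bounded)
  then obtain C where "\<forall>x\<in>closure \<Omega>. \<bar>g x\<bar> \<le> C" unfolding bounded_iff by auto
  then show ?thesis
    using closure_subset[of \<Omega>] by (intro square_integrable_bounded[OF fin continuous_measurable_lebesgue_on[OF c], of C]) auto
qed

text \<open>The sup estimate is applied to differences, whose norms are at most 2 B, with tolerances
  1 / (j + 1). Only countably many integrals occur in all, each bounded along the sequence, so a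
  diagonal subsequence makes all of them converge.\<close>

lemma sobolev_precompact:
  fixes \<Omega> :: "(real^'m) set" and X :: "nat \<Rightarrow> real^'m \<Rightarrow> real"
  assumes \<Omega>: "open \<Omega>" "bounded \<Omega>" "cone_property \<Omega>" and s: "s > real CARD('m) / 2"
    and X: "\<And>n. X n \<in> sobolev s \<Omega>" "\<And>n. continuous_on \<Omega> (X n)" and B: "\<And>n. sobolev_norm s \<Omega> (X n) \<le> B"
  shows "\<exists>r::nat \<Rightarrow> nat. strict_mono r \<and> uniformly_convergent_on \<Omega> (\<lambda>n. X (r n))"
proof -
  let ?M = "lebesgue_on \<Omega>"
  have lm: "\<Omega> \<in> lmeasurable" using \<Omega> by (simp add: lmeasurable_open)
  interpret fM: finite_measure ?M by (rule finite_measure_lebesgue_on[OF lm])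
  have N0: "sobolev_norm s \<Omega> f \<ge> 0" if "f \<in> sobolev s \<Omega>" for f
    unfolding sobolev_data_imp(2)[OF \<Omega>(1,2) sobolev_imp_data[OF \<Omega>(1,2) that]] by (simp add: data_inner_nonneg)
  have B0: "B \<ge> 0" using N0[OF X(1)] B by (rule order_trans)
  have Xsq: "square_integrable ?M (X n)" for n
    by (rule sobolev_data_0(1)[OF \<Omega>(1,2) sobolev_imp_data[OF \<Omega>(1,2) X(1)]])
  have XB: "sqrt (\<integral>t. (X n t)\<^sup>2 \<partial>?M) \<le> B" for n
  proof -
    note d = sobolev_imp_data[OF \<Omega>(1,2) X(1)]
    have "sqrt (\<integral>t. (X n t)\<^sup>2 \<partial>?M) \<le> sobolev_norm s \<Omega> (X n)"
      unfolding sobolev_data_imp(2)[OF \<Omega>(1,2) d] by (rule real_sqrt_le_mono[OF sobolev_data_0(2)[OF \<Omega>(1,2) d]])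
    then show ?thesis using B by (rule order_trans)
  qed
  have diff: "(\<lambda>t. 1 * X n t + (- 1) * X m t) \<in> sobolev s \<Omega>"
    "sobolev_norm s \<Omega> (\<lambda>t. 1 * X n t + (- 1) * X m t) \<le> 2 * B" for n m
  proof -
    let ?N = "sobolev_norm s \<Omega>"
    obtain P where P: "\<And>a b. (\<lambda>t. a * X n t + b * X m t) \<in> sobolev s \<Omega>"
      "\<And>a b. (?N (\<lambda>t. a * X n t + b * X m t))\<^sup>2 = a\<^sup>2 * (?N (X n))\<^sup>2 + 2 * a * b * P + b\<^sup>2 * (?N (X m))\<^sup>2"
      using sobolev_norm_quadratic[OF \<Omega>(1,2) X(1) X(1)] by blast
    show "(\<lambda>t. 1 * X n t + (- 1) * X m t) \<in> sobolev s \<Omega>" by (rule P(1))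
    \<comment> \<open>Nonnegativity of the norm of the sum bounds the mixed term in the norm of the
      difference.\<close>
    have "0 \<le> (?N (\<lambda>t. 1 * X n t + 1 * X m t))\<^sup>2" by simp
    then have "- 2 * P \<le> (?N (X n))\<^sup>2 + (?N (X m))\<^sup>2" unfolding P(2) by simp
    then have "(?N (\<lambda>t. 1 * X n t + (- 1) * X m t))\<^sup>2 \<le> 2 * (?N (X n))\<^sup>2 + 2 * (?N (X m))\<^sup>2" unfolding P(2) by simp
    also have "\<dots> \<le> 2 * B\<^sup>2 + 2 * B\<^sup>2"
      by (intro add_mono mult_left_mono power_mono B N0[OF X(1)]) auto
    also have "\<dots> = (2 * B)\<^sup>2" by (simp add: power2_eq_square)
    finally show "?N (\<lambda>t. 1 * X n t + (- 1) * X m t) \<le> 2 * B"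
      by (rule power2_le_imp_le) (use B0 in simp)
  qed
  have "\<forall>j::nat. \<exists>G. finite G \<and> (\<forall>g\<in>G. continuous_on UNIV g) \<and> (\<forall>u\<in>sobolev s \<Omega>. continuous_on \<Omega> u \<longrightarrow>
    (\<forall>x\<in>\<Omega>. \<bar>u x\<bar> \<le> (\<Sum>g\<in>G. \<bar>\<integral>y. u y * g y \<partial>?M\<bar>) + 1 / real (Suc j) * sobolev_norm s \<Omega> u))"
    by (intro allI sobolev_sup_estimate[OF \<Omega> s]) simp
  then obtain G where G: "\<And>j. finite (G j)" "\<And>j g. g \<in> G j \<Longrightarrow> continuous_on UNIV g"
    "\<And>j u x. u \<in> sobolev s \<Omega> \<Longrightarrow> continuous_on \<Omega> u \<Longrightarrow> x \<in> \<Omega> \<Longrightarrow>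
      \<bar>u x\<bar> \<le> (\<Sum>g\<in>G j. \<bar>\<integral>y. u y * g y \<partial>?M\<bar>) + 1 / real (Suc j) * sobolev_norm s \<Omega> u"
    unfolding choice_iff by blast
  \<comment> \<open>The zero function ensures that the set is nonempty and can be enumerated by
    \<open>from_nat_into\<close>.\<close>
  define GG where "GG = insert (\<lambda>_. 0) (\<Union>j. G j)"
  have "countable GG" unfolding GG_def using G(1) by (auto intro: countable_finite)
  then have GGr: "range (from_nat_into GG) = GG" by (intro range_from_nat_into) (auto simp: GG_def)
  have gsq: "square_integrable ?M g" if "g \<in> GG" for g
  proof -
    have c: "continuous_on UNIV g" using that G(2) by (auto simp: GG_def)
    show ?thesis by (rule continuous_square_integrable[OF c \<Omega>(1,2)])
  qed
  have "bounded (range (\<lambda>n. \<integral>t. X n t * from_nat_into GG i t \<partial>?M))" for i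
  proof -
    have g: "square_integrable ?M (from_nat_into GG i)" using GGr by (intro gsq) auto
    have "\<bar>\<integral>t. X n t * from_nat_into GG i t \<partial>?M\<bar> \<le> B * sqrt (\<integral>t. (from_nat_into GG i t)\<^sup>2 \<partial>?M)" for n
      by (rule order_trans[OF Cauchy_Schwarz_integral[OF Xsq g]]) (intro mult_right_mono XB, simp)
    then show ?thesis unfolding bounded_iff by auto
  qed
  from diagonal_convergent_subsequence[of "\<lambda>i n. \<integral>t. X n t * from_nat_into GG i t \<partial>?M", OF this]
  obtain r :: "nat \<Rightarrow> nat" where r: "strict_mono r"
    "\<And>i. convergent (\<lambda>n. \<integral>t. X (r n) t * from_nat_into GG i t \<partial>?M)" by blast
  have conv: "Cauchy (\<lambda>n. \<integral>t. X (r n) t * g t \<partial>?M)" if "g \<in> GG" for g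
  proof -
    have "g \<in> range (from_nat_into GG)" using GGr that by simp
    then obtain i where "g = from_nat_into GG i" by blast
    then show ?thesis using r(2)[of i] by (simp add: Cauchy_convergent_iff)
  qed
  have "uniformly_Cauchy_on \<Omega> (\<lambda>n. X (r n))"
  proof (rule uniformly_Cauchy_onI)
    fix e :: real assume e: "e > 0"
    obtain j :: nat where "4 * B / e < real j" using reals_Archimedean2 by blast
    then have j: "4 * B / e < real (Suc j)" by simp
    have j': "1 / real (Suc j) * (2 * B) \<le> e / 2"
    proof -
      have "4 * B \<le> e * real (Suc j)" using j e by (simp add: pos_divide_less_eq mult.commute less_imp_le)
      then show ?thesis by (simp add: field_simps)
    qed
    \<comment> \<open>All integrals together may cost less than e / 2. The summand 1 makes the
      inequality strict and covers an empty \<open>G j\<close>.\<close>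
    define \<eta> where "\<eta> = e / (2 * (real (card (G j)) + 1))"
    have \<eta>: "\<eta> > 0" using e by (simp add: \<eta>_def add_nonneg_pos)
    have "\<exists>N. \<forall>n\<ge>N. \<forall>m\<ge>N. \<forall>g\<in>G j. \<bar>(\<integral>t. X (r n) t * g t \<partial>?M) - (\<integral>t. X (r m) t * g t \<partial>?M)\<bar> < \<eta>"
    proof -
      have "\<forall>g\<in>G j. \<exists>N. \<forall>n\<ge>N. \<forall>m\<ge>N. \<bar>(\<integral>t. X (r n) t * g t \<partial>?M) - (\<integral>t. X (r m) t * g t \<partial>?M)\<bar> < \<eta>"
        using conv \<eta> unfolding Cauchy_def dist_real_def GG_def by blast
      from bchoice[OF this] obtain N where N: "\<forall>g\<in>G j. \<forall>n\<ge>N g. \<forall>m\<ge>N g. \<bar>(\<integral>t. X (r n) t * g t \<partial>?M) - (\<integral>t. X (r m) t * g t \<partial>?M)\<bar> < \<eta>"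
        by blast
      have "N g \<le> (\<Sum>g\<in>G j. N g)" if "g \<in> G j" for g using G(1)[of j] that by (intro member_le_sum) auto
      then have "N g \<le> n" if "g \<in> G j" "(\<Sum>g\<in>G j. N g) \<le> n" for g n using that order_trans by blast
      then show ?thesis using N by (intro exI[of _ "\<Sum>g\<in>G j. N g"] allI impI ballI) simp
    qed
    then obtain N where N: "\<And>n m g. n \<ge> N \<Longrightarrow> m \<ge> N \<Longrightarrow> g \<in> G j \<Longrightarrow>
      \<bar>(\<integral>t. X (r n) t * g t \<partial>?M) - (\<integral>t. X (r m) t * g t \<partial>?M)\<bar> < \<eta>" by blast
    have "dist (X (r n) x) (X (r m) x) < e" if x: "x \<in> \<Omega>" and nm: "n \<ge> N" "m \<ge> N" for n m x
    proof -
      let ?u = "\<lambda>t. 1 * X (r n) t + (- 1) * X (r m) t"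
      have "\<bar>?u x\<bar> \<le> (\<Sum>g\<in>G j. \<bar>\<integral>y. ?u y * g y \<partial>?M\<bar>) + 1 / real (Suc j) * sobolev_norm s \<Omega> ?u"
        by (intro G(3) diff x continuous_intros X(2))
      also have "(\<Sum>g\<in>G j. \<bar>\<integral>y. ?u y * g y \<partial>?M\<bar>) \<le> (\<Sum>g\<in>G j. \<eta>)"
      proof (rule sum_mono)
        fix g assume g: "g \<in> G j"
        then have gs: "square_integrable ?M g" by (intro gsq) (auto simp: GG_def)
        have "(\<integral>y. ?u y * g y \<partial>?M) = (\<integral>t. X (r n) t * g t \<partial>?M) - (\<integral>t. X (r m) t * g t \<partial>?M)"
          using square_integrable_mult[OF Xsq gs] by (simp add: left_diff_distrib)
        then show "\<bar>\<integral>y. ?u y * g y \<partial>?M\<bar> \<le> \<eta>" using N[OF nm g] by simp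
      qed
      also have "(\<Sum>g\<in>G j. \<eta>) < e / 2"
      proof -
        have "real (card (G j)) * \<eta> < (real (card (G j)) + 1) * \<eta>" using \<eta> by simp
        also have "\<dots> = e / 2" unfolding \<eta>_def by (simp add: field_simps)
        finally show ?thesis by simp
      qed
      also have "1 / real (Suc j) * sobolev_norm s \<Omega> ?u \<le> 1 / real (Suc j) * (2 * B)"
        by (intro mult_left_mono diff(2)) simp
      also note j'
      finally show ?thesis by (simp add: dist_real_def)
    qed
    then show "\<exists>M. \<forall>x\<in>\<Omega>. \<forall>m\<ge>M. \<forall>n\<ge>M. dist (X (r m) x) (X (r n) x) < e" by blast
  qed
  then show ?thesis using r(1) Cauchy_uniformly_convergent by blast
qed

text \<open>The uniform limit is also the weak limit, so weak closedness provides a member of D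
  equal to it almost everywhere; the essential supremum ignores the null set.\<close>

lemma weakly_closed_sequentially_compact:
  fixes \<Omega> :: "(real^'m) set"
  assumes \<Omega>: "open \<Omega>" "bounded \<Omega>" "cone_property \<Omega>" and s: "s > real CARD('m) / 2"
    and cont: "\<forall>x\<in>D. continuous_on (closure \<Omega>) x"
    and bd: "sobolev_bounded s \<Omega> D" and cl: "sobolev_weakly_closed s \<Omega> D" and X: "\<And>n. X n \<in> D"
  shows "\<exists>(r::nat \<Rightarrow> nat) x. strict_mono r \<and> x \<in> D \<and>
    (\<forall>e>0. \<forall>\<^sub>F n in sequentially. Linf_norm \<Omega> (\<lambda>t. X (r n) t - x t) < ereal e)"
proof -
  obtain B where B: "D \<subseteq> sobolev s \<Omega>" "\<And>x. x \<in> D \<Longrightarrow> sobolev_norm s \<Omega> x \<le> B"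
    using bd unfolding sobolev_bounded_def by blast
  have contO: "continuous_on \<Omega> x" if "x \<in> D" for x
    using cont that continuous_on_subset closure_subset by blast
  obtain r :: "nat \<Rightarrow> nat" where r: "strict_mono r" "uniformly_convergent_on \<Omega> (\<lambda>n. X (r n))"
    using sobolev_precompact[where X=X, OF \<Omega> s _ contO[OF X] B(2)[OF X]] B(1) X by blast
  obtain u where u: "uniform_limit \<Omega> (\<lambda>n. X (r n)) u sequentially"
    using r(2) unfolding uniformly_convergent_on_def by blast
  have unif: "\<exists>N. \<forall>n\<ge>N. \<forall>t\<in>\<Omega>. \<bar>X (r n) t - u t\<bar> \<le> e" if "e > 0" for e
    using uniform_limitD[OF u that] unfolding eventually_sequentially dist_real_def by (meson less_imp_le)
  have Xs: "X (r n) \<in> sobolev s \<Omega>" "sobolev_norm s \<Omega> (X (r n)) \<le> B" for n using B X by auto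
  note w = bounded_uniform_limit_sobolev_weak_lim[where X="\<lambda>n. X (r n)" and u=u, OF \<Omega>(1,2) Xs unif]
  obtain x where x: "x \<in> D" "AE t in lebesgue_on \<Omega>. x t = u t"
    using cl[unfolded sobolev_weakly_closed_def, THEN conjunct2, rule_format, of "\<lambda>n. X (r n)" u] w X by blast
  have "\<forall>\<^sub>F n in sequentially. Linf_norm \<Omega> (\<lambda>t. X (r n) t - x t) < ereal e" if e: "e > 0" for e
  proof -
    obtain N where N: "\<forall>n\<ge>N. \<forall>t\<in>\<Omega>. \<bar>X (r n) t - u t\<bar> \<le> e / 2" using unif[of "e / 2"] e by auto
    have "Linf_norm \<Omega> (\<lambda>t. X (r n) t - x t) < ereal e" if n: "n \<ge> N" for n
    proof -
      have m: "y \<in> borel_measurable (lebesgue_on \<Omega>)" if "y \<in> D" for y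
        by (rule continuous_imp_measurable_on_sets_lebesgue[OF contO[OF that]]) (use \<Omega> in simp)
      have "AE t in lebesgue_on \<Omega>. ereal \<bar>X (r n) t - x t\<bar> \<le> ereal (e / 2)"
        using x(2) AE_space by eventually_elim (use N n in simp)
      then have "Linf_norm \<Omega> (\<lambda>t. X (r n) t - x t) \<le> ereal (e / 2)"
        unfolding Linf_norm_def using m[OF X] m[OF x(1)] by (intro esssup_I) auto
      also have "\<dots> < ereal e" using e by simp
      finally show ?thesis .
    qed
    then show ?thesis by (auto simp: eventually_sequentially)
  qed
  with r(1) x(1) show ?thesis by blast
qed

section \<open>Total boundedness of the image of the operator\<close>

lemma L2_norm_triangle:
  assumes "f \<in> L2_space \<Omega>" "g \<in> L2_space \<Omega>" "h \<in> L2_space \<Omega>"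
  shows "L2_norm \<Omega> (\<lambda>t. f t - h t) \<le> L2_norm \<Omega> (\<lambda>t. f t - g t) + L2_norm \<Omega> (\<lambda>t. g t - h t)"
proof -
  have "square_integrable (lebesgue_on \<Omega>) (\<lambda>t. f t - g t)" "square_integrable (lebesgue_on \<Omega>) (\<lambda>t. g t - h t)"
    using square_integrable_lincomb[of _ f g 1 "-1"] square_integrable_lincomb[of _ g h 1 "-1"] assms
    by (auto simp: L2_space_iff)
  from sqrt_integral_square_triangle[OF this] show ?thesis by (simp add: L2_norm_def)
qed

lemma L2_norm_minus_commute: "L2_norm \<Omega> (\<lambda>t. f t - g t) = L2_norm \<Omega> (\<lambda>t. g t - f t)"
  by (simp add: L2_norm_def power2_commute)

text \<open>Without a finite e-net a greedy choice produces points whose images are pairwise at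
  distance at least e. Continuity of F at the limit of a convergent subsequence contradicts this for
  two consecutive members.\<close>

lemma operator_image_totally_bounded:
  fixes \<Omega> :: "(real^'m) set" and \<Omega>' :: "(real^'n) set"
  assumes \<Omega>: "open \<Omega>" "bounded \<Omega>" "cone_property \<Omega>" and s: "s > real CARD('m) / 2"
    and cont: "\<forall>x\<in>D. continuous_on (closure \<Omega>) x"
    and F: "\<forall>x\<in>D. F x \<in> L2_space \<Omega>'" "continuous_operator_on \<Omega> \<Omega>' D F"
    and bd: "sobolev_bounded s \<Omega> D" and cl: "sobolev_weakly_closed s \<Omega> D" and e: "e > 0"
  shows "\<exists>S. finite S \<and> S \<subseteq> D \<and> (\<forall>x\<in>D. \<exists>y\<in>S. L2_norm \<Omega>' (\<lambda>t. F x t - F y t) < e)"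
proof (rule ccontr)
  assume "\<not> ?thesis"
  then have "\<exists>x. x \<in> D \<and> (\<forall>y\<in>S. e \<le> L2_norm \<Omega>' (\<lambda>t. F x t - F y t))" if "finite S" "S \<subseteq> D" for S
    using that by (meson not_less)
  then obtain p where p: "\<And>S. finite S \<Longrightarrow> S \<subseteq> D \<Longrightarrow> p S \<in> D"
    "\<And>S y. finite S \<Longrightarrow> S \<subseteq> D \<Longrightarrow> y \<in> S \<Longrightarrow> e \<le> L2_norm \<Omega>' (\<lambda>t. F (p S) t - F y t)"
    by metis
  \<comment> \<open>\<open>T n\<close> collects the points chosen before step n, and the next point
    \<open>p (T n)\<close> has its image far from the images of all of them.\<close>
  define T where "T = rec_nat {} (\<lambda>_ S. insert (p S) S)"
  have T: "T 0 = {}" "\<And>n. T (Suc n) = insert (p (T n)) (T n)" by (simp_all add: T_def)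
  have TD: "finite (T n) \<and> T n \<subseteq> D" for n by (induction n) (auto simp: T p(1))
  define X where "X n = p (T n)" for n
  have XD: "X n \<in> D" for n unfolding X_def using p(1) TD by blast
  have XT: "X m \<in> T n" if "m < n" for m n
    using that by (induction n) (auto simp: T X_def less_Suc_eq)
  have far: "e \<le> L2_norm \<Omega>' (\<lambda>t. F (X n) t - F (X m) t)" if "m < n" for m n
    using p(2)[of "T n" "X m"] TD[of n] XT[OF that] by (simp add: X_def)
  obtain r :: "nat \<Rightarrow> nat" and x where r: "strict_mono r" "x \<in> D"
    "\<And>e. e > 0 \<Longrightarrow> \<forall>\<^sub>F n in sequentially. Linf_norm \<Omega> (\<lambda>t. X (r n) t - x t) < ereal e"
    using weakly_closed_sequentially_compact[where X=X, OF \<Omega> s cont bd cl XD] by blast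
  obtain d where d: "d > 0" "\<And>y. y \<in> D \<Longrightarrow> Linf_norm \<Omega> (\<lambda>t. y t - x t) < ereal d \<Longrightarrow> L2_norm \<Omega>' (\<lambda>t. F y t - F x t) < e / 2"
    using F(2)[unfolded continuous_operator_on_def, rule_format, OF r(2), of "e / 2"] e by auto
  obtain N where N: "\<And>n. n \<ge> N \<Longrightarrow> Linf_norm \<Omega> (\<lambda>t. X (r n) t - x t) < ereal d"
    using r(3)[OF d(1)] by (auto simp: eventually_sequentially)
  have "r N < r (Suc N)" using r(1) by (simp add: strict_mono_def)
  from far[OF this] have "e \<le> L2_norm \<Omega>' (\<lambda>t. F (X (r (Suc N))) t - F (X (r N)) t)" .
  also have "\<dots> \<le> L2_norm \<Omega>' (\<lambda>t. F (X (r (Suc N))) t - F x t) + L2_norm \<Omega>' (\<lambda>t. F x t - F (X (r N)) t)"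
    using F(1) XD r(2) by (intro L2_norm_triangle) auto
  also have "L2_norm \<Omega>' (\<lambda>t. F x t - F (X (r N)) t) = L2_norm \<Omega>' (\<lambda>t. F (X (r N)) t - F x t)"
    by (rule L2_norm_minus_commute)
  finally show False using d(2)[OF XD N, of "Suc N"] d(2)[OF XD N, of N] by simp
qed

section \<open>Density of shallow networks\<close>

text \<open>The limits give weak bounds at t - 1 and t + 1, and strict monotonicity makes them
  strict at t.\<close>

lemma sigmoid_bounds:
  assumes "sigmoid \<sigma>"
  shows "0 < \<sigma> t" "\<sigma> t < 1"
proof -
  have m: "strict_mono \<sigma>" and l: "(\<sigma> \<longlongrightarrow> 1) at_top" "(\<sigma> \<longlongrightarrow> 0) at_bot"
    using assms by (auto simp: sigmoid_def)
  have "\<sigma> (t + 1) \<le> 1"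
    by (rule tendsto_lowerbound[OF l(1)])
      (auto intro!: eventually_mono[OF eventually_ge_at_top[of "t + 1"]] simp: strict_mono_less_eq[OF m])
  moreover have "0 \<le> \<sigma> (t - 1)"
    by (rule tendsto_upperbound[OF l(2)])
      (auto intro!: eventually_mono[OF eventually_le_at_bot[of "t - 1"]] simp: strict_mono_less_eq[OF m])
  moreover have "\<sigma> (t - 1) < \<sigma> t" "\<sigma> t < \<sigma> (t + 1)" using m by (auto simp: strict_mono_def)
  ultimately show "0 < \<sigma> t" "\<sigma> t < 1" by linarith+
qed

lemma sum_telescope_from_1:
  fixes f :: "nat \<Rightarrow> real"
  shows "(\<Sum>i=1..p. f i - f (i - 1)) = f p - f 0"
  by (induction p) auto

text \<open>The approximant is a staircase whose steps are steep sigmoids; the neuron with input weight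
  \<open>0\<close> supplies the constant.\<close>

lemma sigmoid_staircase:
  assumes \<sigma>: "sigmoid \<sigma>" and ab: "a < b" and g: "continuous_on {a..b} g" and e: "e > 0"
  shows "\<exists>L::(real \<times> real \<times> real) list. \<forall>x\<in>{a..b}. \<bar>g x - (\<Sum>(c, w, z)\<leftarrow>L. c * \<sigma> (w * x + z))\<bar> \<le> e"
proof -
  \<comment> \<open>One \<eta> pays for moving x to its node; three pay for the steps: 1 in total
    for the tails of the sigmoids and 2 for the jumps next to x.\<close>
  define \<eta> where "\<eta> = e / 4"
  have \<eta>: "\<eta> > 0" using e by (simp add: \<eta>_def)
  have "uniformly_continuous_on {a..b} g" using g by (intro compact_uniformly_continuous) auto
  then obtain d where d: "d > 0" "\<And>x y. x \<in> {a..b} \<Longrightarrow> y \<in> {a..b} \<Longrightarrow> \<bar>x - y\<bar> < d \<Longrightarrow> \<bar>g x - g y\<bar> < \<eta>"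
    using \<eta> unfolding uniformly_continuous_on_def dist_real_def by metis
  obtain N :: nat where "(b - a) / d < real N" using reals_Archimedean2 by blast
  moreover have "(b - a) / d > 0" using ab d by simp
  ultimately have N: "N > 0" "(b - a) / d < real N" by (auto intro: gr0I)
  define h where "h = (b - a) / real N"
  have h: "h > 0" "h < d" using ab N d by (auto simp: h_def field_simps)
  have hN: "real N * h = b - a" using N by (simp add: h_def)
  define node where "node i = a + real i * h" for i
  have node: "node i \<in> {a..b}" if "i \<le> N" for i
  proof -
    have "real i * h \<le> real N * h" using that h by (intro mult_right_mono) auto
    then show ?thesis using h hN by (simp add: node_def)
  qed
  define \<Delta> where "\<Delta> i = g (node i) - g (node (i - 1))" for i
  have \<Delta>: "\<bar>\<Delta> i\<bar> \<le> \<eta>" if "i \<in> {1..N}" for i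
  proof -
    have "node i - node (i - 1) = h" using that by (simp add: node_def of_nat_diff algebra_simps)
    then have "\<bar>g (node i) - g (node (i - 1))\<bar> < \<eta>" using that h by (intro d(2) node) auto
    then show ?thesis by (simp add: \<Delta>_def)
  qed
  have lim: "(\<sigma> \<longlongrightarrow> 1) at_top" "(\<sigma> \<longlongrightarrow> 0) at_bot" using \<sigma> by (auto simp: sigmoid_def)
  have N1: "1 / real N > 0" using N by simp
  have "\<forall>\<^sub>F z in at_top. \<sigma> z > 1 - 1 / real N" by (rule order_tendstoD(1)[OF lim(1)]) (use N1 in simp)
  then obtain R1 where R1: "\<And>z. z \<ge> R1 \<Longrightarrow> \<sigma> z > 1 - 1 / real N" by (auto simp: eventually_at_top_linorder)
  have "\<forall>\<^sub>F z in at_bot. \<sigma> z < 1 / real N" by (rule order_tendstoD(2)[OF lim(2)]) (rule N1)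
  then obtain R2 where R2: "\<And>z. z \<le> R2 \<Longrightarrow> \<sigma> z < 1 / real N" by (auto simp: eventually_at_bot_linorder)
  \<comment> \<open>Steep enough for each sigmoid to be within 1 / N of 0 or 1 at distance h from
    its jump; the 1 in the maximum keeps the slope positive.\<close>
  define M where "M = max 1 (max R1 (- R2)) / h"
  have M: "M * h \<ge> R1" "M * h \<ge> - R2" "M > 0" using h by (auto simp: M_def)
  define S where "S x = g a + (\<Sum>i=1..N. \<Delta> i * \<sigma> (M * x + (- M * node i)))" for x
  \<comment> \<open>Away from the jump the error is at most 1 / N, and within distance h of it at
    most 1 since both values lie between 0 and 1.\<close>
  have close: "\<bar>\<sigma> (M * x + (- M * node i)) - of_bool (node i \<le> x)\<bar> \<le> 1 / real N + of_bool (\<bar>x - node i\<bar> < h)" for x i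
  proof -
    have eq: "M * x + (- M * node i) = M * (x - node i)" by (simp add: algebra_simps)
    note b = sigmoid_bounds[OF \<sigma>, of "M * (x - node i)"]
    consider "x - node i \<ge> h" | "x - node i \<le> - h" | "\<bar>x - node i\<bar> < h" by linarith
    then show ?thesis
    proof cases
      case 1
      have "M * h \<le> M * (x - node i)" using 1 M(3) by (intro mult_left_mono) auto
      then have "\<sigma> (M * (x - node i)) > 1 - 1 / real N" using M(1) by (intro R1) linarith
      then show ?thesis unfolding eq using 1 h b by simp
    next
      case 2
      have "M * (x - node i) \<le> M * (- h)" using 2 M(3) by (intro mult_left_mono) auto
      then have "\<sigma> (M * (x - node i)) < 1 / real N" using M(2) by (intro R2) simp
      then show ?thesis unfolding eq using 2 h b by simp
    next
      case 3
      then have "of_bool (\<bar>x - node i\<bar> < h) = (1::real)" by simp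
      moreover have "\<bar>\<sigma> (M * (x - node i)) - of_bool (node i \<le> x)\<bar> \<le> 1" using b by (cases "node i \<le> x") auto
      ultimately show ?thesis unfolding eq using N1 by linarith
    qed
  qed
  have main: "\<bar>g x - S x\<bar> \<le> e" if x: "x \<in> {a..b}" for x
  proof -
    \<comment> \<open>The index of the last node not to the right of x.\<close>
    define p where "p = nat \<lfloor>(x - a) / h\<rfloor>"
    have "(x - a) / h \<ge> 0" using x h by simp
    then have p: "real p \<le> (x - a) / h" "(x - a) / h < real p + 1" unfolding p_def by linarith+
    have xp: "real p * h \<le> x - a" "x - a < (real p + 1) * h" using p h by (simp_all add: field_simps)
    have "real p * h \<le> real N * h" using xp(1) x hN by simp
    then have pN: "p \<le> N" using h by simp
    have le_iff: "node i \<le> x \<longleftrightarrow> i \<le> p" for i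
    proof
      assume "node i \<le> x"
      then have "real i * h < (real p + 1) * h" using xp(2) by (simp add: node_def)
      then show "i \<le> p" using h by simp
    next
      assume "i \<le> p"
      then have "real i * h \<le> real p * h" using h by (intro mult_right_mono) auto
      then show "node i \<le> x" using xp(1) by (simp add: node_def)
    qed
    \<comment> \<open>At most two nodes are closer to x than the mesh width, so at most two steps
      contribute a full jump error.\<close>
    have near: "i \<in> {p, Suc p}" if "\<bar>x - node i\<bar> < h" for i
    proof -
      have "real p * h < (real i + 1) * h" "real i * h < (real p + 2) * h"
        using that xp by (simp_all add: node_def abs_less_iff algebra_simps)
      then have "real p < real i + 1" "real i < real p + 2" using h by simp_all
      then show ?thesis by auto
    qed
    have "(\<Sum>i=1..N. \<Delta> i * of_bool (node i \<le> x)) = (\<Sum>i\<in>{1..p}. \<Delta> i)"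
      using pN by (intro sum.mono_neutral_cong_right) (auto simp: le_iff)
    also have "\<dots> = g (node p) - g a"
      unfolding \<Delta>_def using sum_telescope_from_1[of "\<lambda>i. g (node i)" p] by (simp add: node_def)
    finally have H: "g a + (\<Sum>i=1..N. \<Delta> i * of_bool (node i \<le> x)) = g (node p)" by simp
    have "\<bar>x - node p\<bar> < d" using xp h by (simp add: node_def algebra_simps)
    then have gp: "\<bar>g x - g (node p)\<bar> < \<eta>" using x node[OF pN] by (intro d(2)) auto
    have "S x - g (node p) = (\<Sum>i=1..N. \<Delta> i * (\<sigma> (M * x + (- M * node i)) - of_bool (node i \<le> x)))"
      unfolding S_def H[symmetric] by (simp only: right_diff_distrib sum_subtractf)
    also have "\<bar>\<dots>\<bar> \<le> (\<Sum>i=1..N. \<eta> * (1 / real N + of_bool (\<bar>x - node i\<bar> < h)))"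
    proof (rule order_trans[OF sum_abs sum_mono])
      fix i assume i: "i \<in> {1..N}"
      show "\<bar>\<Delta> i * (\<sigma> (M * x + (- M * node i)) - of_bool (node i \<le> x))\<bar> \<le> \<eta> * (1 / real N + of_bool (\<bar>x - node i\<bar> < h))"
        unfolding abs_mult using \<eta> by (intro mult_mono \<Delta>[OF i] close) auto
    qed
    also have "\<dots> = \<eta> * (1 + (\<Sum>i=1..N. of_bool (\<bar>x - node i\<bar> < h)))"
      using N by (simp only: sum_distrib_left[symmetric] sum.distrib) simp
    also have "(\<Sum>i=1..N. of_bool (\<bar>x - node i\<bar> < h)) \<le> (2::real)"
    proof -
      have "(\<Sum>i=1..N. of_bool (\<bar>x - node i\<bar> < h) :: real) = real (card ({1..N} \<inter> {i. \<bar>x - node i\<bar> < h}))"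
        by (simp add: of_bool_def sum.If_cases)
      also have "card ({1..N} \<inter> {i. \<bar>x - node i\<bar> < h}) \<le> card {p, Suc p}"
        using near by (intro card_mono) auto
      finally show ?thesis by simp
    qed
    finally have "\<bar>S x - g (node p)\<bar> \<le> \<eta> * 3" using \<eta> by simp
    with gp show ?thesis unfolding \<eta>_def by linarith
  qed
  define L where "L = (g a / \<sigma> 0, 0, 0) # map (\<lambda>i. (\<Delta> i, M, - M * node i)) [1..<Suc N]"
  have "(\<Sum>(c, w, z)\<leftarrow>L. c * \<sigma> (w * x + z)) = S x" for x
    using sigmoid_bounds(1)[OF \<sigma>, of 0] unfolding L_def S_def
    by (simp add: comp_def interv_sum_list_conv_sum_set_nat atLeastLessThanSuc_atLeastAtMost del: upt_Suc)
  with main show ?thesis by (intro exI[of _ L]) simp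
qed

section \<open>Shallow networks: ridge functions, continuous functions, L2\<close>

definition net_eval :: "(real \<Rightarrow> real) \<Rightarrow> (real \<times> 'a::euclidean_space \<times> real) list \<Rightarrow> 'a \<Rightarrow> real" where
  "net_eval \<sigma> L t = (\<Sum>(c, w, z)\<leftarrow>L. c * \<sigma> (w \<bullet> t + z))"

definition net_approximable :: "(real \<Rightarrow> real) \<Rightarrow> 'a::euclidean_space set \<Rightarrow> ('a \<Rightarrow> real) \<Rightarrow> bool" where
  "net_approximable \<sigma> \<Omega> g \<longleftrightarrow> (\<forall>e>0. \<exists>L. \<forall>t\<in>\<Omega>. \<bar>g t - net_eval \<sigma> L t\<bar> \<le> e)"

lemma net_eval_continuous:
  assumes "sigmoid \<sigma>"
  shows "continuous_on A (net_eval \<sigma> L)"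
proof -
  have c: "continuous_on UNIV \<sigma>"
    using assms by (auto simp: sigmoid_def intro!: continuous_at_imp_continuous_on differentiable_imp_continuous_within)
  show ?thesis
  proof (induction L)
    case (Cons q L)
    obtain c w z where q: "q = (c, w, z)" by (cases q)
    have "continuous_on A (\<lambda>t. c * \<sigma> (w \<bullet> t + z) + net_eval \<sigma> L t)"
      by (intro continuous_intros Cons continuous_on_compose2[OF \<open>continuous_on UNIV \<sigma>\<close>]) auto
    then show ?case by (simp add: q net_eval_def[abs_def])
  qed (simp add: net_eval_def[abs_def])
qed

lemma net_approximable_add:
  assumes "net_approximable \<sigma> \<Omega> f" "net_approximable \<sigma> \<Omega> g"
  shows "net_approximable \<sigma> \<Omega> (\<lambda>t. f t + g t)"
  unfolding net_approximable_def
proof (intro allI impI)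
  fix e :: real assume "e > 0"
  then have e: "e / 2 > 0" by simp
  obtain L where L: "\<forall>t\<in>\<Omega>. \<bar>f t - net_eval \<sigma> L t\<bar> \<le> e / 2"
    using assms(1) e unfolding net_approximable_def by blast
  obtain L' where L': "\<forall>t\<in>\<Omega>. \<bar>g t - net_eval \<sigma> L' t\<bar> \<le> e / 2"
    using assms(2) e unfolding net_approximable_def by blast
  have "\<bar>f t + g t - net_eval \<sigma> (L @ L') t\<bar> \<le> e" if "t \<in> \<Omega>" for t
  proof -
    have "f t + g t - net_eval \<sigma> (L @ L') t = (f t - net_eval \<sigma> L t) + (g t - net_eval \<sigma> L' t)"
      by (simp add: net_eval_def)
    also have "\<bar>\<dots>\<bar> \<le> e / 2 + e / 2"
      using L L' that by (intro order_trans[OF abs_triangle_ineq] add_mono) auto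
    finally show ?thesis by simp
  qed
  then show "\<exists>L. \<forall>t\<in>\<Omega>. \<bar>f t + g t - net_eval \<sigma> L t\<bar> \<le> e" by blast
qed

lemma net_approximable_cmult:
  assumes "net_approximable \<sigma> \<Omega> f"
  shows "net_approximable \<sigma> \<Omega> (\<lambda>t. a * f t)"
  unfolding net_approximable_def
proof (intro allI impI)
  fix e :: real assume "e > 0"
  then have e: "e / (\<bar>a\<bar> + 1) > 0" by simp
  then obtain L where L: "\<forall>t\<in>\<Omega>. \<bar>f t - net_eval \<sigma> L t\<bar> \<le> e / (\<bar>a\<bar> + 1)"
    using assms unfolding net_approximable_def by blast
  have sc: "net_eval \<sigma> (map (\<lambda>(c, w, z). (a * c, w, z)) L) t = a * net_eval \<sigma> L t" for t
    by (induction L) (auto simp: net_eval_def algebra_simps)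
  have "\<bar>a * f t - net_eval \<sigma> (map (\<lambda>(c, w, z). (a * c, w, z)) L) t\<bar> \<le> e" if "t \<in> \<Omega>" for t
  proof -
    have "\<bar>a * f t - a * net_eval \<sigma> L t\<bar> = \<bar>a\<bar> * \<bar>f t - net_eval \<sigma> L t\<bar>"
      by (simp add: abs_mult[symmetric] right_diff_distrib)
    also have "\<dots> \<le> (\<bar>a\<bar> + 1) * (e / (\<bar>a\<bar> + 1))" using L that by (intro mult_mono) auto
    also have "\<dots> = e" by simp
    finally show ?thesis by (simp only: sc)
  qed
  then show "\<exists>L. \<forall>t\<in>\<Omega>. \<bar>a * f t - net_eval \<sigma> L t\<bar> \<le> e" by blast
qed

lemma net_approximable_ridge:
  assumes \<sigma>: "sigmoid \<sigma>" and \<Omega>: "bounded \<Omega>" and g: "continuous_on UNIV g"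
  shows "net_approximable \<sigma> \<Omega> (\<lambda>t. g (w \<bullet> t))"
  unfolding net_approximable_def
proof (intro allI impI)
  fix e :: real assume e: "e > 0"
  obtain R where R: "R > 0" "\<And>t. t \<in> \<Omega> \<Longrightarrow> norm t \<le> R" using \<Omega> unfolding bounded_pos by blast
  \<comment> \<open>The summand 1 keeps the interval nondegenerate when w = 0.\<close>
  define A where "A = norm w * R + 1"
  have A: "A > 0" using R by (simp add: A_def add_nonneg_pos)
  have in_A: "w \<bullet> t \<in> {- A..A}" if "t \<in> \<Omega>" for t
  proof -
    have "\<bar>w \<bullet> t\<bar> \<le> norm w * norm t" by (rule Cauchy_Schwarz_ineq2)
    also have "\<dots> \<le> norm w * R" using R(2)[OF that] by (rule mult_left_mono) simp
    finally show ?thesis by (auto simp: A_def abs_le_iff)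
  qed
  obtain L where L: "\<forall>x\<in>{- A..A}. \<bar>g x - (\<Sum>(c, r, z)\<leftarrow>L. c * \<sigma> (r * x + z))\<bar> \<le> e"
    using sigmoid_staircase[OF \<sigma> _ continuous_on_subset[OF g] e, of "- A" A] A by auto
  have "net_eval \<sigma> (map (\<lambda>(c, r, z). (c, r *\<^sub>R w, z)) L) t = (\<Sum>(c, r, z)\<leftarrow>L. c * \<sigma> (r * (w \<bullet> t) + z))" for t
    by (induction L) (auto simp: net_eval_def)
  then show "\<exists>L. \<forall>t\<in>\<Omega>. \<bar>g (w \<bullet> t) - net_eval \<sigma> L t\<bar> \<le> e"
    using L in_A by (intro exI[of _ "map (\<lambda>(c, r, z). (c, r *\<^sub>R w, z)) L"]) simp
qed

text \<open>The span of the exponentials exp (w \<bullet> t) is an algebra, contains the constants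
  (w = 0) and separates points, so Stone-Weierstrass applies. Each exponential is a function of w
  \<bullet> t, and the one-dimensional staircase suffices for it.\<close>

inductive exp_sum :: "('a::euclidean_space \<Rightarrow> real) \<Rightarrow> bool" where
  exp: "exp_sum (\<lambda>t. exp (w \<bullet> t))"
| add: "exp_sum f \<Longrightarrow> exp_sum g \<Longrightarrow> exp_sum (\<lambda>t. f t + g t)"
| cmult: "exp_sum f \<Longrightarrow> exp_sum (\<lambda>t. a * f t)"

lemma exp_sum_mult: "exp_sum f \<Longrightarrow> exp_sum g \<Longrightarrow> exp_sum (\<lambda>t. f t * g t)"
proof (induction rule: exp_sum.induct)
  case (exp w)
  then show ?case
  proof (induction rule: exp_sum.induct)
    case (exp w')
    have "(\<lambda>t. exp (w \<bullet> t) * exp (w' \<bullet> t)) = (\<lambda>t. exp ((w + w') \<bullet> t))"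
      by (simp add: exp_add inner_add_left)
    then show ?case by (simp only: exp_sum.exp)
  next
    case (add f g)
    then show ?case using exp_sum.add by (simp add: distrib_left)
  next
    case (cmult f a)
    then show ?case using exp_sum.cmult[of _ a] by (simp add: mult.left_commute)
  qed
next
  case (add f h)
  then show ?case using exp_sum.add by (simp add: distrib_right)
next
  case (cmult f a)
  then show ?case using exp_sum.cmult[of _ a] by (simp add: mult.assoc)
qed

lemma continuous_net_approximable:
  fixes f :: "'a::euclidean_space \<Rightarrow> real"
  assumes \<sigma>: "sigmoid \<sigma>" and \<Omega>: "bounded \<Omega>" and f: "continuous_on (closure \<Omega>) f"
  shows "net_approximable \<sigma> \<Omega> f"
  unfolding net_approximable_def
proof (intro allI impI)
  fix e :: real assume e: "e > 0"
  have ex: "exp_sum g \<Longrightarrow> net_approximable \<sigma> \<Omega> g" for g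
  proof (induction rule: exp_sum.induct)
    case (exp w)
    show ?case by (rule net_approximable_ridge[OF \<sigma> \<Omega> continuous_on_exp[OF continuous_on_id]])
  qed (auto intro: net_approximable_add net_approximable_cmult)
  have "\<exists>g. exp_sum g \<and> (\<forall>x\<in>closure \<Omega>. \<bar>f x - g x\<bar> < e / 2)"
  proof (rule Stone_Weierstrass_HOL)
    show "compact (closure \<Omega>)" using \<Omega> by (simp add: compact_eq_bounded_closed bounded_closure)
    show "exp_sum (\<lambda>x::'a. c)" for c using exp_sum.cmult[OF exp_sum.exp[of 0], of c] by simp
    show "continuous_on (closure \<Omega>) g" if "exp_sum g" for g
      using that by (induction rule: exp_sum.induct) (auto intro!: continuous_intros)
    show "exp_sum (\<lambda>x. g x + h x)" "exp_sum (\<lambda>x. g x * h x)" if "exp_sum g \<and> exp_sum h" for g h :: "'a \<Rightarrow> real"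
      using that by (auto intro: exp_sum.add exp_sum_mult)
    show "\<exists>g. exp_sum g \<and> g x \<noteq> g y" if "x \<in> closure \<Omega> \<and> y \<in> closure \<Omega> \<and> x \<noteq> y" for x y
    proof -
      \<comment> \<open>The exponential with weight x - y separates x from y.\<close>
      have "(x - y) \<bullet> x - (x - y) \<bullet> y = (x - y) \<bullet> (x - y)" by (simp add: inner_diff_right)
      then have "(x - y) \<bullet> x \<noteq> (x - y) \<bullet> y" using that by auto
      then show ?thesis by (intro exI[of _ "\<lambda>t. exp ((x - y) \<bullet> t)"] conjI exp_sum.exp) simp
    qed
  qed (use f e in auto)
  then obtain g where g: "exp_sum g" "\<And>x. x \<in> closure \<Omega> \<Longrightarrow> \<bar>f x - g x\<bar> < e / 2" by blast
  obtain L where L: "\<And>t. t \<in> \<Omega> \<Longrightarrow> \<bar>g t - net_eval \<sigma> L t\<bar> \<le> e / 2"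
    using ex[OF g(1)] e unfolding net_approximable_def by (meson half_gt_zero)
  have "\<bar>f t - net_eval \<sigma> L t\<bar> \<le> e" if "t \<in> \<Omega>" for t
  proof -
    have "\<bar>f t - g t\<bar> \<le> e / 2" using g(2)[of t] that closure_subset[of \<Omega>] by auto
    with L[OF that] have "\<bar>(f t - g t) + (g t - net_eval \<sigma> L t)\<bar> \<le> e / 2 + e / 2"
      by (intro order_trans[OF abs_triangle_ineq] add_mono)
    then show ?thesis by simp
  qed
  then show "\<exists>L. \<forall>t\<in>\<Omega>. \<bar>f t - net_eval \<sigma> L t\<bar> \<le> e" by blast
qed

lemma ex_L2_norm_less_of_tendsto_0:
  assumes "(\<lambda>n. \<integral>t. (f t - h n t)\<^sup>2 \<partial>lebesgue_on \<Omega>) \<longlonglongrightarrow> 0" "e > 0"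
  shows "\<exists>n::nat. L2_norm \<Omega> (\<lambda>t. f t - h n t) < e"
proof -
  have "(\<lambda>n. L2_norm \<Omega> (\<lambda>t. f t - h n t)) \<longlonglongrightarrow> 0"
    unfolding L2_norm_def using tendsto_real_sqrt[OF assms(1)] by simp
  from order_tendstoD(2)[OF this assms(2)] show ?thesis by (auto simp: eventually_sequentially)
qed

text \<open>f is truncated at level n, then replaced by a truncated continuous approximation, then
  by a network, each at the cost of e / 3. Truncating the continuous functions at the same level
  provides the constant that dominates their squared errors.\<close>

lemma L2_net_approximation:
  fixes f :: "'a::euclidean_space \<Rightarrow> real"
  assumes \<sigma>: "sigmoid \<sigma>" and \<Omega>: "open \<Omega>" "bounded \<Omega>" and f: "f \<in> L2_space \<Omega>" and e: "e > 0"
  shows "\<exists>L. L2_norm \<Omega> (\<lambda>t. f t - net_eval \<sigma> L t) \<le> e"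
proof -
  let ?M = "lebesgue_on \<Omega>"
  have lm: "\<Omega> \<in> lmeasurable" using \<Omega> by (simp add: lmeasurable_open)
  interpret fM: finite_measure ?M by (rule finite_measure_lebesgue_on[OF lm])
  note fin = fM.finite_measure_axioms
  define cl where "cl n y = max (- real n) (min (real n) y)" for n y
  have cl_c: "continuous_on UNIV (cl n)" for n unfolding cl_def by (intro continuous_intros)
  have cl_b: "\<bar>cl n y\<bar> \<le> real n" for n y by (auto simp: cl_def)
  have fsq: "square_integrable ?M f" using f by (simp add: L2_space_iff)
  have fm [measurable]: "f \<in> borel_measurable ?M" using fsq by (rule square_integrableD)
  have clm [measurable]: "cl n \<in> borel_measurable borel" for n by (rule borel_measurable_continuous_onI[OF cl_c])
  have "(\<lambda>n. \<integral>t. (f t - cl n (f t))\<^sup>2 \<partial>?M) \<longlonglongrightarrow> (\<integral>t. 0 \<partial>?M)"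
  proof (rule integral_dominated_convergence[where w="\<lambda>t. (f t)\<^sup>2"])
    show "integrable ?M (\<lambda>t. (f t)\<^sup>2)" using fsq by (rule square_integrableD)
    show "AE t in ?M. (\<lambda>n. (f t - cl n (f t))\<^sup>2) \<longlonglongrightarrow> 0"
    proof (rule AE_I2, rule tendsto_eventually)
      fix t
      obtain N :: nat where "\<bar>f t\<bar> < real N" using reals_Archimedean2 by blast
      then have "(f t - cl n (f t))\<^sup>2 = 0" if "n \<ge> N" for n
        using that by (auto simp: cl_def max_def min_def)
      then show "\<forall>\<^sub>F n in sequentially. (f t - cl n (f t))\<^sup>2 = 0" by (auto simp: eventually_sequentially)
    qed
    show "AE t in ?M. norm ((f t - cl n (f t))\<^sup>2) \<le> (f t)\<^sup>2" for n
    proof (rule AE_I2)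
      fix t
      have "\<bar>f t - cl n (f t)\<bar> \<le> \<bar>f t\<bar>" by (auto simp: cl_def max_def min_def)
      from power_mono[OF this, of 2] show "norm ((f t - cl n (f t))\<^sup>2) \<le> (f t)\<^sup>2" by simp
    qed
  qed auto
  then have "(\<lambda>n. \<integral>t. (f t - cl n (f t))\<^sup>2 \<partial>?M) \<longlonglongrightarrow> 0" by simp
  from ex_L2_norm_less_of_tendsto_0[OF this, of "e / 3"] e
  obtain n where n: "L2_norm \<Omega> (\<lambda>t. f t - cl n (f t)) < e / 3" by auto
  have "f measurable_on \<Omega>" using measurable_on_iff_borel_measurable[of \<Omega> f] fm lm by (auto simp: fmeasurableD)
  then obtain Z g where Z: "negligible Z" and gc: "\<And>j. continuous_on UNIV (g j)"
    and gl: "\<And>x. x \<notin> Z \<Longrightarrow> (\<lambda>j. g j x) \<longlonglongrightarrow> (if x \<in> \<Omega> then f x else 0)"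
    unfolding measurable_on_def by blast
  have gm [measurable]: "g j \<in> borel_measurable ?M" for j by (rule continuous_measurable_lebesgue_on[OF gc])
  have "AE x in lebesgue. x \<notin> Z" using Z by (intro AE_not_in) (simp add: negligible_iff_null_sets)
  then have AEZ: "AE x in ?M. x \<notin> Z" using lm by (auto simp: AE_restrict_space_iff fmeasurableD elim: eventually_mono)
  have "(\<lambda>j. \<integral>t. (cl n (f t) - cl n (g j t))\<^sup>2 \<partial>?M) \<longlonglongrightarrow> (\<integral>t. 0 \<partial>?M)"
  proof (rule integral_dominated_convergence[where w="\<lambda>t. (2 * real n)\<^sup>2"])
    show "AE t in ?M. (\<lambda>j. (cl n (f t) - cl n (g j t))\<^sup>2) \<longlonglongrightarrow> 0"
      using AEZ AE_space
    proof eventually_elim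
      case (elim t)
      then have "(\<lambda>j. g j t) \<longlonglongrightarrow> f t" using gl[of t] by simp
      moreover have "isCont (cl n) (f t)" using cl_c[of n] by (simp add: continuous_on_eq_continuous_at)
      ultimately have "(\<lambda>j. cl n (g j t)) \<longlonglongrightarrow> cl n (f t)" using isCont_tendsto_compose by blast
      then have "(\<lambda>j. (cl n (f t) - cl n (g j t))\<^sup>2) \<longlonglongrightarrow> (cl n (f t) - cl n (f t))\<^sup>2"
        by (intro tendsto_intros)
      then show ?case by simp
    qed
    show "AE t in ?M. norm ((cl n (f t) - cl n (g j t))\<^sup>2) \<le> (2 * real n)\<^sup>2" for j
    proof (rule AE_I2)
      fix t
      have "\<bar>cl n (f t) - cl n (g j t)\<bar> \<le> 2 * real n" using cl_b[of n "f t"] cl_b[of n "g j t"] by linarith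
      from power_mono[OF this, of 2] show "norm ((cl n (f t) - cl n (g j t))\<^sup>2) \<le> (2 * real n)\<^sup>2" by simp
    qed
  qed auto
  then have "(\<lambda>j. \<integral>t. (cl n (f t) - cl n (g j t))\<^sup>2 \<partial>?M) \<longlonglongrightarrow> 0" by simp
  from ex_L2_norm_less_of_tendsto_0[OF this, of "e / 3"] e
  obtain j where j: "L2_norm \<Omega> (\<lambda>t. cl n (f t) - cl n (g j t)) < e / 3" by auto
  have c: "continuous_on UNIV (\<lambda>t. cl n (g j t))" by (rule continuous_on_compose2[OF cl_c gc]) simp
  \<comment> \<open>A uniform error \<eta> becomes an L2 error of at most e / 3 after multiplication
    by the root of the measure.\<close>
  define \<eta> where "\<eta> = e / (3 * (sqrt (measure ?M \<Omega>) + 1))"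
  have s1: "sqrt (measure ?M \<Omega>) + 1 > 0" by (intro add_nonneg_pos) auto
  then have \<eta>: "\<eta> > 0" using e by (simp add: \<eta>_def)
  obtain L where L: "\<And>t. t \<in> \<Omega> \<Longrightarrow> \<bar>cl n (g j t) - net_eval \<sigma> L t\<bar> \<le> \<eta>"
    using continuous_net_approximable[OF \<sigma> \<Omega>(2) continuous_on_subset[OF c]] \<eta> unfolding net_approximable_def by blast
  have netL2: "net_eval \<sigma> L \<in> L2_space \<Omega>" "(\<lambda>t. cl n (g j t)) \<in> L2_space \<Omega>"
    unfolding L2_space_iff by (intro continuous_square_integrable net_eval_continuous[OF \<sigma>] c \<Omega>)+
  have clL2: "(\<lambda>t. cl n (f t)) \<in> L2_space \<Omega>"
    unfolding L2_space_iff by (rule square_integrable_bounded[OF fin _ cl_b]) measurable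
  have "L2_norm \<Omega> (\<lambda>t. cl n (g j t) - net_eval \<sigma> L t) \<le> e / 3"
  proof -
    have d: "square_integrable ?M (\<lambda>t. cl n (g j t) - net_eval \<sigma> L t)"
      using square_integrable_lincomb[of ?M "\<lambda>t. cl n (g j t)" "net_eval \<sigma> L" 1 "-1"] netL2 by (simp add: L2_space_iff)
    have "(\<integral>t. (cl n (g j t) - net_eval \<sigma> L t)\<^sup>2 \<partial>?M) \<le> (\<integral>t. \<eta>\<^sup>2 \<partial>?M)"
    proof (rule integral_mono)
      fix t assume "t \<in> space ?M"
      then have "t \<in> \<Omega>" by simp
      from power_mono[OF L[OF this], of 2] show "(cl n (g j t) - net_eval \<sigma> L t)\<^sup>2 \<le> \<eta>\<^sup>2" by simp
    qed (use d in \<open>auto dest: square_integrableD\<close>)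
    then have "sqrt (\<integral>t. (cl n (g j t) - net_eval \<sigma> L t)\<^sup>2 \<partial>?M) \<le> sqrt (measure ?M \<Omega> * \<eta>\<^sup>2)" by simp
    also have "\<dots> = sqrt (measure ?M \<Omega>) * \<eta>" using \<eta> by (simp add: real_sqrt_mult)
    also have "\<dots> \<le> (sqrt (measure ?M \<Omega>) + 1) * \<eta>" using \<eta> by (intro mult_right_mono) auto
    also have "\<dots> = e / 3"
    proof -
      have "z * (e / (3 * z)) = e / 3" if "z > 0" for z :: real using that by simp
      from this[OF s1] show ?thesis by (simp only: \<eta>_def)
    qed
    finally show ?thesis by (simp add: L2_norm_def)
  qed
  moreover have "L2_norm \<Omega> (\<lambda>t. f t - net_eval \<sigma> L t) \<le>
      L2_norm \<Omega> (\<lambda>t. f t - cl n (f t)) + L2_norm \<Omega> (\<lambda>t. cl n (f t) - net_eval \<sigma> L t)"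
    by (rule L2_norm_triangle[OF f clL2 netL2(1)])
  moreover have "L2_norm \<Omega> (\<lambda>t. cl n (f t) - net_eval \<sigma> L t) \<le>
      L2_norm \<Omega> (\<lambda>t. cl n (f t) - cl n (g j t)) + L2_norm \<Omega> (\<lambda>t. cl n (g j t) - net_eval \<sigma> L t)"
    by (rule L2_norm_triangle[OF clL2 netL2(2,1)])
  ultimately have "L2_norm \<Omega> (\<lambda>t. f t - net_eval \<sigma> L t) \<le> e" using n j by linarith
  then show ?thesis by blast
qed

section \<open>One network for all members of the finite net\<close>

theorem corollary6p3:
  fixes \<sigma> :: "real \<Rightarrow> real"
    and \<Omega>X :: "(real^'m) set" and \<Omega>Y :: "(real^'n) set"
    and s :: real
    and D :: "(real^'m \<Rightarrow> real) set"
    and F :: "(real^'m \<Rightarrow> real) \<Rightarrow> real^'n \<Rightarrow> real"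
    and \<epsilon> :: real
  assumes "sigmoid \<sigma>"
    and "bounded_domain \<Omega>X" and "bounded_domain \<Omega>Y"
    and "cone_property \<Omega>X" and "piecewise_C1_boundary \<Omega>X"
    and "s > real CARD('m) / 2"
    and "\<forall>x\<in>D. continuous_on (closure \<Omega>X) x"
    and "\<forall>x\<in>D. F x \<in> L2_space \<Omega>Y"
    and "continuous_operator_on \<Omega>X \<Omega>Y D F"
    and "sobolev_bounded s \<Omega>X D" and "sobolev_weakly_closed s \<Omega>X D"
    and "\<epsilon> > 0"
  shows "\<exists>(J::nat) (K::nat) (L::nat)
           (w :: nat \<Rightarrow> nat \<Rightarrow> nat \<Rightarrow> real) (\<theta> :: nat \<Rightarrow> nat \<Rightarrow> real) (\<zeta> :: nat \<Rightarrow> real)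
           (wv :: nat \<Rightarrow> real^'n) (sv :: nat \<Rightarrow> real^'m).
           J > 0 \<and> K > 0 \<and> L > 0 \<and> (\<forall>l\<in>{1..L}. sv l \<in> \<Omega>X) \<and>
           (\<forall>x\<in>D. \<exists>\<alpha> :: nat \<Rightarrow> nat \<Rightarrow> real.
              L2_norm \<Omega>Y (\<lambda>t. F x t -
                (\<Sum>j=1..J. \<Sum>k=1..K. \<alpha> j k * \<sigma> ((\<Sum>l=1..L. w j k l * x (sv l)) + \<theta> j k)
                   * \<sigma> (wv j \<bullet> t + \<zeta> j))) \<le> \<epsilon>)"
proof -
  have \<sigma>: "sigmoid \<sigma>" and X: "open \<Omega>X" "bounded \<Omega>X" "\<Omega>X \<noteq> {}" and Y: "open \<Omega>Y" "bounded \<Omega>Y"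
    using assms(1-3) by (auto simp: bounded_domain_def)
  obtain s0 where s0: "s0 \<in> \<Omega>X" using X(3) by blast
  have e2: "\<epsilon> / 2 > 0" using \<open>\<epsilon> > 0\<close> by simp
  obtain S where S: "finite S" "S \<subseteq> D" "\<And>x. x \<in> D \<Longrightarrow> \<exists>y\<in>S. L2_norm \<Omega>Y (\<lambda>t. F x t - F y t) < \<epsilon> / 2"
    using operator_image_totally_bounded[OF X(1,2) assms(4,6-11) e2] by blast
  have "\<forall>y\<in>S. \<exists>L. L2_norm \<Omega>Y (\<lambda>t. F y t - net_eval \<sigma> L t) \<le> \<epsilon> / 2"
    using L2_net_approximation[OF \<sigma> Y _ e2] assms(8) S(2) by blast
  from bchoice[OF this] obtain L where L: "\<And>y. y \<in> S \<Longrightarrow> L2_norm \<Omega>Y (\<lambda>t. F y t - net_eval \<sigma> (L y) t) \<le> \<epsilon> / 2"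
    by blast
  obtain ys where ys: "set ys = S" "distinct ys" using finite_distinct_list[OF S(1)] by blast
  \<comment> \<open>All neurons of the networks for the net points, each tagged with its net point,
    so that the coefficients for x can switch on a single block.\<close>
  define Q where "Q = concat (map (\<lambda>y. map (Pair y) (L y)) ys)"
  \<comment> \<open>One extra neuron makes J positive even if D, and with it the net, is empty.
    Neurons are numbered from 1 and list positions from 0; the extra one reads past the end of
    \<open>Q\<close> but receives coefficient 0.\<close>
  define J where "J = Suc (length Q)"
  define wv where "wv j = fst (snd (snd (Q ! (j - 1))))" for j
  define \<zeta> where "\<zeta> j = snd (snd (snd (Q ! (j - 1))))" for j
  have "\<exists>\<alpha> :: nat \<Rightarrow> nat \<Rightarrow> real. L2_norm \<Omega>Y (\<lambda>t. F x t -
      (\<Sum>j=1..J. \<Sum>k=1..1. \<alpha> j k * \<sigma> ((\<Sum>l=1..1. 0 * x s0) + 0) * \<sigma> (wv j \<bullet> t + \<zeta> j))) \<le> \<epsilon>"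
    if x: "x \<in> D" for x
  proof -
    obtain y where y: "y \<in> S" "L2_norm \<Omega>Y (\<lambda>t. F x t - F y t) < \<epsilon> / 2" using S(3)[OF x] by blast
    \<comment> \<open>Selects the block of the net point y near x. Division by \<sigma> 0, which is
      positive, cancels the constant first factor.\<close>
    define \<alpha> :: "nat \<Rightarrow> nat \<Rightarrow> real" where
      "\<alpha> j k = (if j \<le> length Q \<and> fst (Q ! (j - 1)) = y then fst (snd (Q ! (j - 1))) / \<sigma> 0 else 0)" for j k
    have "(\<Sum>j=1..J. \<Sum>k=1..1. \<alpha> j k * \<sigma> ((\<Sum>l=1..1. 0 * x s0) + 0) * \<sigma> (wv j \<bullet> t + \<zeta> j)) = net_eval \<sigma> (L y) t" for t
    proof -
      let ?g = "\<lambda>(y', c, w, z). if y' = y then c * \<sigma> (w \<bullet> t + z) else 0"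
      have "(\<Sum>j=1..J. \<Sum>k=1..1. \<alpha> j k * \<sigma> ((\<Sum>l=1..1. 0 * x s0) + 0) * \<sigma> (wv j \<bullet> t + \<zeta> j)) =
          (\<Sum>j=1..J. \<alpha> j 1 * \<sigma> 0 * \<sigma> (wv j \<bullet> t + \<zeta> j))"
        by simp
      also have "\<dots> = (\<Sum>j\<in>{0..<J}. \<alpha> (Suc j) 1 * \<sigma> 0 * \<sigma> (wv (Suc j) \<bullet> t + \<zeta> (Suc j)))"
        by (rule sum.reindex_bij_witness[of _ Suc "\<lambda>j. j - 1"]) auto
      also have "\<dots> = (\<Sum>j\<in>{0..<length Q}. ?g (Q ! j))"
        unfolding J_def using sigmoid_bounds(1)[OF \<sigma>, of 0]
        by (auto simp: \<alpha>_def wv_def \<zeta>_def case_prod_beta intro!: sum.cong)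
      also have "\<dots> = sum_list (map ?g Q)" by (simp add: sum_list_sum_nth)
      also have "\<dots> = (\<Sum>y'\<leftarrow>ys. if y' = y then net_eval \<sigma> (L y) t else 0)"
        unfolding Q_def
      proof (induction ys)
        case (Cons y' ys)
        have "sum_list (map ?g (map (Pair y') Ls)) = (if y' = y then net_eval \<sigma> Ls t else 0)" for Ls
          by (induction Ls) (auto simp: net_eval_def)
        with Cons show ?case by simp
      qed simp
      also have "\<dots> = (\<Sum>y'\<in>S. if y' = y then net_eval \<sigma> (L y) t else 0)"
        using ys by (simp add: sum_list_distinct_conv_sum_set)
      also have "\<dots> = net_eval \<sigma> (L y) t" using y(1) S(1) by simp
      finally show ?thesis .
    qed
    moreover have "L2_norm \<Omega>Y (\<lambda>t. F x t - net_eval \<sigma> (L y) t) \<le>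
        L2_norm \<Omega>Y (\<lambda>t. F x t - F y t) + L2_norm \<Omega>Y (\<lambda>t. F y t - net_eval \<sigma> (L y) t)"
    proof (rule L2_norm_triangle)
      show "F x \<in> L2_space \<Omega>Y" "F y \<in> L2_space \<Omega>Y" using assms(8) x y(1) S(2) by auto
      show "net_eval \<sigma> (L y) \<in> L2_space \<Omega>Y"
        unfolding L2_space_iff by (intro continuous_square_integrable net_eval_continuous \<sigma> Y)
    qed
    ultimately show ?thesis using L[OF y(1)] y(2) by (intro exI[of _ \<alpha>]) simp
  qed
  then show ?thesis
    \<comment> \<open>K = L = 1 with zero weights and thresholds makes every first factor \<sigma>
      0; any point of the domain may be the sampling point.\<close>
    using s0 by (intro exI[of _ J] exI[of _ 1] exI[of _ "\<lambda>_ _ _. 0"] exI[of _ "\<lambda>_ _. 0"] exI[of _ \<zeta>]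
        exI[of _ wv] exI[of _ "\<lambda>_. s0"] conjI) (simp_all add: J_def)
qed

end
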